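(* Let $n\ge1$. There is a constant $C$ depending only on $n$ such that the following holds. Suppose that $f$ is a function in $L^1(\gamma)$ on $\mathbb{R}^n$. If $\mathcal{M}_{\mathrm{loc}}f$ is in $L^1(\gamma)$ and $$E_+(f)=\int|x|^2|f(x)|\,d\gamma(x)<\infty,$$ then $f$ is in $H^1(\gamma)$ and $$\|f\|_{H^1(\gamma)}\le C\|\mathcal{M}_{\mathrm{loc}}f\|_{L^1(\gamma)}+C\,E_+(f).$$ If $f$ is nonnegative, the conditions $\mathcal{M}_{\mathrm{loc}}f\in L^1(\gamma)$ and $E_+(f)<\infty$ are also necessary for $f$ to be in $H^1(\gamma)$.
   Context: $\gamma$ is the Gauss measure on $\mathbb{R}^n$, with density $\gamma_0(x)=\pi^{-n/2}e^{-|x|^2}$ with respect to Lebesgue measure. A closed Euclidean ball $B$ with radius $r_B$ and centre $c_B$ is called admissible if $r_B\le\min(1,1/|c_B|)$ (where $\min(1,1/|x|)=1$ for $x=0$). A Gaussian atom is either the constant function $1$ or a function $a\in L^\infty(\gamma)$ supported in an admissible ball $B$ with $\int a\,d\gamma=0$ and $\|a\|_\infty\le\gamma(B)^{-1}$. $H^1(\gamma)$ is the space of all $f\in L^1(\gamma)$ that admit a decomposition $f=\sum_j\lambda_j a_j$ with $a_j$ Gaussian atoms and $(\lambda_j)$ a summable sequence of complex numbers; $\|f\|_{H^1(\gamma)}$ is the infimum of $\sum_j|\lambda_j|$ over all such representations. Let $\Phi=\{\phi\in C_c^1(B(0,1)):\ |D^\alpha\phi|\le1\ \text{for}\ |\alpha|=0,1\}$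 and $\phi_t(x)=t^{-n}\phi(x/t)$. The local grand maximal function is $$\mathcal{M}_{\mathrm{loc}}f(x)=\sup\{|\phi_t*f(x)|:\ \phi\in\Phi,\ 0<t<\min(1,1/|x|)\},$$ where the convolution is taken with respect to Lebesgue measure. *)

theory Defs
  imports "HOL-Analysis.Analysis"
begin

definition gauss :: "(real ^ 'n) measure" where
  "gauss = density lborel
     (\<lambda>x. ennreal (pi powr (- (real CARD('n) / 2)) * exp (- (norm x)\<^sup>2)))"

(* The value at 0 is given separately because 1 / 0 = 0 in HOL. *)
definition adm_radius :: "real ^ 'n \<Rightarrow> real" where
  "adm_radius x = (if x = 0 then 1 else min 1 (1 / norm x))"

definition admissible :: "real ^ 'n \<Rightarrow> real \<Rightarrow> bool" where
  "admissible c r \<longleftrightarrow> 0 < r \<and> r \<le> adm_radius c"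

(* Elements of the Lebesgue spaces are represented by Borel functions, so the support
   condition and the sup norm are taken modulo null sets. *)
definition gaussian_atom :: "(real ^ 'n \<Rightarrow> complex) \<Rightarrow> bool" where
  "gaussian_atom a \<longleftrightarrow> a = (\<lambda>_. 1) \<or>
     (\<exists>c r. admissible c r \<and> a \<in> borel_measurable gauss \<and>
        (AE x in gauss. x \<notin> cball c r \<longrightarrow> a x = 0) \<and>
        (AE x in gauss. norm (a x) \<le> 1 / measure gauss (cball c r)) \<and>
        (LINT x|gauss. a x) = 0)"

(* The series converges in L^1(gauss); since every atom has L^1 norm at most 1, this is the
   same as almost everywhere convergence.  Finite sums are covered by zero coefficients. *)
definition atomic_decomp ::
  "(real ^ 'n \<Rightarrow> complex) \<Rightarrow> (nat \<Rightarrow> complex) \<Rightarrow> (nat \<Rightarrow> real ^ 'n \<Rightarrow> complex) \<Rightarrow> bool" where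
  "atomic_decomp f l a \<longleftrightarrow>
     (\<forall>j. gaussian_atom (a j)) \<and> summable (\<lambda>j. norm (l j)) \<and>
     (\<lambda>N. \<integral>\<^sup>+x. ennreal (norm (f x - (\<Sum>j<N. l j * a j x))) \<partial>gauss) \<longlonglongrightarrow> 0"

definition H1 :: "(real ^ 'n \<Rightarrow> complex) set" where
  "H1 = {f. integrable gauss f \<and> (\<exists>l a. atomic_decomp f l a)}"

(* Meaningful for f in H1 only. *)
definition H1_norm :: "(real ^ 'n \<Rightarrow> complex) \<Rightarrow> real" where
  "H1_norm f = Inf {\<Sum>j. norm (l j) |l. \<exists>a. atomic_decomp f l a}"

definition partial_deriv :: "'n \<Rightarrow> (real ^ 'n \<Rightarrow> complex) \<Rightarrow> real ^ 'n \<Rightarrow> complex" where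
  "partial_deriv i \<phi> x = frechet_derivative \<phi> (at x) (axis i 1)"

definition test_functions :: "(real ^ 'n \<Rightarrow> complex) set" where
  "test_functions = {\<phi>.
     \<phi> differentiable_on UNIV \<and> (\<forall>i. continuous_on UNIV (partial_deriv i \<phi>)) \<and>
     closure {x. \<phi> x \<noteq> 0} \<subseteq> ball 0 1 \<and>
     (\<forall>x. norm (\<phi> x) \<le> 1) \<and> (\<forall>i x. norm (partial_deriv i \<phi> x) \<le> 1)}"

definition dilate :: "real \<Rightarrow> (real ^ 'n \<Rightarrow> complex) \<Rightarrow> real ^ 'n \<Rightarrow> complex" where
  "dilate t \<phi> x = (1 / t ^ CARD('n)) *\<^sub>R \<phi> ((1 / t) *\<^sub>R x)"

definition convol ::
  "(real ^ 'n \<Rightarrow> complex) \<Rightarrow> (real ^ 'n \<Rightarrow> complex) \<Rightarrow> real ^ 'n \<Rightarrow> complex" where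
  "convol g f x = (LINT y|lborel. g (x - y) * f y)"

(* The supremum can be infinite at individual points, hence values in ennreal. *)
definition Mloc :: "(real ^ 'n \<Rightarrow> complex) \<Rightarrow> real ^ 'n \<Rightarrow> ennreal" where
  "Mloc f x = (SUP \<phi>\<in>test_functions. SUP t\<in>{0<..<adm_radius x}.
     ennreal (norm (convol (dilate t \<phi>) f x)))"

definition L1_ennreal :: "(real ^ 'n \<Rightarrow> ennreal) \<Rightarrow> bool" where
  "L1_ennreal g \<longleftrightarrow> g \<in> borel_measurable gauss \<and> (\<integral>\<^sup>+x. g x \<partial>gauss) < \<infinity>"

definition E_plus :: "(real ^ 'n \<Rightarrow> complex) \<Rightarrow> ennreal" where
  "E_plus f = (\<integral>\<^sup>+x. ennreal ((norm x)\<^sup>2 * norm (f x)) \<partial>gauss)"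

end

theory Submission
  imports Defs "HOL-Real_Asymp.Real_Asymp"
begin

text \<open>
  Sufficiency. An admissible Whitney covering splits \<open>f\<close> into pieces. After subtraction of a multiple
  of a uniform density, which makes its mean vanish, each piece is decomposed into atoms by the
  Calderon--Zygmund argument on the superlevel sets \<open>\<Omega>\<^sub>k\<close> of its maximal function: the good parts
  \<open>g\<^sub>k\<close> telescope, and since \<open>f\<close> is itself integrable, \<open>g\<^sub>k\<close> converges to the piece almost everywhere,
  so that no estimate of maximal functions of the bad parts is needed. The subtracted densities are moved
  to the origin along chains of admissible balls; a chain starting at \<open>x\<close> has about \<open>1 + |x|\<^sup>2\<close>
  steps, which produces the term \<open>E\<^sub>+\<close>. The remaining density at the origin lies in \<open>H\<^sup>1\<close> because the
  same argument applies to the constant function 1, which is an atom.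

  Necessity. The maximal functions of atoms are uniformly bounded in \<open>L\<^sup>1\<close>, and so are their
  second moments, because \<open>|y|\<^sup>2\<close> is constant on an admissible ball up to a bounded error.
\<close>

subsection \<open>Atomic decompositions\<close>

text \<open>\<open>Mloc\<close> convolves \<open>f\<close> with respect to Lebesgue measure, while
  atoms have mean zero with respect to \<open>gauss\<close>. The decomposition is therefore carried
  out for the product of \<open>f\<close> with the Gaussian density, using Lebesgue means, and the
  pieces are divided by the density at the end. On an admissible ball \<open>|y|^2\<close> differs
  from its value at the centre by at most 3. The density, divided by its value at the centre, is
  thus bounded and varies slowly at the scale of the ball, so it can be merged into the test
  function; this is how \<open>Mloc f\<close> controls the weighted pieces.

  The local maximal function sees no large scales. A piece at a scale comparable to its whole ball
  can only be estimated through the integral of its modulus, so superlevel sets are used from the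
  mean height \<open>base\<close> upwards.

  Whitney coverings use a radius function \<open>\<rho>\<close> with Lipschitz constant 1/100.
  Within 20 radii of a centre it stays between 0.8 and 1.2 times the radius, which leaves room for
  the 5 radii of the Vitali cover, the 10 radii of the supports and the 20 radii within which
  overlaps are counted.\<close>

definition gdens :: "real ^ 'n \<Rightarrow> real" where
  "gdens x = pi powr (- (real CARD('n) / 2)) * exp (- (norm x)\<^sup>2)"

lemma gauss_eq: "gauss = density lborel (\<lambda>x::real^'n. ennreal (gdens x))"
  unfolding gauss_def gdens_def ..

lemma gdens_pos [simp]: "0 < gdens x" "0 \<le> gdens x" "gdens x \<noteq> 0"
  by (simp_all add: gdens_def)

lemma continuous_gdens: "continuous_on S gdens"
  unfolding gdens_def by (intro continuous_intros)

lemma gdens_measurable [measurable]: "gdens \<in> borel_measurable borel"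
  by (intro borel_measurable_continuous_onI continuous_gdens)

lemma sets_gauss [simp, measurable_cong]: "sets gauss = sets borel"
  and space_gauss [simp]: "space gauss = UNIV"
  by (simp_all add: gauss_eq)

lemma measurable_gauss_iff [simp]: "measurable gauss M = measurable borel M"
  by (intro measurable_cong_sets) auto

lemma AE_gauss: "(AE x in gauss. P x) \<longleftrightarrow> (AE x in lborel. P x)"
  unfolding gauss_eq by (subst AE_density) auto

lemma nn_integral_gauss:
  "f \<in> borel_measurable borel \<Longrightarrow> (\<integral>\<^sup>+x. f x \<partial>gauss) = (\<integral>\<^sup>+x. ennreal (gdens x) * f x \<partial>lborel)"
  unfolding gauss_eq by (subst nn_integral_density) auto

lemma
  fixes f :: "real^'n \<Rightarrow> complex"
  assumes [measurable]: "f \<in> borel_measurable borel"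
  shows integrable_gauss: "integrable gauss f \<longleftrightarrow> integrable lborel (\<lambda>x. gdens x *\<^sub>R f x)"
    and integral_gauss: "(LINT x|gauss. f x) = (LINT x|lborel. gdens x *\<^sub>R f x)"
  unfolding gauss_eq by (subst integrable_density integral_density; simp)+

lemma suminf_ennreal_finite:
  fixes f :: "nat \<Rightarrow> real"
  assumes "\<And>i. 0 \<le> f i" "summable f"
  shows "(\<Sum>i. ennreal (f i)) < \<infinity>"
  by (subst suminf_ennreal2[OF assms]) (rule ennreal_less_top[folded infinity_ennreal_def])

abbreviation uvol :: "'n::finite itself \<Rightarrow> real" where
  "uvol _ \<equiv> unit_ball_vol (real CARD('n))"

lemma emeasure_ball_vec:
  "0 \<le> r \<Longrightarrow> emeasure lborel (ball (c::real^'n) r) = ennreal (uvol TYPE('n) * r ^ CARD('n))"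
  by (simp add: emeasure_ball)

lemma emeasure_cball_vec:
  "0 \<le> r \<Longrightarrow> emeasure lborel (cball (c::real^'n) r) = ennreal (uvol TYPE('n) * r ^ CARD('n))"
  by (simp add: emeasure_cball)

text \<open>On the shell \<open>k <= |x| < k + 1\<close> the integrand is at most
  \<open>P * a k\<close>, and Gaussian decay beats the volume of the shells. Only finiteness of the
  mass and of the second moment enters later, so no Gaussian integral has to be evaluated.\<close>

lemma gauss_moment_finite: "(\<integral>\<^sup>+x. ennreal (1 + (norm x)\<^sup>2) \<partial>(gauss :: (real^'n) measure)) < \<infinity>"
proof -
  define a where "a k = (1 + (real k + 1)\<^sup>2) * exp (- (real k)\<^sup>2)" for k :: nat
  define P where "P = pi powr (- (real CARD('n) / 2))"
  define V where "V = uvol TYPE('n)"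
  have V: "0 \<le> V" and P: "0 \<le> P" by (simp_all add: V_def P_def)
  have a0: "0 \<le> a k" for k by (simp add: a_def)
  have bd: "ennreal (gdens x) * ennreal (1 + (norm x)\<^sup>2) \<le> (\<Sum>k. ennreal (P * a k) * indicator (ball 0 (real k + 1)) x)"
    for x :: "real^'n"
  proof -
    define k where "k = nat \<lfloor>norm x\<rfloor>"
    have k: "real k \<le> norm x" "norm x < real k + 1"
      unfolding k_def using norm_ge_zero[of x] by (simp_all; linarith)+
    have "gdens x * (1 + (norm x)\<^sup>2) = P * ((1 + (norm x)\<^sup>2) * exp (-(norm x)\<^sup>2))"
      by (simp add: gdens_def P_def)
    also have "\<dots> \<le> P * a k"
      unfolding a_def using k P
      by (intro mult_left_mono mult_mono add_left_mono power_mono) (auto intro!: power_mono)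
    finally have "ennreal (gdens x) * ennreal (1 + (norm x)\<^sup>2) \<le> ennreal (P * a k)"
      by (simp del: ennreal_plus add: ennreal_mult'[symmetric] ennreal_leI)
    also have "\<dots> = ennreal (P * a k) * indicator (ball 0 (real k + 1)) x" using k by simp
    also have "\<dots> \<le> (\<Sum>k. ennreal (P * a k) * indicator (ball 0 (real k + 1)) x)"
      using sum_le_suminf[of "\<lambda>k. ennreal (P * a k) * indicator (ball 0 (real k + 1)) x" "{k}"]
      by (simp only: summableI zero_le finite.intros sum.insert sum.empty add_0_right empty_iff not_False_eq_True simp_thms)
    finally show ?thesis .
  qed
  have sm: "summable (\<lambda>k. P * a k * (V * (real k + 1) ^ CARD('n)))"
  proof (rule summable_comparison_test_bigo)
    show "summable (\<lambda>k. norm (1 / (real k)^2))"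
      using inverse_power_summable[of 2, where 'a=real] by (simp add: field_simps)
    show "(\<lambda>k. P * a k * (V * (real k + 1) ^ CARD('n))) \<in> O(\<lambda>k. 1 / (real k)^2)"
    proof -
      have "(\<lambda>k::nat. a k * (real k + 1) ^ CARD('n)) \<in> O(\<lambda>k. 1 / (real k)^2)"
        unfolding a_def by real_asymp
      from landau_o.big.mult[OF _ this, of "\<lambda>_. P * V" "\<lambda>_. 1"] show ?thesis
        by (simp add: mult_ac)
    qed
  qed
  have "(\<integral>\<^sup>+x. ennreal (1 + (norm x)\<^sup>2) \<partial>(gauss :: (real^'n) measure))
      = (\<integral>\<^sup>+x. ennreal (gdens x) * ennreal (1 + (norm x)\<^sup>2) \<partial>(lborel :: (real^'n) measure))"
    by (rule nn_integral_gauss) measurable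
  also have "\<dots> \<le> (\<integral>\<^sup>+x. (\<Sum>k. ennreal (P * a k) * indicator (ball 0 (real k + 1)) x) \<partial>(lborel :: (real^'n) measure))"
    by (intro nn_integral_mono bd)
  also have "\<dots> = (\<Sum>k. \<integral>\<^sup>+x. ennreal (P * a k) * indicator (ball 0 (real k + 1)) x \<partial>(lborel :: (real^'n) measure))"
    by (rule nn_integral_suminf) (auto intro!: borel_measurable_times_ennreal borel_measurable_indicator)
  also have "\<dots> = (\<Sum>k. ennreal (P * a k * (V * (real k + 1) ^ CARD('n))))"
  proof (rule suminf_cong)
    fix k :: nat
    have "(\<integral>\<^sup>+x. ennreal (P * a k) * indicator (ball 0 (real k + 1)) x \<partial>(lborel :: (real^'n) measure))
      = ennreal (P * a k) * emeasure lborel (ball (0::real^'n) (real k + 1))"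
      by (rule nn_integral_cmult_indicator) simp
    also have "\<dots> = ennreal (P * a k * (V * (real k + 1) ^ CARD('n)))"
      unfolding V_def using a0 P by (subst emeasure_ball_vec) (auto intro!: ennreal_mult'[symmetric])
    finally show "(\<integral>\<^sup>+x. ennreal (P * a k) * indicator (ball 0 (real k + 1)) x \<partial>(lborel :: (real^'n) measure))
       = ennreal (P * a k * (V * (real k + 1) ^ CARD('n)))" .
  qed
  also have "\<dots> < \<infinity>"
    using sm a0 P V by (intro suminf_ennreal_finite) simp_all
  finally show ?thesis .
qed

lemma gauss_finite: "emeasure (gauss :: (real^'n) measure) UNIV < \<infinity>"
proof -
  have "emeasure (gauss :: (real^'n) measure) UNIV = (\<integral>\<^sup>+x. 1 \<partial>(gauss :: (real^'n) measure))" by simp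
  also have "\<dots> \<le> (\<integral>\<^sup>+x. ennreal (1 + (norm x)\<^sup>2) \<partial>(gauss :: (real^'n) measure))"
    by (intro nn_integral_mono) (simp add: ennreal_ge_1)
  also note gauss_moment_finite
  finally show ?thesis .
qed

lemma finite_measure_gauss: "finite_measure (gauss :: (real^'n) measure)"
  using gauss_finite[where 'n='n] by (intro finite_measureI) auto

lemma atom_measurable [measurable_dest]: "gaussian_atom a \<Longrightarrow> a \<in> borel_measurable borel"
  by (auto simp: gaussian_atom_def)

text \<open>A ball atom has norm at most 1 by its sup bound, the constant atom has the total mass as
  its norm. The sum of the two bounds covers both kinds of atom.\<close>

lemma atom_L1:
  fixes a :: "real^'n \<Rightarrow> complex"
  assumes "gaussian_atom a"
  shows "(\<integral>\<^sup>+x. ennreal (norm (a x)) \<partial>gauss) \<le> ennreal (1 + measure gauss (UNIV :: (real^'n) set))"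
proof -
  interpret finite_measure "gauss :: (real^'n) measure" by (rule finite_measure_gauss)
  show ?thesis
  proof (cases "a = (\<lambda>_. 1)")
    case True
    then show ?thesis by (simp add: emeasure_eq_measure)
  next
    case False
    then obtain c r where *: "AE x in gauss. x \<notin> cball c r \<longrightarrow> a x = 0"
       "AE x in gauss. norm (a x) \<le> 1 / measure gauss (cball c r)"
      using assms unfolding gaussian_atom_def by blast
    have "(\<integral>\<^sup>+x. ennreal (norm (a x)) \<partial>gauss) \<le>
        (\<integral>\<^sup>+x. ennreal (1 / measure gauss (cball c r)) * indicator (cball c r) x \<partial>gauss)"
    proof (rule nn_integral_mono_AE, use * in eventually_elim)
      case (elim x)
      then show ?case by (cases "x \<in> cball c r") (auto intro!: ennreal_leI)
    qed
    also have "\<dots> = ennreal (1 / measure gauss (cball c r) * measure gauss (cball c r))"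
      by (subst nn_integral_cmult_indicator) (simp_all only: emeasure_eq_measure ennreal_mult divide_nonneg_nonneg zero_le_one measure_nonneg sets_gauss sets_lborel[symmetric] fmeasurableD lmeasurable_cball, auto)
    also have "\<dots> \<le> ennreal (1 + measure gauss (UNIV :: (real^'n) set))"
      by (intro ennreal_leI) auto
    finally show ?thesis .
  qed
qed

text \<open>Atoms are uniformly bounded in \<open>L^1\<close>, so summable coefficients give a
  finite integral of the absolute series. Absolute convergence at almost every point is what makes
  the later rearrangements legitimate.\<close>

lemma atom_series_finite:
  fixes a :: "nat \<Rightarrow> real^'n \<Rightarrow> complex"
  assumes a: "\<And>j. gaussian_atom (a j)" and l: "summable (\<lambda>j. norm (l j))"
  shows "(\<integral>\<^sup>+x. (\<Sum>j. ennreal (norm (l j * a j x))) \<partial>gauss) < \<infinity>"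
    and "AE x in gauss. summable (\<lambda>j. norm (l j * a j x))"
proof -
  let ?G = "1 + measure gauss (UNIV :: (real^'n) set)"
  note [measurable] = atom_measurable[OF a]
  have "(\<integral>\<^sup>+x. (\<Sum>j. ennreal (norm (l j * a j x))) \<partial>gauss) = (\<Sum>j. \<integral>\<^sup>+x. ennreal (norm (l j * a j x)) \<partial>gauss)"
    by (rule nn_integral_suminf) measurable
  also have "\<dots> = (\<Sum>j. ennreal (norm (l j)) * \<integral>\<^sup>+x. ennreal (norm (a j x)) \<partial>gauss)"
    by (simp add: norm_mult ennreal_mult nn_integral_cmult)
  also have "\<dots> \<le> (\<Sum>j. ennreal (norm (l j) * ?G))"
  proof (intro suminf_le allI)
    fix j
    have "ennreal (norm (l j) * ?G) = ennreal (norm (l j)) * ennreal ?G" by (intro ennreal_mult) auto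
    then show "ennreal (norm (l j)) * (\<integral>\<^sup>+x. ennreal (norm (a j x)) \<partial>gauss) \<le> ennreal (norm (l j) * ?G)"
      using atom_L1[OF a[of j]] by (metis mult_left_mono zero_le)
  qed (rule summableI)+
  also have "\<dots> < \<infinity>"
    using summable_mult2[OF l, of ?G] by (intro suminf_ennreal_finite) simp_all
  finally show fin: "(\<integral>\<^sup>+x. (\<Sum>j. ennreal (norm (l j * a j x))) \<partial>gauss) < \<infinity>" .
  have "AE x in gauss. (\<Sum>j. ennreal (norm (l j * a j x))) \<noteq> \<infinity>"
  proof (rule nn_integral_PInf_AE)
    show "(\<lambda>x. \<Sum>j. ennreal (norm (l j * a j x))) \<in> borel_measurable gauss" by measurable
    show "(\<integral>\<^sup>+x. (\<Sum>j. ennreal (norm (l j * a j x))) \<partial>gauss) \<noteq> \<infinity>" using fin by (rule less_imp_neq)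
  qed
  then show "AE x in gauss. summable (\<lambda>j. norm (l j * a j x))"
    by eventually_elim (rule summable_suminf_not_top, rule norm_ge_zero, simp only: infinity_ennreal_def not_False_eq_True)
qed

text \<open>Almost everywhere convergence of the series replaces convergence in \<open>L\<^sup>1\<close>:
  the two are equivalent here, and only the former is stable under rearrangement at no cost.\<close>

definition dec :: "(real^'n \<Rightarrow> complex) \<Rightarrow> real \<Rightarrow> bool" where
  "dec f \<Lambda> \<longleftrightarrow> (\<exists>l a. (\<forall>j. gaussian_atom (a j)) \<and> summable (\<lambda>j. norm (l j)) \<and>
     (\<Sum>j. norm (l j)) \<le> \<Lambda> \<and> (AE x in gauss. (\<lambda>j. l j * a j x) sums f x))"

text \<open>Returns from pointwise to \<open>L^1\<close> convergence: the remainder after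
  \<open>N\<close> terms is dominated by the tail of the absolute series, whose integral
  \<open>T N\<close> is the tail of a convergent numerical series.\<close>

lemma dec_atomic_decomp:
  fixes f :: "real^'n \<Rightarrow> complex"
  assumes "dec f \<Lambda>" and [measurable]: "f \<in> borel_measurable borel"
  obtains l a where "atomic_decomp f l a" "(\<Sum>j. norm (l j)) \<le> \<Lambda>"
proof -
  from assms(1) obtain l a where a: "\<And>j. gaussian_atom (a j)" and l: "summable (\<lambda>j. norm (l j))"
    and le: "(\<Sum>j. norm (l j)) \<le> \<Lambda>" and sums: "AE x in gauss. (\<lambda>j. l j * a j x) sums f x"
    unfolding dec_def by blast
  note [measurable] = atom_measurable[OF a]
  let ?e = "\<lambda>j x. ennreal (norm (l j * a j x))"
  have fin: "(\<Sum>j. \<integral>\<^sup>+x. ?e j x \<partial>gauss) < \<infinity>"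
    using atom_series_finite(1)[where a=a, OF a l] by (subst nn_integral_suminf[symmetric]) auto
  define T where "T N = (\<Sum>j. \<integral>\<^sup>+x. ?e (j + N) x \<partial>gauss)" for N
  have bd: "(\<integral>\<^sup>+x. ennreal (norm (f x - (\<Sum>j<N. l j * a j x))) \<partial>gauss) \<le> T N" for N
  proof -
    have "(\<integral>\<^sup>+x. ennreal (norm (f x - (\<Sum>j<N. l j * a j x))) \<partial>gauss) \<le>
       (\<integral>\<^sup>+x. (\<Sum>j. ?e (j + N) x) \<partial>gauss)"
    proof (rule nn_integral_mono_AE, use sums atom_series_finite(2)[where a=a, OF a l] in eventually_elim)
      case (elim x)
      have s: "summable (\<lambda>j. norm (l (j + N) * a (j + N) x))"
        using elim(2) by (subst summable_iff_shift)
      have "f x - (\<Sum>j<N. l j * a j x) = (\<Sum>j. l (j + N) * a (j + N) x)"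
        using suminf_minus_initial_segment[of "\<lambda>j. l j * a j x" N] elim(1)
        by (simp add: sums_iff)
      then have "norm (f x - (\<Sum>j<N. l j * a j x)) \<le> (\<Sum>j. norm (l (j + N) * a (j + N) x))"
        using summable_norm[OF s] by simp
      then show ?case
        using s by (subst suminf_ennreal2) (auto intro: ennreal_leI)
    qed
    also have "\<dots> = T N" unfolding T_def by (rule nn_integral_suminf) measurable
    finally show ?thesis .
  qed
  define u where "u j = enn2real (\<integral>\<^sup>+x. ?e j x \<partial>gauss)" for j
  have uj: "(\<integral>\<^sup>+x. ?e j x \<partial>gauss) = ennreal (u j)" for j
    using fin ennreal_suminf_lessD[OF fin[unfolded infinity_ennreal_def], of j]
    by (simp add: u_def ennreal_enn2real_if)
  have u0: "0 \<le> u j" for j by (simp add: u_def)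
  have su: "summable u"
    using fin[unfolded uj] u0 by (intro summable_suminf_not_top) simp_all
  have "T = (\<lambda>N. ennreal (\<Sum>j. u (j + N)))"
    unfolding T_def uj using summable_ignore_initial_segment[OF su] u0 by (intro ext suminf_ennreal2)
  moreover have "(\<lambda>N. ennreal (\<Sum>j. u (j + N))) \<longlonglongrightarrow> ennreal 0"
    by (intro tendsto_ennrealI suminf_exist_split2 su)
  ultimately have "T \<longlonglongrightarrow> 0" by simp
  then have "(\<lambda>N. \<integral>\<^sup>+x. ennreal (norm (f x - (\<Sum>j<N. l j * a j x))) \<partial>gauss) \<longlonglongrightarrow> 0"
    by (rule tendsto_sandwich[where f="\<lambda>_. 0" and h=T, rotated 2, OF tendsto_const]) (simp_all only: bd zero_le eventually_True)
  then have "atomic_decomp f l a" using a l unfolding atomic_decomp_def by auto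
  then show ?thesis using le that by auto
qed

lemma dec_H1:
  assumes "dec f \<Lambda>" "integrable gauss f"
  shows "f \<in> H1" "H1_norm f \<le> \<Lambda>"
proof -
  obtain l a where *: "atomic_decomp f l a" "(\<Sum>j. norm (l j)) \<le> \<Lambda>"
    using dec_atomic_decomp[OF assms(1)] assms(2) by (metis borel_measurable_integrable measurable_gauss_iff)
  show "f \<in> H1" using * assms(2) by (auto simp: H1_def)
  have "H1_norm f \<le> (\<Sum>j. norm (l j))"
    unfolding H1_norm_def
  proof (rule cInf_lower)
    show "(\<Sum>j. norm (l j)) \<in> {\<Sum>j. norm (l j) |l. \<exists>a. atomic_decomp f l a}" using * by blast
    show "bdd_below {\<Sum>j. norm (l j) |l. \<exists>a. atomic_decomp f l a}"
      by (auto intro!: bdd_belowI[of _ 0] suminf_nonneg simp: atomic_decomp_def)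
  qed
  with * show "H1_norm f \<le> \<Lambda>" by simp
qed

lemma dec_nonneg: "dec f \<Lambda> \<Longrightarrow> 0 \<le> \<Lambda>"
  unfolding dec_def by (auto intro: order_trans[OF suminf_nonneg])

lemma dec_mono: "dec f \<Lambda> \<Longrightarrow> \<Lambda> \<le> \<Lambda>' \<Longrightarrow> dec f \<Lambda>'"
  unfolding dec_def by (meson order_trans)

lemma dec_cong: "dec f \<Lambda> \<Longrightarrow> AE x in gauss. f x = g x \<Longrightarrow> dec g \<Lambda>"
proof -
  assume f: "dec f \<Lambda>" and eq: "AE x in gauss. f x = g x"
  then obtain l a where *: "\<forall>j. gaussian_atom (a j)" "summable (\<lambda>j. norm (l j))" "(\<Sum>j. norm (l j)) \<le> \<Lambda>"
    and s: "AE x in gauss. (\<lambda>j. l j * a j x) sums f x"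
    unfolding dec_def by blast
  from s eq have "AE x in gauss. (\<lambda>j. l j * a j x) sums g x" by eventually_elim simp
  with * show ?thesis unfolding dec_def by (intro exI[of _ l] exI[of _ a]) simp
qed

lemma atom_one: "gaussian_atom (\<lambda>_. 1)"
  by (simp add: gaussian_atom_def)

lemma dec_cmult_atom:
  assumes "gaussian_atom a"
  shows "dec (\<lambda>x. z * a x) (norm z)"
proof -
  have "(\<lambda>j. (if j = 0 then z else 0) * a x) sums (z * a x)" for x
    using sums_single[of 0 "\<lambda>_. z * a x"] by (simp add: if_distrib[of "\<lambda>u. u * a x"] cong: if_cong)
  moreover have "(\<lambda>j::nat. norm (if j = 0 then z else 0)) sums norm z"
    using sums_single[of 0 "\<lambda>_. norm z"] by (simp add: if_distrib[of norm] cong: if_cong)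
  ultimately show ?thesis unfolding dec_def
    by (intro exI[of _ "\<lambda>j. if j = 0 then z else 0"] exI[of _ "\<lambda>_. a"]) (auto simp: assms sums_iff)
qed

lemma dec_zero: "dec (\<lambda>_. 0) 0"
  using dec_cmult_atom[OF atom_one, of 0] by simp

text \<open>The double family of coefficients and atoms is enumerated through
  \<open>prod_decode\<close>; by Tonelli its coefficients remain summable. At almost every point the
  rearranged series converges absolutely, and iterated unordered summation identifies its value with
  \<open>f x\<close>.\<close>

lemma dec_sums:
  fixes f :: "real^'n \<Rightarrow> complex"
  assumes F: "\<And>m. dec (F m) (\<Lambda> m)" and \<Lambda>: "summable \<Lambda>" and f: "AE x in gauss. (\<lambda>m. F m x) sums f x"
  shows "dec f (\<Sum>m. \<Lambda> m)"
proof -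
  from F have "\<forall>m. \<exists>l a. (\<forall>j. gaussian_atom (a j)) \<and> summable (\<lambda>j. norm (l j)) \<and>
     (\<Sum>j. norm (l j)) \<le> \<Lambda> m \<and> (AE x in gauss. (\<lambda>j. l j * a j x) sums F m x)"
    unfolding dec_def by blast
  then obtain l a where a: "\<And>m j. gaussian_atom (a m j)" and l: "\<And>m. summable (\<lambda>j. norm (l m j))"
    and le: "\<And>m. (\<Sum>j. norm (l m j)) \<le> \<Lambda> m" and sm: "\<And>m. AE x in gauss. (\<lambda>j. l m j * a m j x) sums F m x"
    unfolding choice_iff by blast
  define l' where "l' p = (case prod_decode p of (m, i) \<Rightarrow> l m i)" for p
  define a' where "a' p = (case prod_decode p of (m, i) \<Rightarrow> a m i)" for p
  have \<Lambda>0: "0 \<le> \<Lambda> m" for m using dec_nonneg[OF F] .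
  have "(\<Sum>p. ennreal (norm (l' p))) = (\<Sum>p. (\<lambda>(m,i). ennreal (norm (l m i))) (prod_decode p))"
    by (simp add: l'_def split_beta)
  also have "\<dots> = (\<Sum>m. \<Sum>i. ennreal (norm (l m i)))"
    by (rule suminf_ennreal_2dimen) simp
  also have "\<dots> = (\<Sum>m. ennreal (\<Sum>i. norm (l m i)))"
    using l by (intro suminf_cong suminf_ennreal2) auto
  also have "\<dots> \<le> (\<Sum>m. ennreal (\<Lambda> m))"
    using le by (intro suminf_le allI ennreal_leI) auto
  also have "\<dots> = ennreal (\<Sum>m. \<Lambda> m)"
    using \<Lambda> \<Lambda>0 by (intro suminf_ennreal2)
  finally have tot: "(\<Sum>p. ennreal (norm (l' p))) \<le> ennreal (\<Sum>m. \<Lambda> m)" .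
  have l': "summable (\<lambda>p. norm (l' p))"
    using tot by (intro summable_suminf_not_top) (auto simp: top_unique)
  have le': "(\<Sum>p. norm (l' p)) \<le> (\<Sum>m. \<Lambda> m)"
    using tot l' suminf_nonneg[OF \<Lambda> \<Lambda>0] by (simp add: suminf_ennreal2)
  have a': "gaussian_atom (a' p)" for p by (simp add: a'_def a split: prod.split)
  have "AE x in gauss. \<forall>m. (\<lambda>j. l m j * a m j x) sums F m x"
    using sm by (simp add: AE_all_countable)
  with f atom_series_finite(2)[where a=a', OF a' l']
  have "AE x in gauss. (\<lambda>p. l' p * a' p x) sums f x"
  proof eventually_elim
    case (elim x)
    let ?g = "\<lambda>(m,i). l m i * a m i x"
    have eq: "?g (prod_decode p) = l' p * a' p x" for p
      by (simp add: l'_def a'_def split: prod.split)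
    have "(\<lambda>p. norm (l' p * a' p x)) summable_on UNIV"
      using elim(2) by (intro summable_nonneg_imp_summable_on) auto
    then have abs: "(\<lambda>p. norm (?g (prod_decode p))) summable_on UNIV" by (simp add: eq)
    then have "(\<lambda>q. norm (?g q)) summable_on (UNIV :: (nat \<times> nat) set)"
      by (subst summable_on_reindex_bij_betw[OF bij_prod_decode, symmetric])
    then have gs: "?g summable_on (Sigma UNIV (\<lambda>_. UNIV))"
      using abs_summable_summable[of ?g UNIV] by simp
    then obtain S where S: "(?g has_sum S) (Sigma UNIV (\<lambda>_. UNIV))"
      unfolding summable_on_def by blast
    have inner: "((\<lambda>i. ?g (m, i)) has_sum F m x) UNIV" for m
    proof -
      have "(\<lambda>i. ?g (m, i)) summable_on UNIV"
        using summable_on_SigmaD1[of "\<lambda>m i. l m i * a m i x" UNIV "\<lambda>_. UNIV" m] gs by (simp add: case_prod_unfold)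
      then obtain s where s: "((\<lambda>i. ?g (m, i)) has_sum s) UNIV" unfolding summable_on_def by blast
      from has_sum_imp_sums[OF this] elim(3) have "s = F m x"
        by (auto dest: sums_unique2)
      with s show ?thesis by simp
    qed
    have "((\<lambda>m. F m x) has_sum S) UNIV"
      by (rule has_sum_SigmaD[OF S inner])
    from has_sum_imp_sums[OF this] elim(1) have "S = f x" by (auto dest: sums_unique2)
    with S have "(?g has_sum f x) UNIV" by simp
    then have "((\<lambda>p. ?g (prod_decode p)) has_sum f x) UNIV"
      by (subst has_sum_reindex_bij_betw[OF bij_prod_decode])
    then show ?case unfolding eq by (rule has_sum_imp_sums)
  qed
  with a' l' le' show ?thesis unfolding dec_def by blast
qed

lemma dec_add:
  assumes "dec f A" "dec g B"
  shows "dec (\<lambda>x. f x + g x) (A + B)"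
proof -
  define F where "F m = (if m = 0 then f else if m = Suc 0 then g else (\<lambda>_. 0))" for m
  define L where "L m = (if m = 0 then A else if m = Suc 0 then B else 0)" for m
  have L: "L sums (A + B)"
    using sums_finite[of "{0, Suc 0}" L] by (simp add: L_def)
  have "dec (\<lambda>x. f x + g x) (\<Sum>m. L m)"
  proof (rule dec_sums[where F=F])
    show "dec (F m) (L m)" for m using assms dec_zero by (auto simp: F_def L_def)
    show "summable L" using L by (rule sums_summable)
    show "AE x in gauss. (\<lambda>m. F m x) sums (f x + g x)"
    proof (rule AE_I2)
      fix x show "(\<lambda>m. F m x) sums (f x + g x)"
        using sums_finite[of "{0, Suc 0}" "\<lambda>m. F m x"] by (simp add: F_def)
    qed
  qed
  then show ?thesis using L by (simp add: sums_iff)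
qed

lemma dec_cmult:
  assumes "dec f A"
  shows "dec (\<lambda>x. z * f x) (norm z * A)"
proof -
  from assms obtain l a where a: "\<And>j. gaussian_atom (a j)" and l: "summable (\<lambda>j. norm (l j))"
    and le: "(\<Sum>j. norm (l j)) \<le> A" and sums: "AE x in gauss. (\<lambda>j. l j * a j x) sums f x"
    unfolding dec_def by blast
  have "AE x in gauss. (\<lambda>j. (z * l j) * a j x) sums (z * f x)"
    using sums by eventually_elim (unfold mult.assoc, rule sums_mult)
  moreover have "(\<Sum>j. norm (z * l j)) \<le> norm z * A"
    unfolding norm_mult suminf_mult[OF l] using le by (intro mult_left_mono) simp_all
  moreover have "summable (\<lambda>j. norm (z * l j))" unfolding norm_mult by (rule summable_mult[OF l])
  ultimately show ?thesis unfolding dec_def using a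
    by (intro exI[of _ "\<lambda>j. z * l j"] exI[of _ a]) simp
qed

subsection \<open>Admissible balls and test functions\<close>

text \<open>The maximum in the denominator absorbs the special value at 0, so that positivity, the
  bound 1 and the Lipschitz estimate follow without a case distinction.\<close>

lemma adm_radius_eq: "adm_radius x = 1 / max 1 (norm x)"
proof (cases "x = 0")
  case False
  then have "min 1 (1 / norm x) = 1 / max 1 (norm x)"
    by (cases "norm x \<le> 1") (auto simp: min_def max_def divide_le_eq_1 le_divide_eq_1)
  with False show ?thesis by (simp add: adm_radius_def)
qed (simp add: adm_radius_def)

lemma adm_radius_pos [simp]: "0 < adm_radius x" and adm_radius_le_1: "adm_radius x \<le> 1"
  by (simp_all add: adm_radius_eq)

lemma adm_radius_mult_norm_le: "adm_radius x * norm x \<le> 1"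
  by (simp add: adm_radius_eq field_simps)

text \<open>Reciprocals of two numbers that are at least 1 differ by no more than the numbers
  do.\<close>

lemma adm_radius_lipschitz: "\<bar>adm_radius x - adm_radius y\<bar> \<le> dist x y"
proof -
  define u v where "u = max 1 (norm x)" and "v = max 1 (norm y)"
  have uv: "1 \<le> u" "1 \<le> v" by (simp_all add: u_def v_def)
  then have "1 \<le> u * v" using mult_mono[of 1 u 1 v] by simp
  have "adm_radius x - adm_radius y = (v - u) / (u * v)"
    using uv unfolding adm_radius_eq u_def[symmetric] v_def[symmetric] by (subst diff_frac_eq) auto
  then have "\<bar>adm_radius x - adm_radius y\<bar> = \<bar>v - u\<bar> / (u * v)"
    using uv by (simp only: abs_divide abs_mult)
  also have "\<dots> \<le> \<bar>v - u\<bar> / 1" using \<open>1 \<le> u * v\<close> by (intro divide_left_mono) auto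
  also have "\<dots> = \<bar>v - u\<bar>" by simp
  also have "\<dots> \<le> \<bar>norm x - norm y\<bar>" unfolding u_def v_def by linarith
  also have "\<dots> \<le> dist x y" unfolding dist_norm by (rule norm_triangle_ineq3)
  finally show ?thesis .
qed

lemma norm_sq_diff_le: "\<bar>(norm x)\<^sup>2 - (norm y)\<^sup>2\<bar> \<le> dist x y * (norm x + norm y)" for x y :: "'a::real_normed_vector"
proof -
  have "(norm x)\<^sup>2 - (norm y)\<^sup>2 = (norm x - norm y) * (norm x + norm y)"
    by (simp add: power2_eq_square algebra_simps)
  then have "\<bar>(norm x)\<^sup>2 - (norm y)\<^sup>2\<bar> = \<bar>norm x - norm y\<bar> * (norm x + norm y)"
    by (simp add: abs_mult)
  also have "\<dots> \<le> dist x y * (norm x + norm y)"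
    unfolding dist_norm by (intro mult_right_mono norm_triangle_ineq3) simp
  finally show ?thesis .
qed

text \<open>The difference of squares is at most \<open>d * (2 * norm c + d)\<close> with
  \<open>d = dist x c\<close>, and \<open>adm_radius c * norm c <= 1\<close> absorbs the growth of
  \<open>norm c\<close>. This is the geometric reason for the size of admissible balls. The
  recurring constants \<open>exp 3\<close> and \<open>exp 8\<close> are
  \<open>exp (2 * k + k^2)\<close> for \<open>k = 1\<close> and \<open>k = 2\<close>.\<close>

lemma norm_sq_diff_adm:
  fixes x c :: "real^'n"
  assumes "dist x c \<le> k * adm_radius c" "0 \<le> k"
  shows "\<bar>(norm x)\<^sup>2 - (norm c)\<^sup>2\<bar> \<le> 2 * k + k\<^sup>2"
proof -
  have "norm x \<le> norm c + dist x c"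
    unfolding dist_norm using norm_triangle_sub[of x c] by simp
  then have "\<bar>(norm x)\<^sup>2 - (norm c)\<^sup>2\<bar> \<le> dist x c * (2 * norm c + dist x c)"
    by (intro order_trans[OF norm_sq_diff_le] mult_left_mono) auto
  also have "\<dots> \<le> (k * adm_radius c) * (2 * norm c + k * adm_radius c)"
    using assms by (intro mult_mono add_left_mono) (auto simp: less_imp_le)
  also have "\<dots> = 2 * k * (adm_radius c * norm c) + (k * adm_radius c)\<^sup>2"
    by (simp add: power2_eq_square algebra_simps)
  also have "\<dots> \<le> 2 * k * 1 + k\<^sup>2"
    using assms adm_radius_mult_norm_le[of c] adm_radius_le_1[of c] less_imp_le[OF adm_radius_pos[of c]]
    by (intro add_mono mult_left_mono power_mono) (auto simp: mult_le_cancel_left2)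
  finally show ?thesis by simp
qed

lemma gdens_comparable:
  fixes x c :: "real^'n"
  assumes "dist x c \<le> k * adm_radius c" "0 \<le> k"
  shows "gdens x \<le> exp (2 * k + k\<^sup>2) * gdens c" "gdens c \<le> exp (2 * k + k\<^sup>2) * gdens x"
proof -
  note d = norm_sq_diff_adm[OF assms]
  have "exp (- (norm x)\<^sup>2) \<le> exp (2 * k + k\<^sup>2) * exp (- (norm c)\<^sup>2)"
       "exp (- (norm c)\<^sup>2) \<le> exp (2 * k + k\<^sup>2) * exp (- (norm x)\<^sup>2)"
    using d unfolding exp_add[symmetric] exp_le_cancel_iff by auto
  then show "gdens x \<le> exp (2 * k + k\<^sup>2) * gdens c" "gdens c \<le> exp (2 * k + k\<^sup>2) * gdens x"
    unfolding gdens_def by (simp_all add: mult.left_commute[of _ "pi powr _"] mult_left_mono)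
qed

lemma gdens_admissible:
  fixes x c :: "real^'n"
  assumes "admissible c r" "x \<in> cball c r"
  shows "gdens x \<le> exp 3 * gdens c" "gdens c \<le> exp 3 * gdens x"
  using gdens_comparable[of x c 1] assms by (auto simp: admissible_def dist_commute)

lemma ball_sets_borel [measurable]: "ball (c::'a::euclidean_space) r \<in> sets borel" "cball c r \<in> sets borel"
  by auto

lemma emeasure_gauss: "S \<in> sets borel \<Longrightarrow> emeasure gauss S = (\<integral>\<^sup>+x. ennreal (gdens x) * indicator S x \<partial>lborel)"
  unfolding gauss_eq by (subst emeasure_density) auto

lemma measure_gauss_cball:
  fixes c :: "real^'n"
  assumes "admissible c r"
  shows "measure gauss (cball c r) \<le> exp 3 * gdens c * (uvol TYPE('n) * r ^ CARD('n))"
    and "gdens c * (uvol TYPE('n) * r ^ CARD('n)) \<le> exp 3 * measure gauss (cball c r)"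
proof -
  interpret finite_measure "gauss :: (real^'n) measure" by (rule finite_measure_gauss)
  let ?V = "uvol TYPE('n) * r ^ CARD('n)"
  have r: "0 < r" using assms by (simp add: admissible_def)
  have V: "0 \<le> ?V" using r by simp
  have e: "ennreal (measure gauss (cball c r)) = (\<integral>\<^sup>+x. ennreal (gdens x) * indicator (cball c r) x \<partial>lborel)"
    by (simp add: emeasure_eq_measure[symmetric] emeasure_gauss)
  have "\<dots> \<le> (\<integral>\<^sup>+x. ennreal (exp 3 * gdens c) * indicator (cball c r) x \<partial>lborel)"
    using gdens_admissible(1)[OF assms] by (intro nn_integral_mono) (auto simp: indicator_def intro!: ennreal_leI)
  also have "\<dots> = ennreal (exp 3 * gdens c * ?V)"
    using r by (subst nn_integral_cmult_indicator) (simp_all add: emeasure_cball_vec ennreal_mult)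
  finally show "measure gauss (cball c r) \<le> exp 3 * gdens c * ?V"
    using V unfolding e[symmetric] by simp
  have "ennreal (gdens c * ?V) = (\<integral>\<^sup>+x. ennreal (gdens c) * indicator (cball c r) x \<partial>lborel)"
    using r by (subst nn_integral_cmult_indicator) (simp_all add: emeasure_cball_vec ennreal_mult)
  also have "\<dots> \<le> (\<integral>\<^sup>+x. ennreal (exp 3) * (ennreal (gdens x) * indicator (cball c r) x) \<partial>lborel)"
    using gdens_admissible(2)[OF assms]
    by (intro nn_integral_mono) (auto simp: indicator_def ennreal_mult[symmetric] intro!: ennreal_leI)
  also have "\<dots> = ennreal (exp 3 * measure gauss (cball c r))"
    unfolding ennreal_mult[OF exp_ge_zero measure_nonneg] e by (rule nn_integral_cmult) measurable
  finally show "gdens c * ?V \<le> exp 3 * measure gauss (cball c r)"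
    by simp
qed

text \<open>Division by the density turns the Lebesgue mean into the Gauss mean, so the quotient is
  a multiple of an atom. One factor \<open>exp 3\<close> comes from the sup norm of the quotient,
  the other from the Gauss measure of the ball; the rest is \<open>b\<close> times the Lebesgue
  volume.\<close>

lemma dec_lebesgue:
  fixes A :: "real^'n \<Rightarrow> complex"
  assumes adm: "admissible c r" and [measurable]: "A \<in> borel_measurable borel"
    and supp: "\<And>x. x \<notin> cball c r \<Longrightarrow> A x = 0" and bd: "AE x in lborel. norm (A x) \<le> b" and b: "0 \<le> b"
    and mean: "(LINT x|lborel. A x) = 0"
  shows "dec (\<lambda>x. A x / of_real (gdens x)) (exp 6 * uvol TYPE('n) * b * r ^ CARD('n))"
proof -
  let ?V = "uvol TYPE('n) * r ^ CARD('n)"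
  have r: "0 < r" using adm by (simp add: admissible_def)
  have V: "0 < ?V" using r by simp
  define m where "m = measure gauss (cball c r)"
  define B where "B = exp 3 * b / gdens c"
  have "0 < exp 3 * m"
    by (rule less_le_trans[OF _ measure_gauss_cball(2)[OF adm, folded m_def]]) (rule mult_pos_pos[OF gdens_pos(1) V])
  then have m: "0 < m" by (simp add: zero_less_mult_iff)
  have nb: "AE x in gauss. norm (A x / of_real (gdens x)) \<le> B" unfolding AE_gauss
    using bd
  proof eventually_elim
    case (elim x)
    show ?case
    proof (cases "x \<in> cball c r")
      case True
      have "norm (A x / of_real (gdens x)) = norm (A x) * (1 / gdens x)" by (simp add: norm_divide)
      also have "\<dots> \<le> b * (exp 3 / gdens c)"
        using gdens_admissible(2)[OF adm True] elim b by (intro mult_mono) (auto simp: field_simps)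
      finally show ?thesis by (simp add: B_def mult_ac)
    next
      case False
      then show ?thesis using supp b by (simp add: B_def)
    qed
  qed
  show ?thesis
  \<comment> \<open>The atom is obtained by dividing by \<open>z\<close>, which would vanish for
    \<open>b = 0\<close>; the function is then zero almost everywhere.\<close>
  proof (cases "b = 0")
    case True
    from nb have "AE x in gauss. 0 = A x / of_real (gdens x)" by eventually_elim (simp add: True B_def)
    then have "dec (\<lambda>x. A x / of_real (gdens x)) 0" by (rule dec_cong[OF dec_zero])
    then show ?thesis by (simp add: True)
  next
    case False
    then have B: "0 < B" using b by (simp add: B_def)
    define z where "z = B * m"
    have z: "0 < z" using B m by (simp add: z_def)
    have "gaussian_atom (\<lambda>x. A x / of_real (gdens x) / of_real z)"
      unfolding gaussian_atom_def
    proof (intro disjI2 exI conjI)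
      show "admissible c r" by fact
      show "(\<lambda>x. A x / of_real (gdens x) / of_real z) \<in> borel_measurable gauss" by measurable
      show "AE x in gauss. x \<notin> cball c r \<longrightarrow> A x / of_real (gdens x) / of_real z = 0"
        using supp by simp
      show "AE x in gauss. norm (A x / of_real (gdens x) / of_real z) \<le> 1 / measure gauss (cball c r)"
        using nb
      proof eventually_elim
        case (elim x)
        have "norm (A x / of_real (gdens x) / of_real z) = norm (A x / of_real (gdens x)) / z"
          using z by (subst norm_divide) simp
        also have "\<dots> \<le> B / z" using elim z by (intro divide_right_mono) auto
        finally show ?case using B by (simp add: z_def m_def)
      qed
      have "(LINT x|gauss. A x / of_real (gdens x) / of_real z) = (LINT x|lborel. A x / of_real z)"
        by (subst integral_gauss) (auto simp: scaleR_conv_of_real)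
      then show "(LINT x|gauss. A x / of_real (gdens x) / of_real z) = 0" using mean by simp
    qed
    from dec_cmult_atom[OF this, of "of_real z"]
    have "dec (\<lambda>x. A x / of_real (gdens x)) z" using z by simp
    moreover have "z \<le> exp 6 * uvol TYPE('n) * b * r ^ CARD('n)"
    proof -
      have "z \<le> B * (exp 3 * gdens c * ?V)"
        unfolding z_def m_def using measure_gauss_cball(1)[OF adm] B by (intro mult_left_mono) auto
      also have "\<dots> = (exp 3 * exp 3) * uvol TYPE('n) * b * r ^ CARD('n)" by (simp add: B_def)
      finally show ?thesis by (simp add: exp_add[symmetric])
    qed
    ultimately show ?thesis by (rule dec_mono)
  qed
qed

section \<open>Continuously differentiable functions and the bump profile\<close>

definition C1 :: "('a::euclidean_space \<Rightarrow> real) \<Rightarrow> bool" where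
  "C1 f \<longleftrightarrow> (\<exists>D. (\<forall>x. (f has_derivative D x) (at x)) \<and> (\<forall>v. continuous_on UNIV (\<lambda>x. D x v)))"

lemma C1_continuous: "C1 f \<Longrightarrow> continuous_on UNIV f"
  unfolding C1_def by (meson continuous_at_imp_continuous_on has_derivative_continuous)

lemma C1_measurable: "C1 f \<Longrightarrow> f \<in> borel_measurable borel"
  by (intro borel_measurable_continuous_onI C1_continuous)

lemma C1_const: "C1 (\<lambda>_. c)"
  unfolding C1_def by (intro exI[of _ "\<lambda>_ _. 0"]) (auto intro!: derivative_eq_intros)

lemma C1_mult:
  assumes "C1 f" "C1 g" shows "C1 (\<lambda>x. f x * g x)"
proof -
  from assms obtain D E where D: "\<And>x. (f has_derivative D x) (at x)" "\<And>v. continuous_on UNIV (\<lambda>x. D x v)"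
    and E: "\<And>x. (g has_derivative E x) (at x)" "\<And>v. continuous_on UNIV (\<lambda>x. E x v)"
    unfolding C1_def by blast
  show ?thesis unfolding C1_def
  proof (intro exI[of _ "\<lambda>x v. f x * E x v + D x v * g x"] conjI allI)
    show "((\<lambda>x. f x * g x) has_derivative (\<lambda>v. f x * E x v + D x v * g x)) (at x)" for x
      by (rule has_derivative_mult[OF D(1) E(1)])
    show "continuous_on UNIV (\<lambda>x. f x * E x v + D x v * g x)" for v
      by (intro continuous_on_add continuous_on_mult D E C1_continuous assms)
  qed
qed

lemma C1_comp:
  assumes f: "C1 f" and q: "\<And>u. (q has_real_derivative q' u) (at u)" "continuous_on UNIV q'"
  shows "C1 (\<lambda>x. q (f x))"
proof -
  from f obtain D where D: "\<And>x. (f has_derivative D x) (at x)" "\<And>v. continuous_on UNIV (\<lambda>x. D x v)"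
    unfolding C1_def by blast
  have "((\<lambda>x. q (f x)) has_derivative (\<lambda>v. q' (f x) * D x v)) (at x)" for x
    using has_derivative_compose[OF D(1) q(1)[unfolded has_field_derivative_def]] .
  moreover have "continuous_on UNIV (\<lambda>x. q' (f x) * D x v)" for v
    by (intro continuous_on_mult D continuous_on_compose2[OF q(2) C1_continuous[OF f]]) auto
  ultimately show ?thesis unfolding C1_def by (intro exI[of _ "\<lambda>x v. q' (f x) * D x v"]) auto
qed

lemma C1_diff_const: "C1 f \<Longrightarrow> C1 (\<lambda>x. c - f x)"
  by (rule C1_comp[where q'="\<lambda>_. -1"]) (auto intro!: derivative_eq_intros)

lemma C1_prod: "finite A \<Longrightarrow> (\<And>i. i \<in> A \<Longrightarrow> C1 (f i)) \<Longrightarrow> C1 (\<lambda>x. \<Prod>i\<in>A. f i x)"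
  by (induction A rule: finite_induct) (auto intro: C1_const C1_mult)

lemma C1_norm_sq: "C1 (\<lambda>x::'a::euclidean_space. (norm (x - a))\<^sup>2)"
  unfolding C1_def power2_norm_eq_inner
  by (rule exI[of _ "\<lambda>x v. 2 * ((x - a) \<bullet> v)"])
     (auto intro!: derivative_eq_intros continuous_intros simp: inner_commute)

lemma C1_gdens: "C1 (gdens :: real^'n \<Rightarrow> real)"
proof -
  have "C1 (\<lambda>x::real^'n. (\<lambda>u. pi powr (- (real CARD('n) / 2)) * exp (- u)) ((norm (x - 0))\<^sup>2))"
    by (rule C1_comp[OF C1_norm_sq, where q'="\<lambda>u. - (pi powr (- (real CARD('n) / 2)) * exp (- u))"])
       (auto intro!: derivative_eq_intros continuous_intros)
  then show ?thesis by (simp add: gdens_def[abs_def])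
qed

text \<open>Difference quotients along \<open>v\<close> obey the Lipschitz bound and so does their
  limit. Cutoffs can therefore be handled through Lipschitz constants, which pass easily through
  products, and derivatives are bounded only when a function is fed into
  \<open>Mloc\<close>.\<close>

lemma derivative_bound_lipschitz:
  fixes f :: "'a::real_normed_vector \<Rightarrow> real"
  assumes D: "(f has_derivative D) (at x)" and L: "\<And>y z. \<bar>f y - f z\<bar> \<le> L * dist y z"
  shows "\<bar>D v\<bar> \<le> L * norm v"
proof -
  interpret bounded_linear D using D by (rule has_derivative_bounded_linear)
  have "((\<lambda>h. f (x + h *\<^sub>R v)) has_derivative (\<lambda>h. D (h *\<^sub>R v))) (at 0)"
    by (rule has_derivative_compose[where g=f]) (auto intro!: derivative_eq_intros D)
  then have "((\<lambda>h. f (x + h *\<^sub>R v)) has_real_derivative D v) (at 0)"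
    by (simp add: has_field_derivative_def scaleR mult.commute[of _ "D v"])
  then have lim: "(\<lambda>h. \<bar>(f (x + h *\<^sub>R v) - f x) / h\<bar>) \<midarrow>0\<rightarrow> \<bar>D v\<bar>"
    unfolding DERIV_def by (intro tendsto_rabs) simp
  show ?thesis
  proof (rule tendsto_upperbound[OF lim])
    have "\<bar>(f (x + h *\<^sub>R v) - f x) / h\<bar> \<le> L * norm v" if "h \<noteq> 0" for h
      using L[of "x + h *\<^sub>R v" x] that by (simp add: dist_norm divide_le_eq mult_ac)
    then show "\<forall>\<^sub>F h in at 0. \<bar>(f (x + h *\<^sub>R v) - f x) / h\<bar> \<le> L * norm v"
      by (auto simp: eventually_at_filter)
  qed simp
qed

text \<open>One continuous derivative is all that \<open>test_functions\<close> asks for, so the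
  squared positive part can stand in for a smooth truncation.\<close>

definition pos2 :: "real \<Rightarrow> real" where "pos2 v = (max 0 v)\<^sup>2"

lemma pos2_deriv: "(pos2 has_real_derivative 2 * max 0 v) (at v)"
proof -
  consider "v < 0" | "v = 0" | "0 < v" by linarith
  then show ?thesis
  proof cases
    case 1
    have "((\<lambda>_. 0) has_real_derivative 2 * max 0 v) (at v)" using 1 by (auto intro!: derivative_eq_intros)
    then show ?thesis
      by (rule has_field_derivative_transform_within_open[of _ _ _ "{..<0}"]) (use 1 in \<open>auto simp: pos2_def\<close>)
  next
    case 3
    have "((\<lambda>x. x\<^sup>2) has_real_derivative 2 * max 0 v) (at v)" using 3 by (auto intro!: derivative_eq_intros)
    then show ?thesis
      by (rule has_field_derivative_transform_within_open[of _ _ _ "{0<..}"]) (use 3 in \<open>auto simp: pos2_def\<close>)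
  next
    case 2
    have "(\<lambda>h. (pos2 (0 + h) - pos2 0) / h) \<midarrow>0\<rightarrow> 0"
    proof (rule Lim_null_comparison)
      show "\<forall>\<^sub>F h in at 0. norm ((pos2 (0 + h) - pos2 0) / h) \<le> \<bar>h\<bar>"
        by (auto simp: eventually_at_filter pos2_def max_def power2_eq_square)
      show "(\<lambda>h::real. \<bar>h\<bar>) \<midarrow>0\<rightarrow> 0" by (auto intro!: tendsto_eq_intros)
    qed
    then show ?thesis by (simp add: DERIV_def 2)
  qed
qed

lemma pos2_diff: "\<bar>pos2 a - pos2 b\<bar> \<le> \<bar>max 0 a - max 0 b\<bar> * (max 0 a + max 0 b)"
  using norm_sq_diff_le[of "max 0 a" "max 0 b"] by (simp add: pos2_def dist_norm)

text \<open>The inner \<open>pos2\<close> is at least 1 for \<open>norm y <= 5\<close> and vanishes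
  for \<open>norm y >= 10\<close>; the outer one cuts it off at height 1. The radii match the factor
  5 of the Vitali covering and the 10 radii allowed for the support of a Whitney function.\<close>

definition bump :: "'a::euclidean_space \<Rightarrow> real" where
  "bump y = 1 - pos2 (1 - pos2 ((100 - (norm y)\<^sup>2) / 75))"

lemma bump_range: "0 \<le> bump y" "bump y \<le> 1"
  by (auto simp: bump_def pos2_def power_le_one_iff)

lemma bump_eq_1: "norm y \<le> 5 \<Longrightarrow> bump y = 1"
proof -
  assume "norm y \<le> 5"
  then have "(norm y)\<^sup>2 \<le> 25" using power_mono[of "norm y" 5 2] by simp
  then have "1 \<le> pos2 ((100 - (norm y)\<^sup>2) / 75)"
    using power_mono[of 1 "max 0 ((100 - (norm y)\<^sup>2) / 75)" 2] by (simp add: pos2_def)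
  then have "max 0 (1 - pos2 ((100 - (norm y)\<^sup>2) / 75)) = 0" by simp
  then show "bump y = 1" unfolding bump_def pos2_def[of "1 - _"] by simp
qed

lemma bump_eq_0: "10 \<le> norm y \<Longrightarrow> bump y = 0"
  using power_mono[of 10 "norm y" 2] by (auto simp: bump_def pos2_def max_def)

text \<open>Layer by layer: \<open>m\<close> has slope at most \<open>20 / 75\<close> and values in
  \<open>[0, 4/3]\<close>, its square \<open>w\<close> has slope at most
  \<open>160 / 225 < 1\<close>, and the outer square at most doubles this.\<close>

lemma bump_lipschitz: "\<bar>bump y - bump z\<bar> \<le> 2 * dist y z"
proof -
  define m where "m u = max 0 ((100 - (norm u)\<^sup>2) / 75)" for u :: 'a
  have m_eq: "m u = (100 - (min (norm u) 10)\<^sup>2) / 75" for u :: 'a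
    using power_mono[of "norm u" 10 2] power_mono[of 10 "norm u" 2]
    by (cases "norm u \<le> 10") (auto simp: m_def)
  have m0: "0 \<le> m u" "m u \<le> 4/3" for u unfolding m_eq using power_mono[of "min (norm u) 10" 10 2] by auto
  have "\<bar>m y - m z\<bar> = \<bar>(min (norm y) 10)\<^sup>2 - (min (norm z) 10)\<^sup>2\<bar> / 75"
    unfolding m_eq by (simp add: diff_divide_distrib[symmetric] abs_minus_commute)
  also have "(min (norm y) 10)\<^sup>2 - (min (norm z) 10)\<^sup>2 =
     (min (norm y) 10 - min (norm z) 10) * (min (norm y) 10 + min (norm z) 10)"
    by (simp add: power2_eq_square algebra_simps)
  also have "\<bar>\<dots>\<bar> / 75 \<le> (dist y z * 20) / 75"
  proof (intro divide_right_mono)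
    have "\<bar>min (norm y) 10 - min (norm z) 10\<bar> \<le> \<bar>norm y - norm z\<bar>" by linarith
    also have "\<dots> \<le> dist y z" unfolding dist_norm by (rule norm_triangle_ineq3)
    finally show "\<bar>(min (norm y) 10 - min (norm z) 10) * (min (norm y) 10 + min (norm z) 10)\<bar> \<le> dist y z * 20"
      unfolding abs_mult by (intro mult_mono) auto
  qed simp
  finally have m_lip: "\<bar>m y - m z\<bar> \<le> 20/75 * dist y z" by simp
  define w where "w u = (m u)\<^sup>2" for u
  have "\<bar>w y - w z\<bar> \<le> \<bar>m y - m z\<bar> * (m y + m z)"
    unfolding w_def using norm_sq_diff_le[of "m y" "m z"] m0 by (simp add: dist_norm)
  also have "\<dots> \<le> (20/75 * dist y z) * (8/3)" using m_lip m0[of y] m0[of z] by (intro mult_mono) auto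
  finally have w_lip: "\<bar>w y - w z\<bar> \<le> 160/225 * dist y z" by simp
  have b: "bump u = 1 - pos2 (1 - w u)" for u by (simp add: bump_def w_def m_def pos2_def)
  have "\<bar>bump y - bump z\<bar> = \<bar>pos2 (1 - w y) - pos2 (1 - w z)\<bar>" unfolding b by simp
  also have "\<dots> \<le> \<bar>max 0 (1 - w y) - max 0 (1 - w z)\<bar> * (max 0 (1 - w y) + max 0 (1 - w z))"
    by (rule pos2_diff)
  also have "\<dots> \<le> \<bar>w y - w z\<bar> * 2"
  proof (intro mult_mono)
    have "max 0 (1 - w u) \<le> 1" for u by (simp add: w_def)
    from this[of y] this[of z] show "max 0 (1 - w y) + max 0 (1 - w z) \<le> 2" by linarith
  qed auto
  finally have fin: "\<bar>bump y - bump z\<bar> \<le> \<bar>w y - w z\<bar> * 2" .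
  have "160/225 * dist y z \<le> 1 * dist y z" by (intro mult_right_mono) auto
  then have "160/225 * dist y z \<le> dist y z" by simp
  then have "\<bar>w y - w z\<bar> \<le> dist y z" by (rule order_trans[OF w_lip])
  then have "\<bar>w y - w z\<bar> * 2 \<le> dist y z * 2" by (rule mult_right_mono) simp
  then show ?thesis using order_trans[OF fin] by (simp add: mult.commute)
qed

lemma C1_bump: "C1 (\<lambda>y. bump ((1 / s) *\<^sub>R (y - a)))"
proof -
  have p: "C1 (\<lambda>x. pos2 (f x))" if "C1 f" for f :: "'a \<Rightarrow> real"
    by (rule C1_comp[OF that pos2_deriv]) (intro continuous_intros)
  have "C1 (\<lambda>y. (\<lambda>u. (100 - (1 / s)\<^sup>2 * u) / 75) ((norm (y - a))\<^sup>2))"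
    by (rule C1_comp[OF C1_norm_sq, where q'="\<lambda>u. - (1 / s)\<^sup>2 / 75"])
       (auto intro!: derivative_eq_intros continuous_intros)
  then have "C1 (\<lambda>y. 1 - pos2 (1 - pos2 ((100 - (1 / s)\<^sup>2 * (norm (y - a))\<^sup>2) / 75)))"
    by (intro C1_diff_const p)
  then show ?thesis by (simp add: bump_def power_mult_distrib power_divide)
qed

text \<open>Test functions attached to a point \<open>x\<close> and a scale \<open>t\<close>,
  written in the integration variable and without the factor \<open>t^(-n)\<close>. A Lipschitz
  bound takes the place of the derivative bound because it is stable under multiplication by
  cutoffs.\<close>

definition testf :: "real^'n \<Rightarrow> real \<Rightarrow> (real^'n \<Rightarrow> real) set" where
  "testf x t = {\<zeta>. C1 \<zeta> \<and> (\<forall>y. \<bar>\<zeta> y\<bar> \<le> 1) \<and> (\<forall>y. t \<le> dist x y \<longrightarrow> \<zeta> y = 0) \<and>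
     (\<forall>y z. \<bar>\<zeta> y - \<zeta> z\<bar> \<le> dist y z / t)}"

text \<open>Using the scale \<open>2 * t\<close> instead of \<open>t\<close> puts the support of
  \<open>\<phi>\<close> into the closed half ball and hence strictly inside the unit ball. The
  factor 1/2 in \<open>\<phi>\<close> compensates the doubled slope; undoing both changes produces
  \<open>2 * (2 * t)^n\<close>.\<close>

lemma Mloc_testf:
  fixes \<zeta> :: "real^'n \<Rightarrow> real"
  assumes t: "0 < t" "2 * t < adm_radius x" and \<zeta>: "\<zeta> \<in> testf x t"
  shows "ennreal (norm (LINT y|lborel. \<zeta> y *\<^sub>R f y)) \<le> ennreal (2 * (2 * t) ^ CARD('n)) * Mloc f x"
proof -
  define \<phi> :: "real^'n \<Rightarrow> complex" where "\<phi> z = of_real (\<zeta> (x - (2 * t) *\<^sub>R z) / 2)" for z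
  from \<zeta> obtain D where D: "\<And>x. (\<zeta> has_derivative D x) (at x)" "\<And>v. continuous_on UNIV (\<lambda>x. D x v)"
    unfolding testf_def C1_def by blast
  have z1: "\<bar>\<zeta> y\<bar> \<le> 1" and z0: "t \<le> dist x y \<Longrightarrow> \<zeta> y = 0" and zl: "\<bar>\<zeta> y - \<zeta> z\<bar> \<le> dist y z / t" for y z
    using \<zeta> by (auto simp: testf_def)
  have Db: "\<bar>D y v\<bar> \<le> 1 / t * norm v" for y v
    by (rule derivative_bound_lipschitz[OF D(1)]) (use zl in simp)
  have lin: "D y (c *\<^sub>R v) = c * D y v" for y c v
    using has_derivative_bounded_linear[OF D(1)] by (simp add: linear_simps)
  have der: "(\<phi> has_derivative (\<lambda>v. of_real (D (x - (2 * t) *\<^sub>R z) (- ((2 * t) *\<^sub>R v)) / 2))) (at z)" for z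
  proof -
    have "((\<lambda>z. \<zeta> (x - (2 * t) *\<^sub>R z)) has_derivative (\<lambda>v. D (x - (2 * t) *\<^sub>R z) (- ((2 * t) *\<^sub>R v)))) (at z)"
      by (rule has_derivative_compose[where g=\<zeta>, OF _ D(1)]) (auto intro!: derivative_eq_intros)
    then have "((\<lambda>z. \<zeta> (x - (2 * t) *\<^sub>R z) / 2) has_derivative (\<lambda>v. D (x - (2 * t) *\<^sub>R z) (- ((2 * t) *\<^sub>R v)) / 2)) (at z)"
      by (auto intro!: derivative_eq_intros)
    then show ?thesis unfolding \<phi>_def
      by (rule has_derivative_of_real)
  qed
  have pd: "partial_deriv i \<phi> z = of_real (- t * D (x - (2 * t) *\<^sub>R z) (axis i 1))" for i z
  proof -
    have "partial_deriv i \<phi> z = of_real (D (x - (2 * t) *\<^sub>R z) ((- 2 * t) *\<^sub>R axis i 1) / 2)"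
      unfolding partial_deriv_def by (subst frechet_derivative_at[OF der, symmetric]) simp
    then show ?thesis unfolding lin by simp
  qed
  have "\<phi> \<in> test_functions"
    unfolding test_functions_def
  proof (intro CollectI conjI allI)
    show "\<phi> differentiable_on UNIV"
      using der by (auto simp: differentiable_on_def differentiable_def)
    show "continuous_on UNIV (partial_deriv i \<phi>)" for i
      unfolding pd[abs_def] by (intro continuous_intros continuous_on_compose2[OF D(2)]) auto
    have "{x. \<phi> x \<noteq> 0} \<subseteq> cball 0 (1/2)"
    proof
      fix z assume "z \<in> {x. \<phi> x \<noteq> 0}"
      then have "\<not> t \<le> dist x (x - (2 * t) *\<^sub>R z)" using z0 by (auto simp: \<phi>_def)
      then have "2 * t * norm z < t" using t by (simp add: dist_norm)
      then show "z \<in> cball 0 (1/2)" using t by simp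
    qed
    from closure_minimal[OF this closed_cball] show "closure {x. \<phi> x \<noteq> 0} \<subseteq> ball 0 1" by force
    show "norm (\<phi> z) \<le> 1" for z using z1[of "x - (2 * t) *\<^sub>R z"] by (simp add: \<phi>_def)
    show "norm (partial_deriv i \<phi> z) \<le> 1" for i z
      using Db[of "x - (2 * t) *\<^sub>R z" "axis i 1"] t unfolding pd norm_of_real
      by (simp add: abs_mult norm_axis_1 field_simps)
  qed
  then have "ennreal (norm (convol (dilate (2 * t) \<phi>) f x)) \<le> Mloc f x"
    unfolding Mloc_def using t by (intro SUP_upper2[of \<phi>] SUP_upper2[of "2 * t"]) auto
  moreover have "convol (dilate (2 * t) \<phi>) f x = (LINT y|lborel. (1 / (2 * (2 * t) ^ CARD('n))) *\<^sub>R (\<zeta> y *\<^sub>R f y))"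
    unfolding convol_def
  proof (rule Bochner_Integration.integral_cong[OF refl])
    fix y :: "real^'n"
    have "x - (2 * t) *\<^sub>R ((1 / (2 * t)) *\<^sub>R (x - y)) = y" using t by simp
    then show "dilate (2 * t) \<phi> (x - y) * f y = (1 / (2 * (2 * t) ^ CARD('n))) *\<^sub>R (\<zeta> y *\<^sub>R f y)"
      unfolding dilate_def \<phi>_def by (simp add: scaleR_conv_of_real)
  qed
  then have "convol (dilate (2 * t) \<phi>) f x = (1 / (2 * (2 * t) ^ CARD('n))) *\<^sub>R (LINT y|lborel. \<zeta> y *\<^sub>R f y)"
    by (simp only: integral_scaleR_right)
  then have "norm (LINT y|lborel. \<zeta> y *\<^sub>R f y) = 2 * (2 * t) ^ CARD('n) * norm (convol (dilate (2 * t) \<phi>) f x)"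
    using t by simp
  ultimately show ?thesis
    using t by (simp add: ennreal_mult mult_left_mono)
qed

text \<open>The product has slope at most \<open>(M + L) / t\<close>, and division by
  \<open>M + L\<close> restores the normalisation. A multiplier that varies on the scale
  \<open>t\<close> can thus be absorbed into the test function at bounded cost.\<close>

lemma testf_mult:
  assumes \<zeta>: "\<zeta> \<in> testf x t" and \<kappa>: "C1 \<kappa>" "\<And>y. \<bar>\<kappa> y\<bar> \<le> M" "\<And>y z. \<bar>\<kappa> y - \<kappa> z\<bar> \<le> L * dist y z / t"
    and M: "0 < M" "0 \<le> L" and t: "0 < t"
  shows "(\<lambda>y. \<zeta> y * \<kappa> y / (M + L)) \<in> testf x t"
proof -
  have z1: "\<bar>\<zeta> y\<bar> \<le> 1" and z0: "t \<le> dist x y \<Longrightarrow> \<zeta> y = 0" and zl: "\<bar>\<zeta> y - \<zeta> z\<bar> \<le> dist y z / t" for y z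
    using \<zeta> by (auto simp: testf_def)
  have "C1 (\<lambda>y. \<zeta> y * \<kappa> y * (1 / (M + L)))"
    using \<zeta> \<kappa>(1) by (intro C1_mult C1_const) (auto simp: testf_def)
  moreover have "\<bar>\<zeta> y * \<kappa> y / (M + L)\<bar> \<le> 1" for y
  proof -
    have "\<bar>\<zeta> y * \<kappa> y\<bar> \<le> 1 * M" unfolding abs_mult using z1 \<kappa>(2) by (intro mult_mono) auto
    then show ?thesis using M by (simp add: abs_mult)
  qed
  moreover have "\<bar>\<zeta> y * \<kappa> y / (M + L) - \<zeta> z * \<kappa> z / (M + L)\<bar> \<le> dist y z / t" for y z
  proof -
    have "\<zeta> y * \<kappa> y - \<zeta> z * \<kappa> z = (\<zeta> y - \<zeta> z) * \<kappa> y + \<zeta> z * (\<kappa> y - \<kappa> z)" by (simp add: algebra_simps)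
    then have "\<bar>\<zeta> y * \<kappa> y - \<zeta> z * \<kappa> z\<bar> \<le> \<bar>\<zeta> y - \<zeta> z\<bar> * \<bar>\<kappa> y\<bar> + \<bar>\<zeta> z\<bar> * \<bar>\<kappa> y - \<kappa> z\<bar>"
      by (metis abs_mult abs_triangle_ineq)
    also have "\<dots> \<le> dist y z / t * M + 1 * (L * dist y z / t)"
      using z1 zl \<kappa> t by (intro add_mono mult_mono) auto
    also have "\<dots> = (M + L) * (dist y z / t)" by (simp add: algebra_simps add_divide_distrib)
    finally have "\<bar>\<zeta> y * \<kappa> y - \<zeta> z * \<kappa> z\<bar> / (M + L) \<le> dist y z / t"
      using M by (subst pos_divide_le_eq) (auto simp: mult.commute)
    then show ?thesis using M by (simp add: diff_divide_distrib[symmetric] abs_divide)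
  qed
  ultimately show ?thesis unfolding testf_def using z0 by simp
qed

subsection \<open>Whitney coverings\<close>

abbreviation overlap :: "'n::finite itself \<Rightarrow> real" where
  "overlap _ \<equiv> 33 ^ CARD('n)"

text \<open>A Whitney function is a product in which at most \<open>2 * 33^n\<close> factors differ
  between two nearby points, each with slope at most \<open>4 / s i\<close>.\<close>

abbreviation whitney_lip :: "'n::finite itself \<Rightarrow> real" where
  "whitney_lip _ \<equiv> 8 * 33 ^ CARD('n) + 1"

text \<open>A radius \<open>s i = 0\<close> marks an unused index, so that finite and infinite coverings are
  indexed alike by the natural numbers.\<close>

definition whitney ::
  "(real^'n \<Rightarrow> real) \<Rightarrow> (nat \<Rightarrow> real^'n) \<Rightarrow> (nat \<Rightarrow> real) \<Rightarrow> (nat \<Rightarrow> real^'n \<Rightarrow> real) \<Rightarrow> bool" where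
  "whitney \<rho> x s \<eta> \<longleftrightarrow>
     (\<forall>i. 0 \<le> s i) \<and> (\<forall>i. 0 < s i \<longrightarrow> \<rho> (x i) = s i) \<and>
     (\<forall>i j. i \<noteq> j \<longrightarrow> ball (x i) (s i) \<inter> ball (x j) (s j) = {}) \<and>
     (\<forall>i. C1 (\<eta> i)) \<and> (\<forall>i y. 0 \<le> \<eta> i y \<and> \<eta> i y \<le> 1) \<and>
     (\<forall>i y. 10 * s i \<le> dist y (x i) \<longrightarrow> \<eta> i y = 0) \<and>
     (\<forall>i y z. 0 < s i \<longrightarrow> \<bar>\<eta> i y - \<eta> i z\<bar> \<le> whitney_lip TYPE('n) / s i * dist y z) \<and>
     (\<forall>y. (\<lambda>i. \<eta> i y) sums (if 0 < \<rho> y then 1 else 0))"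

lemma card_disjoint_balls_le:
  fixes x :: "'i \<Rightarrow> real^'n"
  assumes fin: "finite F" and disj: "\<And>i j. i \<in> F \<Longrightarrow> j \<in> F \<Longrightarrow> i \<noteq> j \<Longrightarrow> ball (x i) (s i) \<inter> ball (x j) (s j) = {}"
    and sub: "\<And>i. i \<in> F \<Longrightarrow> ball (x i) (s i) \<subseteq> ball y R" and s: "\<And>i. i \<in> F \<Longrightarrow> r \<le> s i"
    and r: "0 < r" "0 < R"
  shows "real (card F) * r ^ CARD('n) \<le> R ^ CARD('n)"
proof -
  let ?V = "uvol TYPE('n)"
  have V: "0 < ?V" by simp
  have "ennreal (real (card F) * (?V * r ^ CARD('n))) = (\<Sum>i\<in>F. ennreal (?V * r ^ CARD('n)))"
    using r by (simp add: ennreal_mult ennreal_of_nat_eq_real_of_nat)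
  also have "\<dots> \<le> (\<Sum>i\<in>F. emeasure lborel (ball (x i) (s i)))"
  proof (rule sum_mono)
    fix i assume "i \<in> F"
    then have "r \<le> s i" by (rule s)
    with r show "ennreal (?V * r ^ CARD('n)) \<le> emeasure lborel (ball (x i) (s i))"
      by (subst emeasure_ball_vec) (auto intro!: ennreal_leI mult_left_mono power_mono)
  qed
  also have "\<dots> = emeasure lborel (\<Union>i\<in>F. ball (x i) (s i))"
    using disj fin by (intro sum_emeasure) (auto simp: disjoint_family_on_def)
  also have "\<dots> \<le> emeasure lborel (ball y R)"
    using sub by (intro emeasure_mono) auto
  also have "\<dots> = ennreal (?V * R ^ CARD('n))" using r by (simp only: emeasure_ball_vec less_imp_le)
  finally have "real (card F) * (?V * r ^ CARD('n)) \<le> ?V * R ^ CARD('n)"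
    using r by simp
  then have "?V * (real (card F) * r ^ CARD('n)) \<le> ?V * R ^ CARD('n)" by (simp add: mult_ac)
  then show ?thesis using V by (simp only: mult_le_cancel_left_pos)
qed

text \<open>The balls counted here have radii between 5/6 and 5/4 of \<open>\<rho> y\<close>. They
  lie in the ball of radius \<open>27 * \<rho> y\<close> about \<open>y\<close>, since 21 radii are
  at most \<open>21 * 5/4 * \<rho> y\<close>, and comparing volumes of disjoint balls leaves room
  for at most \<open>(27 * 6/5)^n = (162/5)^n\<close> of them.\<close>

lemma whitney_overlap_aux:
  fixes x :: "nat \<Rightarrow> real^'n"
  assumes lip: "\<And>y z. \<bar>\<rho> y - \<rho> z\<bar> \<le> dist y z / 100"
    and \<rho>: "\<And>i. 0 < s i \<Longrightarrow> \<rho> (x i) = s i"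
    and disj: "\<And>i j. i \<noteq> j \<Longrightarrow> ball (x i) (s i) \<inter> ball (x j) (s j) = {}"
  shows "finite {i. dist y (x i) < 20 * s i}" "real (card {i. dist y (x i) < 20 * s i}) \<le> overlap TYPE('n)"
proof -
  have *: "real (card F) \<le> 33 ^ CARD('n)" if fin: "finite F" and F: "F \<subseteq> {i. dist y (x i) < 20 * s i}" for F
  proof (cases "F = {}")
    case False
    have near: "5/6 * \<rho> y \<le> s i" "s i \<le> 5/4 * \<rho> y" if "i \<in> F" for i
    proof -
      have d: "dist y (x i) < 20 * s i" using that F by auto
      then have "0 < s i" using zero_le_dist[of y "x i"] by linarith
      then have "\<rho> (x i) = s i" by (rule \<rho>)
      then show "5/6 * \<rho> y \<le> s i" "s i \<le> 5/4 * \<rho> y" using lip[of y "x i"] d by linarith+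
    qed
    obtain i0 where i0: "i0 \<in> F" using False by auto
    then have "0 < s i0" using F zero_le_dist[of y "x i0"] by (smt (verit) mem_Collect_eq subsetD)
    then have pos: "0 < \<rho> y" using near(2)[OF i0] by auto
    have "real (card F) * (5/6 * \<rho> y) ^ CARD('n) \<le> (27 * \<rho> y) ^ CARD('n)"
    proof (rule card_disjoint_balls_le[OF fin])
      show "ball (x i) (s i) \<subseteq> ball y (27 * \<rho> y)" if "i \<in> F" for i
      proof
        fix z assume "z \<in> ball (x i) (s i)"
        then have "dist y z < 20 * s i + s i"
          using that F dist_triangle[of y z "x i"] by (auto simp: dist_commute)
        then show "z \<in> ball y (27 * \<rho> y)" using near(2)[OF that] pos by auto
      qed
    qed (use disj near pos in auto)
    also have "(27 * \<rho> y) ^ CARD('n) = (162/5) ^ CARD('n) * (5/6 * \<rho> y) ^ CARD('n)"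
      by (subst power_mult_distrib[symmetric]) simp
    finally have "real (card F) \<le> (162/5) ^ CARD('n)" using pos by (subst (asm) mult_le_cancel_right_pos) auto
    also have "\<dots> \<le> 33 ^ CARD('n)" by (intro power_mono) auto
    finally show ?thesis .
  qed simp
  show fin: "finite {i. dist y (x i) < 20 * s i}"
  proof (rule ccontr)
    assume inf: "infinite {i. dist y (x i) < 20 * s i}"
    obtain F where "F \<subseteq> {i. dist y (x i) < 20 * s i}" "finite F" "card F = Suc (nat \<lceil>33 ^ CARD('n) :: real\<rceil>)"
      using infinite_arbitrarily_large[OF inf] by meson
    with *[of F] show False by linarith
  qed
  show "real (card {i. dist y (x i) < 20 * s i}) \<le> overlap TYPE('n)" using *[OF fin] by simp
qed

lemma whitney_overlap:
  fixes x :: "nat \<Rightarrow> real^'n"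
  assumes "whitney \<rho> x s \<eta>" and lip: "\<And>y z. \<bar>\<rho> y - \<rho> z\<bar> \<le> dist y z / 100"
  shows "finite {i. dist y (x i) < 20 * s i}" "real (card {i. dist y (x i) < 20 * s i}) \<le> overlap TYPE('n)"
  using assms whitney_overlap_aux[OF lip, of s x y] unfolding whitney_def by blast+

lemma sum_telescope_prod:
  fixes p :: "nat \<Rightarrow> real"
  shows "(\<Sum>i<N. p i * (\<Prod>j<i. 1 - p j)) = 1 - (\<Prod>j<N. 1 - p j)"
  by (induction N) (auto simp: algebra_simps)

lemma prod_diff_le_sum:
  fixes a b :: "'i \<Rightarrow> real"
  assumes "finite A" "\<And>i. i \<in> A \<Longrightarrow> \<bar>a i\<bar> \<le> 1" "\<And>i. i \<in> A \<Longrightarrow> \<bar>b i\<bar> \<le> 1"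
  shows "\<bar>prod a A - prod b A\<bar> \<le> (\<Sum>i\<in>A. \<bar>a i - b i\<bar>)"
  using norm_prod_diff[of A a b] assms by simp

text \<open>Vitali's covering lemma for the balls \<open>ball y (\<rho> y)\<close> yields disjoint
  balls whose fivefold dilates cover the set where \<open>\<rho>\<close> is positive. Each bump
  equals 1 on its dilate, so at every covered point one factor \<open>1 - \<psi> j\<close> vanishes
  and the telescoping sum is exactly 1 from there on.\<close>

lemma whitney_exists:
  fixes \<rho> :: "real^'n \<Rightarrow> real"
  assumes lip: "\<And>y z. \<bar>\<rho> y - \<rho> z\<bar> \<le> dist y z / 100" and B: "\<And>y. \<rho> y \<le> B"
  obtains x s \<eta> where "whitney \<rho> x s \<eta>"
proof -
  define K where "K = {y. 0 < \<rho> y}"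
  obtain C where C: "countable C" "C \<subseteq> K" and disj: "pairwise (\<lambda>i j. disjnt (ball i (\<rho> i)) (ball j (\<rho> j))) C"
    and cov: "K \<subseteq> (\<Union>i\<in>C. ball i (5 * \<rho> i))"
  proof (rule Vitali_covering_lemma_balls[where K=K and S=K and a="\<lambda>x. x" and r=\<rho> and B=B])
    show "K \<subseteq> (\<Union>i\<in>K. ball i (\<rho> i))" by (auto simp: K_def)
    show "0 < \<rho> i \<and> \<rho> i \<le> B" if "i \<in> K" for i using that B by (auto simp: K_def)
  qed
  define J where "J = to_nat_on C ` C"
  define x where "x j = from_nat_into C j" for j
  define s where "s j = (if j \<in> J then \<rho> (x j) else 0)" for j
  have xC: "x j \<in> C" "0 < \<rho> (x j)" "to_nat_on C (x j) = j" if "j \<in> J" for j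
    using that C by (auto simp: J_def x_def K_def)
  have s0: "0 \<le> s j" for j using xC(2)[of j] by (auto simp: s_def)
  have sJ: "0 < s j \<longleftrightarrow> j \<in> J" for j using xC(2)[of j] by (auto simp: s_def)
  have s\<rho>: "\<rho> (x j) = s j" if "0 < s j" for j using that by (auto simp: s_def split: if_splits)
  have dj: "ball (x i) (s i) \<inter> ball (x j) (s j) = {}" if "i \<noteq> j" for i j
  proof (cases "i \<in> J \<and> j \<in> J")
    case True
    then have "x i \<noteq> x j" using that xC(3) by metis
    then show ?thesis using disj True xC(1) by (auto simp: pairwise_def disjnt_def s_def)
  qed (auto simp: s_def)
  have cover: "\<exists>j. dist y (x j) < 5 * s j" if "0 < \<rho> y" for y
  proof -
    from that cov obtain c where c: "c \<in> C" "y \<in> ball c (5 * \<rho> c)" by (auto simp: K_def)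
    then have "x (to_nat_on C c) = c" using C by (simp add: x_def)
    with c show ?thesis by (intro exI[of _ "to_nat_on C c"]) (auto simp: s_def J_def dist_commute)
  qed
  define \<psi> where "\<psi> j y = (if 0 < s j then bump ((1 / s j) *\<^sub>R (y - x j)) else 0)" for j y
  define \<eta> where "\<eta> i y = \<psi> i y * (\<Prod>j<i. 1 - \<psi> j y)" for i y
    \<comment> \<open>the partial sums of this partition of unity telescope, and no quotient has to be differentiated\<close>
  have nrm: "norm ((1 / s j) *\<^sub>R (y - x j)) = dist y (x j) / s j" if "0 < s j" for j y
    using that by (simp add: dist_norm)
  have \<psi>_range: "0 \<le> \<psi> j y" "\<psi> j y \<le> 1" for j y by (auto simp: \<psi>_def bump_range)
  have \<psi>_0: "\<psi> j y = 0" if "10 * s j \<le> dist y (x j)" for j y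
    using that by (auto simp: \<psi>_def pos_le_divide_eq nrm simp del: norm_scaleR intro!: bump_eq_0)
  have \<psi>_1: "\<psi> j y = 1" if "dist y (x j) < 5 * s j" for j y
  proof -
    have "0 < s j" using that zero_le_dist[of y "x j"] by linarith
    then show ?thesis using that
      by (auto simp: \<psi>_def pos_divide_le_eq nrm simp del: norm_scaleR intro!: bump_eq_1)
  qed
  have \<psi>_C1: "C1 (\<psi> j)" for j unfolding \<psi>_def[abs_def] by (cases "0 < s j") (auto intro: C1_bump C1_const)
  have \<psi>_lip: "\<bar>\<psi> j y - \<psi> j z\<bar> \<le> 2 / s j * dist y z" if "0 < s j" for j y z
  proof -
    have "dist ((1 / s j) *\<^sub>R (y - x j)) ((1 / s j) *\<^sub>R (z - x j)) = dist y z / s j"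
      using that by (simp add: dist_norm scaleR_diff_right[symmetric] del: scaleR_diff_right)
    then show ?thesis using that bump_lipschitz[of "(1 / s j) *\<^sub>R (y - x j)" "(1 / s j) *\<^sub>R (z - x j)"]
      by (simp add: \<psi>_def)
  qed
  have prod_range: "0 \<le> (\<Prod>j<i. 1 - \<psi> j y)" "(\<Prod>j<i. 1 - \<psi> j y) \<le> 1" for i y
    using \<psi>_range by (auto intro!: prod_nonneg prod_le_1)
  have \<eta>_range: "0 \<le> \<eta> i y" "\<eta> i y \<le> 1" for i y
    using \<psi>_range prod_range by (auto simp: \<eta>_def intro!: mult_le_one)
  have \<eta>_0: "\<eta> i y = 0" if "10 * s i \<le> dist y (x i)" for i y using \<psi>_0[OF that] by (simp add: \<eta>_def)
  have near: "8/10 * s j \<le> \<rho> y" "\<rho> y \<le> 12/10 * s j" if "dist y (x j) < 20 * s j" for y j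
  proof -
    have "0 < s j" using that zero_le_dist[of y "x j"] by linarith
    then have "\<rho> (x j) = s j" by (rule s\<rho>)
    then show "8/10 * s j \<le> \<rho> y" "\<rho> y \<le> 12/10 * s j" using lip[of y "x j"] that by linarith+
  qed
  define S where "S y = {j. dist y (x j) < 20 * s j}" for y
  have S: "finite (S y)" "real (card (S y)) \<le> 33 ^ CARD('n)" for y
    unfolding S_def using whitney_overlap_aux[OF lip s\<rho> dj] by auto
  \<comment> \<open>For points at distance at least \<open>s i\<close> the range
    \<open>[0, 1]\<close> of \<open>\<eta> i\<close> suffices. Closer points both lie within 20
    radii of \<open>x i\<close>, so every bump active at one of them has radius at least
    \<open>s i / 2\<close>, and a difference of products is bounded by the sum of the differences of
    the factors.\<close>
  have \<eta>_lip1: "\<bar>\<eta> i y - \<eta> i z\<bar> \<le> whitney_lip TYPE('n) / s i * dist y z"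
    if si: "0 < s i" and y: "dist y (x i) < 10 * s i" for i y z
  proof (cases "dist y z \<ge> s i")
    case True
    have "\<bar>\<eta> i y - \<eta> i z\<bar> \<le> 1" using \<eta>_range[of i y] \<eta>_range[of i z] by (auto simp: abs_le_iff)
    also have "\<dots> \<le> 1 / s i * dist y z" using True si by simp
    also have "\<dots> \<le> whitney_lip TYPE('n) / s i * dist y z" using si by (intro mult_right_mono divide_right_mono) auto
    finally show ?thesis .
  next
    case False
    have z: "dist z (x i) < 20 * s i"
      using False y si dist_triangle[of z "x i" y] by (simp add: dist_commute)
    have \<rho>i: "8/10 * s i \<le> \<rho> y" "8/10 * s i \<le> \<rho> z" using near[of y i] near[of z i] z y si by auto
    have big: "s i / 2 \<le> s j" if "j \<in> S y \<union> S z" for j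
      using that near(2)[of y j] near(2)[of z j] \<rho>i si by (auto simp: S_def)
    have "\<bar>\<eta> i y - \<eta> i z\<bar> \<le> (\<Sum>j\<le>i. \<bar>\<psi> j y - \<psi> j z\<bar>)"
    proof -
      define p where "p y j = (if j = i then \<psi> j y else 1 - \<psi> j y)" for y j
      have "\<eta> i y = (\<Prod>j\<le>i. p y j)" for y
      proof -
        have "{..i} = insert i {..<i}" by auto
        then show ?thesis by (simp add: \<eta>_def p_def)
      qed
      moreover have "\<bar>prod (p y) {..i} - prod (p z) {..i}\<bar> \<le> (\<Sum>j\<le>i. \<bar>p y j - p z j\<bar>)"
        using \<psi>_range by (intro prod_diff_le_sum) (auto simp: p_def abs_le_iff)
      moreover have "\<bar>p y j - p z j\<bar> = \<bar>\<psi> j y - \<psi> j z\<bar>" for j by (auto simp: p_def)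
      ultimately show ?thesis by simp
    qed
    also have "\<dots> = (\<Sum>j\<in>{..i} \<inter> (S y \<union> S z). \<bar>\<psi> j y - \<psi> j z\<bar>)"
    proof (rule sum.mono_neutral_right)
      show "\<forall>j\<in>{..i} - {..i} \<inter> (S y \<union> S z). \<bar>\<psi> j y - \<psi> j z\<bar> = 0"
      proof
        fix j assume "j \<in> {..i} - {..i} \<inter> (S y \<union> S z)"
        then have "10 * s j \<le> dist y (x j)" "10 * s j \<le> dist z (x j)" using s0[of j] by (auto simp: S_def)
        then show "\<bar>\<psi> j y - \<psi> j z\<bar> = 0" using \<psi>_0 by simp
      qed
    qed auto
    also have "\<dots> \<le> (\<Sum>j\<in>{..i} \<inter> (S y \<union> S z). 4 / s i * dist y z)"
    proof (rule sum_mono)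
      fix j assume j: "j \<in> {..i} \<inter> (S y \<union> S z)"
      have sj: "s i / 2 \<le> s j" using big j by auto
      then have "\<bar>\<psi> j y - \<psi> j z\<bar> \<le> 2 / s j * dist y z" using si by (intro \<psi>_lip) auto
      also have "\<dots> \<le> 2 / (s i / 2) * dist y z" using sj si by (intro mult_right_mono divide_left_mono) auto
      finally show "\<bar>\<psi> j y - \<psi> j z\<bar> \<le> 4 / s i * dist y z" by simp
    qed
    also have "\<dots> = real (card ({..i} \<inter> (S y \<union> S z))) * (4 / s i * dist y z)" by simp
    also have "\<dots> \<le> (2 * 33 ^ CARD('n)) * (4 / s i * dist y z)"
    proof (rule mult_right_mono)
      have "card ({..i} \<inter> (S y \<union> S z)) \<le> card (S y \<union> S z)" using S(1) by (intro card_mono) auto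
      also have "\<dots> \<le> card (S y) + card (S z)" by (rule card_Un_le)
      finally show "real (card ({..i} \<inter> (S y \<union> S z))) \<le> 2 * 33 ^ CARD('n)"
        using S(2)[of y] S(2)[of z] by linarith
    qed (use si in auto)
    also have "\<dots> = (8 * 33 ^ CARD('n)) / s i * dist y z" by simp
    also have "\<dots> \<le> whitney_lip TYPE('n) / s i * dist y z" using si by (intro mult_right_mono divide_right_mono) auto
    finally show ?thesis .
  qed
  have \<eta>_lip: "\<bar>\<eta> i y - \<eta> i z\<bar> \<le> whitney_lip TYPE('n) / s i * dist y z" if si: "0 < s i" for i y z
  proof -
    consider "dist y (x i) < 10 * s i" | "dist z (x i) < 10 * s i" | "10 * s i \<le> dist y (x i)" "10 * s i \<le> dist z (x i)"
      by linarith
    then show ?thesis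
    proof cases
      case 1 then show ?thesis using \<eta>_lip1[OF si] by blast
    next
      case 2 then show ?thesis using \<eta>_lip1[OF si, of z y] by (simp add: dist_commute abs_minus_commute)
    next
      case 3 then show ?thesis using si by (simp add: \<eta>_0)
    qed
  qed
  have \<eta>_sums: "(\<lambda>i. \<eta> i y) sums (if 0 < \<rho> y then 1 else 0)" for y
  proof (cases "0 < \<rho> y")
    case True
    then obtain j where j: "dist y (x j) < 5 * s j" using cover by blast
    have "\<forall>\<^sub>F N in sequentially. (\<Sum>i<N. \<eta> i y) = 1"
      using eventually_gt_at_top[of j]
    proof eventually_elim
      case (elim N)
      have "(\<Prod>j<N. 1 - \<psi> j y) = 0" using elim \<psi>_1[OF j] by (intro prod_zero) auto
      then show ?case unfolding \<eta>_def sum_telescope_prod by simp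
    qed
    then show ?thesis using True unfolding sums_def by (simp add: tendsto_eventually)
  next
    case False
    have "\<eta> i y = 0" for i
    proof (rule ccontr)
      assume "\<eta> i y \<noteq> 0"
      then have "dist y (x i) < 10 * s i" using \<eta>_0[of i y] by linarith
      then have "dist y (x i) < 20 * s i" "0 < s i" using zero_le_dist[of y "x i"] by linarith+
      then show False using near(1)[of y i] False by simp
    qed
    then show ?thesis using False by simp
  qed
  have "C1 (\<eta> i)" for i
    unfolding \<eta>_def[abs_def] by (intro C1_mult C1_prod C1_diff_const \<psi>_C1) auto
  then have "whitney \<rho> x s \<eta>"
    unfolding whitney_def using s0 s\<rho> dj \<eta>_range \<eta>_0 \<eta>_lip \<eta>_sums by auto
  then show ?thesis by (rule that)
qed

subsection \<open>Pointwise bounds by maximal functions\<close>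

text \<open>Recentres a function living within 10 radii of \<open>p\<close> at a point
  \<open>z\<close> up to \<open>K\<close> radii away. It is applied with \<open>K = 10\<close> for
  \<open>z\<close> in the support ball and with \<open>K = 100\<close> for \<open>z\<close> a
  nearest point outside a superlevel set.\<close>

lemma testf_of_lipschitz:
  fixes \<zeta> :: "real^'n \<Rightarrow> real"
  assumes C1: "C1 \<zeta>" and bd: "\<And>y. \<bar>\<zeta> y\<bar> \<le> 1" and supp: "\<And>y. 10 * s \<le> dist y p \<Longrightarrow> \<zeta> y = 0"
    and lip: "\<And>y z. \<bar>\<zeta> y - \<zeta> z\<bar> \<le> L / s * dist y z" and s: "0 < s" and L: "1 \<le> L"
    and z: "dist z p \<le> K * s" and K: "0 \<le> K"
  shows "(\<lambda>y. \<zeta> y / ((K + 10) * L)) \<in> testf z ((K + 10) * s)"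
proof -
  have KL: "1 \<le> (K + 10) * L" using K L mult_mono[of 1 "K + 10" 1 L] by simp
  have "C1 (\<lambda>y. \<zeta> y * (1 / ((K + 10) * L)))" by (intro C1_mult C1 C1_const)
  moreover have "\<bar>\<zeta> y / ((K + 10) * L)\<bar> \<le> 1" for y
  proof -
    have "\<bar>\<zeta> y / ((K + 10) * L)\<bar> = \<bar>\<zeta> y\<bar> / ((K + 10) * L)" using KL by (subst abs_divide) simp
    also have "\<dots> \<le> 1" using KL bd[of y] by (subst divide_le_eq_1_pos) linarith+
    finally show ?thesis .
  qed
  moreover have "\<zeta> y / ((K + 10) * L) = 0" if "(K + 10) * s \<le> dist z y" for y
  proof -
    have "10 * s \<le> dist y p" using that z dist_triangle[of z y p] by (simp add: dist_commute algebra_simps)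
    then show ?thesis using supp by simp
  qed
  moreover have "\<bar>\<zeta> y / ((K + 10) * L) - \<zeta> w / ((K + 10) * L)\<bar> \<le> dist y w / ((K + 10) * s)" for y w
  proof -
    have "\<bar>\<zeta> y / ((K + 10) * L) - \<zeta> w / ((K + 10) * L)\<bar> = \<bar>\<zeta> y - \<zeta> w\<bar> / ((K + 10) * L)"
      using KL by (simp add: diff_divide_distrib[symmetric] del: mult_eq_0_iff)
    also have "\<dots> \<le> (L / s * dist y w) / ((K + 10) * L)"
      using KL by (intro divide_right_mono lip) auto
    also have "\<dots> = dist y w / ((K + 10) * s)" using L by simp
    finally show ?thesis .
  qed
  ultimately show ?thesis by (auto simp: testf_def)
qed

lemma whitney_lip_ge_1: "1 \<le> whitney_lip TYPE('n::finite)" by simp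

lemma whitneyD:
  fixes x :: "nat \<Rightarrow> real^'n"
  assumes "whitney \<rho> x s \<eta>"
  shows "0 \<le> s i" "0 < s i \<Longrightarrow> \<rho> (x i) = s i" "i \<noteq> j \<Longrightarrow> ball (x i) (s i) \<inter> ball (x j) (s j) = {}"
    "C1 (\<eta> i)" "0 \<le> \<eta> i y" "\<eta> i y \<le> 1" "10 * s i \<le> dist y (x i) \<Longrightarrow> \<eta> i y = 0"
    "0 < s i \<Longrightarrow> \<bar>\<eta> i y - \<eta> i z\<bar> \<le> whitney_lip TYPE('n) / s i * dist y z"
    "(\<lambda>i. \<eta> i y) sums (if 0 < \<rho> y then 1 else 0)"
  using assms unfolding whitney_def by blast+

lemma whitney_abs: "whitney \<rho> x s \<eta> \<Longrightarrow> \<bar>\<eta> i y\<bar> \<le> 1"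
  using whitneyD(5)[of \<rho> x s \<eta> i y] whitneyD(6)[of \<rho> x s \<eta> i y] by simp

lemma whitney_zero: "whitney \<rho> x s \<eta> \<Longrightarrow> s i = 0 \<Longrightarrow> \<eta> i y = 0"
  using whitneyD(7)[of \<rho> x s \<eta> i y] by simp

lemma whitney_near:
  fixes x :: "nat \<Rightarrow> real^'n"
  assumes W: "whitney \<rho> x s \<eta>" and lip: "\<And>y z. \<bar>\<rho> y - \<rho> z\<bar> \<le> dist y z / 100" and d: "dist y (x i) < 20 * s i"
  shows "0 < s i" "8/10 * s i \<le> \<rho> y" "\<rho> y \<le> 12/10 * s i"
proof -
  show s: "0 < s i" using d zero_le_dist[of y "x i"] by linarith
  then have "\<rho> (x i) = s i" by (rule whitneyD(2)[OF W])
  then show "8/10 * s i \<le> \<rho> y" "\<rho> y \<le> 12/10 * s i" using lip[of y "x i"] d by linarith+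
qed

lemma whitney_eta_pos:
  fixes x :: "nat \<Rightarrow> real^'n"
  assumes W: "whitney \<rho> x s \<eta>" and e: "\<eta> i y \<noteq> 0"
  shows "0 < s i" "dist y (x i) < 10 * s i"
proof -
  show d: "dist y (x i) < 10 * s i" using whitneyD(7)[OF W, of i y] e by linarith
  then show "0 < s i" using zero_le_dist[of y "x i"] by linarith
qed

lemma open_pos_set:
  fixes \<rho> :: "'a::metric_space \<Rightarrow> real"
  assumes lip: "\<And>y z. \<bar>\<rho> y - \<rho> z\<bar> \<le> dist y z / 100"
  shows "open {y. 0 < \<rho> y}"
proof -
  have "continuous_on UNIV \<rho>"
    unfolding continuous_on_iff
  proof (intro ballI allI impI)
    fix x and e :: real assume "0 < e"
    show "\<exists>d>0. \<forall>x'\<in>UNIV. dist x' x < d \<longrightarrow> dist (\<rho> x') (\<rho> x) < e"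
    proof (intro exI[of _ e] conjI ballI impI)
      fix x' assume d: "dist x' x < e"
      have "\<bar>\<rho> x' - \<rho> x\<bar> \<le> dist x' x / 100" by (rule lip)
      then show "dist (\<rho> x') (\<rho> x) < e" using d zero_le_dist[of x' x] unfolding dist_real_def by linarith
    qed fact
  qed
  then show ?thesis by (intro open_Collect_less continuous_on_const)
qed

text \<open>The undilated balls are disjoint and contained in the set where \<open>\<rho>\<close> is
  positive, so that set pays for the sum of \<open>s i ^ n\<close>.\<close>

lemma whitney_volume:
  fixes x :: "nat \<Rightarrow> real^'n"
  assumes W: "whitney \<rho> x s \<eta>" and lip: "\<And>y z. \<bar>\<rho> y - \<rho> z\<bar> \<le> dist y z / 100"
    and fin: "emeasure lborel {y. 0 < \<rho> y} < \<infinity>"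
  shows "summable (\<lambda>i. s i ^ CARD('n))"
    "uvol TYPE('n) * (\<Sum>i. s i ^ CARD('n)) \<le> measure lborel {y. 0 < \<rho> y}"
proof -
  let ?V = "uvol TYPE('n)"
  have [measurable]: "{y. 0 < \<rho> y} \<in> sets borel" using open_pos_set[OF lip] by auto
  have "(\<Sum>i. ennreal (?V * s i ^ CARD('n))) = (\<Sum>i. emeasure lborel (ball (x i) (s i)))"
    by (simp only: emeasure_ball_vec whitneyD(1)[OF W])
  also have "\<dots> = emeasure lborel (\<Union>i. ball (x i) (s i))"
    using whitneyD(3)[OF W] by (intro suminf_emeasure) (auto simp: disjoint_family_on_def)
  also have "\<dots> \<le> emeasure lborel {y. 0 < \<rho> y}"
  proof (intro emeasure_mono subsetI)
    fix y assume "y \<in> (\<Union>i. ball (x i) (s i))"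
    then obtain i where "dist y (x i) < s i" by (auto simp: dist_commute)
    then have "dist y (x i) < 20 * s i" using whitneyD(1)[OF W, of i] by linarith
    from whitney_near[OF W lip this] show "y \<in> {y. 0 < \<rho> y}" by simp
  qed auto
  also have "\<dots> = ennreal (measure lborel {y. 0 < \<rho> y})" using fin by (intro emeasure_eq_ennreal_measure) auto
  finally have le: "(\<Sum>i. ennreal (?V * s i ^ CARD('n))) \<le> ennreal (measure lborel {y. 0 < \<rho> y})" .
  have V: "0 < ?V" by simp
  have nn: "0 \<le> ?V * s i ^ CARD('n)" for i using whitneyD(1)[OF W] by simp
  have sm: "summable (\<lambda>i. ?V * s i ^ CARD('n))"
    by (rule summable_suminf_not_top[OF nn neq_top_trans[OF ennreal_neq_top le]])
  then show "summable (\<lambda>i. s i ^ CARD('n))"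
    using summable_mult[OF sm, of "1 / ?V"] V by simp
  from le have "(\<Sum>i. ?V * s i ^ CARD('n)) \<le> measure lborel {y. 0 < \<rho> y}"
    unfolding suminf_ennreal2[OF nn sm] by (subst (asm) ennreal_le_iff) simp_all
  then show "?V * (\<Sum>i. s i ^ CARD('n)) \<le> measure lborel {y. 0 < \<rho> y}"
    unfolding suminf_mult[OF \<open>summable (\<lambda>i. s i ^ CARD('n))\<close>] .
qed

lemma integrable_bounded_scaleR:
  fixes h :: "'a \<Rightarrow> 'b::{banach,second_countable_topology}"
  assumes "integrable M h" "\<kappa> \<in> borel_measurable M" "\<And>y. \<bar>\<kappa> y\<bar> \<le> B"
  shows "integrable M (\<lambda>y. \<kappa> y *\<^sub>R h y)"
proof (rule Bochner_Integration.integrable_bound)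
  show "integrable M (\<lambda>y. B *\<^sub>R h y)" using assms(1) by simp
  show "AE y in M. norm (\<kappa> y *\<^sub>R h y) \<le> norm (B *\<^sub>R h y)"
  proof (rule AE_I2)
    fix y
    have "\<bar>\<kappa> y\<bar> \<le> \<bar>B\<bar>" using assms(3)[of y] by linarith
    then show "norm (\<kappa> y *\<^sub>R h y) \<le> norm (B *\<^sub>R h y)" unfolding norm_scaleR by (rule mult_right_mono) simp
  qed
qed (use assms in auto)

lemma whitney_measurable: "whitney \<rho> x s \<eta> \<Longrightarrow> \<eta> i \<in> borel_measurable borel"
  using whitneyD(4) C1_measurable by blast

lemma whitney_integrable:
  fixes h :: "real^'n \<Rightarrow> 'b::{banach,second_countable_topology}"
  assumes W: "whitney \<rho> x s \<eta>" and h: "integrable lborel h"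
  shows "integrable lborel (\<lambda>y. \<eta> i y *\<^sub>R h y)"
  using whitney_measurable[OF W] whitney_abs[OF W] by (intro integrable_bounded_scaleR[OF h, of _ 1]) simp_all

text \<open>Partial sums of the nonnegative \<open>\<eta> i\<close> never exceed 1, so the absolute
  series is controlled by \<open>norm (h y)\<close> and may be integrated term by term.\<close>

lemma whitney_sums_integral:
  fixes h :: "real^'n \<Rightarrow> 'b::{banach,second_countable_topology}"
  assumes W: "whitney \<rho> x s \<eta>" and h: "integrable lborel h"
  shows "(\<lambda>i. LINT y|lborel. \<eta> i y *\<^sub>R h y) sums (LINT y|lborel. indicator {y. 0 < \<rho> y} y *\<^sub>R h y)"
proof -
  have eq: "(\<Sum>i. \<eta> i y *\<^sub>R h y) = indicator {y. 0 < \<rho> y} y *\<^sub>R h y" for y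
    using sums_scaleR_left[OF whitneyD(9)[OF W, of y], of "h y"]
    by (simp add: sums_iff indicator_def split: if_splits)
  have int: "integrable lborel (\<lambda>y. \<eta> i y *\<^sub>R h y)" for i by (rule whitney_integrable[OF W h])
  have "(\<lambda>i. LINT y|lborel. \<eta> i y *\<^sub>R h y) sums (LINT y|lborel. (\<Sum>i. \<eta> i y *\<^sub>R h y))"
  proof (rule sums_integral[OF int])
    show "AE y in lborel. summable (\<lambda>i. norm (\<eta> i y *\<^sub>R h y))"
      using whitneyD(5)[OF W] sums_summable[OF whitneyD(9)[OF W]] by (intro AE_I2) (simp add: summable_mult2)
    show "summable (\<lambda>i. LINT y|lborel. norm (\<eta> i y *\<^sub>R h y))"
    proof (rule summableI_nonneg_bounded)
      fix n
      have "(\<Sum>i<n. LINT y|lborel. norm (\<eta> i y *\<^sub>R h y)) = (LINT y|lborel. (\<Sum>i<n. norm (\<eta> i y *\<^sub>R h y)))"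
        using int by (intro Bochner_Integration.integral_sum[symmetric] integrable_norm)
      also have "\<dots> \<le> (LINT y|lborel. norm (h y))"
      proof (rule integral_mono)
        show "integrable lborel (\<lambda>y. (\<Sum>i<n. norm (\<eta> i y *\<^sub>R h y)))"
          by (intro Bochner_Integration.integrable_sum integrable_norm int)
        show "(\<Sum>i<n. norm (\<eta> i y *\<^sub>R h y)) \<le> norm (h y)" for y
        proof -
          have "(\<Sum>i<n. \<eta> i y) \<le> (\<Sum>i. \<eta> i y)"
            using whitneyD(5)[OF W] sums_summable[OF whitneyD(9)[OF W]] by (intro sum_le_suminf) auto
          also have "\<dots> \<le> 1" using whitneyD(9)[OF W, of y] by (simp add: sums_iff split: if_splits)
          finally have "(\<Sum>i<n. \<eta> i y) * norm (h y) \<le> 1 * norm (h y)" by (rule mult_right_mono) simp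
          then show ?thesis using whitneyD(5)[OF W] by (simp add: sum_distrib_right)
        qed
      qed (use h in auto)
      finally show "(\<Sum>i<n. LINT y|lborel. norm (\<eta> i y *\<^sub>R h y)) \<le> (LINT y|lborel. norm (h y))" .
    qed auto
  qed
  then show ?thesis unfolding eq .
qed

section \<open>Domination of a function almost everywhere by its integrals against test
  functions\<close>

lemma outer_open_set:
  fixes h :: "'a::euclidean_space \<Rightarrow> 'b::{banach,second_countable_topology}"
  assumes h: "integrable lborel h" and A: "A \<in> sets borel" "A \<subseteq> W" "A \<subseteq> ball 0 R" and W: "open W" and e: "0 < e"
  obtains U where "open U" "A \<subseteq> U" "U \<subseteq> W" "U \<subseteq> ball 0 R"
    "measure lborel (U - A) \<le> e" "(LINT y|lborel. indicator (U - A) y *\<^sub>R norm (h y)) \<le> e"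
proof -
  \<comment> \<open>Outer regularity is applied to a single finite measure combining Lebesgue
    measure on the ball with the density \<open>norm (h x)\<close>, so that one open set
    approximates \<open>A\<close> in both senses.\<close>
  define M where "M = density lborel (\<lambda>x. ennreal (norm (h x)) + indicator (ball 0 R) x)"
  have [measurable]: "h \<in> borel_measurable borel" using h by (auto dest: borel_measurable_integrable)
  have eM: "emeasure M S = (\<integral>\<^sup>+y. ennreal (norm (h y)) * indicator S y \<partial>lborel) + emeasure lborel (ball 0 R \<inter> S)"
    if [measurable]: "S \<in> sets borel" for S
  proof -
    have "emeasure M S = (\<integral>\<^sup>+y. ennreal (norm (h y)) * indicator S y + indicator (ball 0 R \<inter> S) y \<partial>lborel)"
      unfolding M_def by (subst emeasure_density) (auto intro!: nn_integral_cong simp: indicator_def)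
    also have "\<dots> = (\<integral>\<^sup>+y. ennreal (norm (h y)) * indicator S y \<partial>lborel) + emeasure lborel (ball 0 R \<inter> S)"
      by (subst nn_integral_add) auto
    finally show ?thesis .
  qed
  have sM: "sets M = sets borel" by (simp add: M_def)
  have "emeasure M UNIV \<noteq> \<infinity>"
  proof -
    have "(\<integral>\<^sup>+y. ennreal (norm (h y)) \<partial>lborel) < \<infinity>"
      using h by (auto simp: integrable_iff_bounded)
    moreover have "emeasure lborel (ball (0::'a) R) < \<infinity>" by (rule emeasure_lborel_ball_finite)
    ultimately show ?thesis by (simp add: eM ennreal_add_eq_top less_top)
  qed
  then interpret M: finite_measure M
    by (intro finite_measureI) (simp add: M_def)
  have "emeasure M A < emeasure M A + ennreal e"
    using e M.emeasure_finite[of A] by (simp add: ennreal_add_left_cancel_less less_top)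
  then have "(INF U \<in> {U. A \<subseteq> U \<and> open U}. emeasure M U) < emeasure M A + ennreal e"
    using outer_regular[OF sM, of A] A(1) M.emeasure_finite by (simp add: M_def)
  then obtain U0 where U0: "A \<subseteq> U0" "open U0" "emeasure M U0 < emeasure M A + ennreal e"
    by (auto simp: INF_less_iff)
  define U where "U = U0 \<inter> (W \<inter> ball 0 R)"
  have U: "open U" "A \<subseteq> U" "U \<subseteq> W" "U \<subseteq> ball 0 R" using U0 W A by (auto simp: U_def)
  have [measurable]: "U \<in> sets borel" "A \<in> sets borel" using U A by auto
  have "emeasure M (U - A) + emeasure M A = emeasure M U"
    using U by (subst plus_emeasure) (auto simp: sM intro!: arg_cong[where f="emeasure M"])
  also have "\<dots> \<le> emeasure M U0" using U0 by (intro emeasure_mono) (auto simp: U_def sM)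
  also note U0(3)
  finally have "emeasure M (U - A) < ennreal e"
    by (simp add: add.commute[of _ "emeasure M A"] ennreal_add_left_cancel_less)
  moreover have "ball 0 R \<inter> (U - A) = U - A" using U by auto
  ultimately have sm: "(\<integral>\<^sup>+y. ennreal (norm (h y)) * indicator (U - A) y \<partial>lborel) + emeasure lborel (U - A) \<le> ennreal e"
    by (simp add: eM)
  have m: "emeasure lborel (U - A) \<le> ennreal e" by (rule order_trans[OF _ sm]) simp
  then have 1: "measure lborel (U - A) \<le> e"
    using e unfolding measure_def by (intro enn2real_leI) simp_all
  have "(\<integral>\<^sup>+y. ennreal (norm (h y)) * indicator (U - A) y \<partial>lborel) \<le> ennreal e" by (rule order_trans[OF _ sm]) simp
  also have "(\<integral>\<^sup>+y. ennreal (norm (h y)) * indicator (U - A) y \<partial>lborel)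
     = (\<integral>\<^sup>+y. ennreal (indicator (U - A) y *\<^sub>R norm (h y)) \<partial>lborel)"
    by (intro nn_integral_cong) (auto simp: indicator_def)
  finally have 2: "(LINT y|lborel. indicator (U - A) y *\<^sub>R norm (h y)) \<le> e"
    using e by (subst integral_eq_nn_integral) (auto intro!: enn2real_leI)
  show ?thesis using that U 1 2 by blast
qed

text \<open>An open \<open>U\<close> slightly larger than \<open>A\<close> is cut into Whitney
  pieces. A piece close to \<open>A\<close> is a test function at a point of \<open>A\<close>, where
  \<open>N\<close> is at most \<alpha>, and the volumes of these pieces add up to at most that of
  \<open>U\<close>. The other pieces see \<open>h\<close> only on \<open>U - A\<close>, where its
  integral is small. Then the excess \<open>e\<close> tends to 0.\<close>

lemma integral_bound_sublevel:
  fixes h :: "real^'n \<Rightarrow> complex" and N :: "real^'n \<Rightarrow> ennreal"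
  assumes h: "integrable lborel h" and W: "open W" and \<delta>: "0 < \<delta>"
    and test: "\<And>x t \<zeta>. x \<in> W \<Longrightarrow> 0 < t \<Longrightarrow> t < \<delta> \<Longrightarrow> \<zeta> \<in> testf x t \<Longrightarrow>
        ennreal (norm (LINT y|lborel. \<zeta> y *\<^sub>R h y)) \<le> ennreal (t ^ CARD('n)) * N x"
    and \<alpha>: "0 \<le> \<alpha>" and A: "A \<in> sets borel" "A \<subseteq> W" "A \<subseteq> ball 0 R" "\<And>y. y \<in> A \<Longrightarrow> N y \<le> ennreal \<alpha>"
  shows "norm (LINT y|lborel. indicator A y *\<^sub>R h y) \<le>
    20 * whitney_lip TYPE('n) * 20 ^ CARD('n) / uvol TYPE('n) * \<alpha> * measure lborel A"
proof -
  let ?V = "uvol TYPE('n)" and ?L = "whitney_lip TYPE('n)"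
  have V: "0 < ?V" by simp
  define c where "c = 20 * ?L * 20 ^ CARD('n)"
  have c: "0 \<le> c" by (simp add: c_def)
  have [measurable]: "A \<in> sets borel" by fact
  have main: "norm (LINT y|lborel. indicator A y *\<^sub>R h y) \<le> c / ?V * \<alpha> * (measure lborel A + e) + 2 * e" if e: "0 < e" for e
  proof -
    obtain U where U: "open U" "A \<subseteq> U" "U \<subseteq> W" "U \<subseteq> ball 0 R" "measure lborel (U - A) \<le> e"
      and Ue: "(LINT y|lborel. indicator (U - A) y *\<^sub>R norm (h y)) \<le> e"
      by (rule outer_open_set[OF h A(1-3) W e])
    have [measurable]: "U \<in> sets borel" using U by auto
    have ne: "- U \<noteq> {}"
    proof
      assume "- U = {}"
      then have "UNIV \<subseteq> ball (0::real^'n) R" using U by auto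
      then show False using bounded_subset[OF bounded_ball] not_bounded_UNIV by blast
    qed
    have bU: "emeasure lborel S < \<infinity>" if "S \<subseteq> U" for S
      using le_less_trans[OF emeasure_mono emeasure_lborel_ball_finite[of 0 R]] that U(4) by auto
    \<comment> \<open>The cap keeps \<open>s i <= \<delta> / 100\<close>, so that test functions at
      scale \<open>20 * s i\<close> are covered by the hypothesis; it does not change the set where
      \<open>\<rho>\<close> is positive.\<close>
    define \<rho> where "\<rho> y = min (infdist y (- U)) \<delta> / 100" for y
    have lip: "\<bar>\<rho> y - \<rho> z\<bar> \<le> dist y z / 100" for y z
      using infdist_triangle_abs[of y "- U" z] unfolding \<rho>_def by linarith
    have "y \<in> - U \<longleftrightarrow> infdist y (- U) = 0" for y
      using U(1) ne by (intro in_closed_iff_infdist_zero) auto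
    then have "y \<in> U \<longleftrightarrow> 0 < infdist y (- U)" for y
      using infdist_nonneg[of y "- U"] by (metis ComplI Compl_iff order_less_le)
    then have \<rho>U: "{y. 0 < \<rho> y} = U" using \<delta> by (auto simp: \<rho>_def)
    obtain x s \<eta> where Wh: "whitney \<rho> x s \<eta>"
    proof (rule whitney_exists[OF lip])
      show "\<rho> y \<le> \<delta> / 100" for y by (auto simp: \<rho>_def)
    qed
    let ?D = "\<lambda>y. indicator (U - A) y *\<^sub>R norm (h y)"
    have D: "integrable lborel ?D" using h by (intro integrable_mult_indicator) auto
    have trm: "norm (LINT y|lborel. \<eta> i y *\<^sub>R h y) \<le> c * \<alpha> * s i ^ CARD('n) + (LINT y|lborel. \<eta> i y *\<^sub>R ?D y)" for i
    \<comment> \<open>Either the support ball meets \<open>A\<close>, or \<open>h\<close> may be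
      replaced there by its restriction to \<open>U - A\<close>.\<close>
    proof (cases "\<exists>z\<in>A. dist z (x i) < 10 * s i")
      case True
      then obtain z where z: "z \<in> A" "dist z (x i) < 10 * s i" by blast
      then have s: "0 < s i" using zero_le_dist[of z "x i"] by linarith
      have "(\<lambda>y. \<eta> i y / ((10 + 10) * ?L)) \<in> testf z ((10 + 10) * s i)"
        using z(2) by (intro testf_of_lipschitz[where p="x i"] whitneyD(4)[OF Wh] whitney_abs[OF Wh]
            whitneyD(7)[OF Wh] whitneyD(8)[OF Wh s] s whitney_lip_ge_1) simp_all
      moreover have "(10 + 10) * s i < \<delta>"
        using whitneyD(2)[OF Wh s] \<delta> by (simp add: \<rho>_def)
      ultimately have "ennreal (norm (LINT y|lborel. (\<eta> i y / ((10 + 10) * ?L)) *\<^sub>R h y)) \<le> ennreal (((10 + 10) * s i) ^ CARD('n)) * N z"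
        using s z A(2) by (intro test) auto
      also have "\<dots> \<le> ennreal (((10 + 10) * s i) ^ CARD('n)) * ennreal \<alpha>"
        using A(4) z by (intro mult_left_mono) auto
      also have "\<dots> = ennreal (((10 + 10) * s i) ^ CARD('n) * \<alpha>)"
        using s \<alpha> by (simp add: ennreal_mult)
      finally have "norm (LINT y|lborel. (\<eta> i y / ((10 + 10) * ?L)) *\<^sub>R h y) \<le> ((10 + 10) * s i) ^ CARD('n) * \<alpha>"
        using s \<alpha> by (subst (asm) ennreal_le_iff) auto
      also have "(LINT y|lborel. (\<eta> i y / ((10 + 10) * ?L)) *\<^sub>R h y) = (1 / (20 * ?L)) *\<^sub>R (LINT y|lborel. \<eta> i y *\<^sub>R h y)"
        by (subst integral_scaleR_right[symmetric]) (simp add: divide_inverse mult_ac)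
      finally have "norm (LINT y|lborel. \<eta> i y *\<^sub>R h y) / (20 * ?L) \<le> (20 * s i) ^ CARD('n) * \<alpha>"
        by (simp add: add_nonneg_nonneg)
      then have "norm (LINT y|lborel. \<eta> i y *\<^sub>R h y) \<le> ((20 * s i) ^ CARD('n) * \<alpha>) * (20 * ?L)"
        by (subst (asm) pos_divide_le_eq) (auto intro: add_nonneg_pos)
      also have "\<dots> = c * \<alpha> * s i ^ CARD('n)" unfolding c_def power_mult_distrib by (simp add: mult_ac)
      also have "\<dots> \<le> c * \<alpha> * s i ^ CARD('n) + (LINT y|lborel. \<eta> i y *\<^sub>R ?D y)"
        using whitneyD(5)[OF Wh] by (simp add: integral_nonneg_AE)
      finally show ?thesis .
    next
      case False
      have eq: "norm (\<eta> i y *\<^sub>R h y) = \<eta> i y *\<^sub>R ?D y" for y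
      proof (cases "\<eta> i y = 0")
        case F: False
        from whitney_eta_pos[OF Wh F] have d: "dist y (x i) < 10 * s i" "0 < s i" by auto
        then have "0 < \<rho> y" using whitney_near(2)[OF Wh lip, of y i] by auto
        then have "y \<in> U" using \<rho>U by auto
        moreover have "y \<notin> A" using False d by auto
        ultimately show ?thesis using whitneyD(5)[OF Wh, of i y] by simp
      qed simp
      have "norm (LINT y|lborel. \<eta> i y *\<^sub>R h y) \<le> (LINT y|lborel. norm (\<eta> i y *\<^sub>R h y))"
        by (rule integral_norm_bound)
      also have "\<dots> = (LINT y|lborel. \<eta> i y *\<^sub>R ?D y)" unfolding eq ..
      also have "\<dots> \<le> c * \<alpha> * s i ^ CARD('n) + (LINT y|lborel. \<eta> i y *\<^sub>R ?D y)"
        using c \<alpha> whitneyD(1)[OF Wh] by simp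
      finally show ?thesis .
    qed
    have vol: "summable (\<lambda>i. s i ^ CARD('n))" "?V * (\<Sum>i. s i ^ CARD('n)) \<le> measure lborel U"
      using whitney_volume[OF Wh lip] bU[OF subset_refl] by (auto simp: \<rho>U)
    have sD: "(\<lambda>i. LINT y|lborel. \<eta> i y *\<^sub>R ?D y) sums (LINT y|lborel. ?D y)"
    proof -
      have "indicator U y *\<^sub>R ?D y = ?D y" for y by (simp add: indicator_def)
      with whitney_sums_integral[OF Wh D] show ?thesis unfolding \<rho>U by (simp only:)
    qed
    have sb: "(\<lambda>i. c * \<alpha> * s i ^ CARD('n) + (LINT y|lborel. \<eta> i y *\<^sub>R ?D y)) sums
        (c * \<alpha> * (\<Sum>i. s i ^ CARD('n)) + (LINT y|lborel. ?D y))"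
      by (intro sums_add sums_mult summable_sums vol sD)
    have "(LINT y|lborel. indicator U y *\<^sub>R h y) = (\<Sum>i. LINT y|lborel. \<eta> i y *\<^sub>R h y)"
      using whitney_sums_integral[OF Wh h] unfolding \<rho>U by (simp add: sums_iff)
    then have "norm (LINT y|lborel. indicator U y *\<^sub>R h y) \<le> c * \<alpha> * (\<Sum>i. s i ^ CARD('n)) + (LINT y|lborel. ?D y)"
      using norm_suminf_le[OF trm sums_summable[OF sb]] sums_unique[OF sb] by simp
    also have "\<dots> \<le> c * \<alpha> * (measure lborel U / ?V) + e"
      using vol(2) V c \<alpha> Ue by (intro add_mono mult_left_mono) (auto simp: pos_le_divide_eq mult.commute)
    also have "measure lborel U \<le> measure lborel A + e"
    proof -
      have "measure lborel U = measure lborel A + measure lborel (U - A)"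
        using bU U by (subst measure_Union[symmetric]) (auto simp: less_top intro!: arg_cong[where f="measure lborel"])
      with U(5) show ?thesis by simp
    qed
    finally have 1: "norm (LINT y|lborel. indicator U y *\<^sub>R h y) \<le> c * \<alpha> * ((measure lborel A + e) / ?V) + e"
      using c \<alpha> V by (simp add: mult_left_mono divide_right_mono)
    have iU: "integrable lborel (\<lambda>y. indicator S y *\<^sub>R h y)" if "S \<in> sets borel" for S :: "(real^'n) set"
      using that by (intro integrable_mult_indicator h) auto
    have "(LINT y|lborel. indicator U y *\<^sub>R h y) = (LINT y|lborel. indicator A y *\<^sub>R h y + indicator (U - A) y *\<^sub>R h y)"
      using U by (intro Bochner_Integration.integral_cong) (auto simp: indicator_def)
    also have "\<dots> = (LINT y|lborel. indicator A y *\<^sub>R h y) + (LINT y|lborel. indicator (U - A) y *\<^sub>R h y)"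
      by (intro Bochner_Integration.integral_add iU) auto
    finally have "(LINT y|lborel. indicator A y *\<^sub>R h y) = (LINT y|lborel. indicator U y *\<^sub>R h y) - (LINT y|lborel. indicator (U - A) y *\<^sub>R h y)" by simp
    then have "norm (LINT y|lborel. indicator A y *\<^sub>R h y) \<le>
       norm (LINT y|lborel. indicator U y *\<^sub>R h y) + norm (LINT y|lborel. indicator (U - A) y *\<^sub>R h y)"
      by (simp add: norm_triangle_ineq4)
    moreover have "norm (LINT y|lborel. indicator (U - A) y *\<^sub>R h y) \<le> e"
      using Ue integral_norm_bound[of lborel "\<lambda>y. indicator (U - A) y *\<^sub>R h y"] by simp
    ultimately have "norm (LINT y|lborel. indicator A y *\<^sub>R h y) \<le> c * \<alpha> * ((measure lborel A + e) / ?V) + 2 * e"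
      using 1 by linarith
    then show ?thesis by simp
  qed
  have "norm (LINT y|lborel. indicator A y *\<^sub>R h y) \<le> c / ?V * \<alpha> * measure lborel A"
  proof (rule tendsto_lowerbound)
    have "((\<lambda>e. k * (m + e) + 2 * e) \<longlongrightarrow> k * (m + 0) + 2 * 0) (at_right 0)" for k m :: real
      by (intro tendsto_intros)
    from this[of "c / ?V * \<alpha>" "measure lborel A"]
    show "((\<lambda>e. c / ?V * \<alpha> * (measure lborel A + e) + 2 * e) \<longlongrightarrow> c / ?V * \<alpha> * measure lborel A) (at_right 0)"
      by simp
    show "\<forall>\<^sub>F e in at_right 0. norm (LINT y|lborel. indicator A y *\<^sub>R h y) \<le> c / ?V * \<alpha> * (measure lborel A + e) + 2 * e"
      using main by (auto simp: eventually_at_filter)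
  qed simp
  then show ?thesis unfolding c_def .
qed

text \<open>Averages of \<open>h\<close> over subsets of a sublevel set stay in a closed ball of
  radius \<open>c * \<alpha>\<close>; by the averaging theorem almost all values of \<open>h\<close>
  on that set do as well. This takes the place of Lebesgue differentiation. Letting \<alpha> run
  through the nonnegative rationals compares \<open>h\<close> with \<open>N\<close>
  pointwise.\<close>

lemma AE_le_maximal:
  fixes h :: "real^'n \<Rightarrow> complex" and N :: "real^'n \<Rightarrow> ennreal"
  assumes h: "integrable lborel h" and W: "open W" and \<delta>: "0 < \<delta>"
    and lsc: "\<And>\<alpha>::real. 0 \<le> \<alpha> \<Longrightarrow> open {y\<in>W. ennreal \<alpha> < N y}"
    and test: "\<And>x t \<zeta>. x \<in> W \<Longrightarrow> 0 < t \<Longrightarrow> t < \<delta> \<Longrightarrow> \<zeta> \<in> testf x t \<Longrightarrow>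
        ennreal (norm (LINT y|lborel. \<zeta> y *\<^sub>R h y)) \<le> ennreal (t ^ CARD('n)) * N x"
  shows "AE x in lborel. x \<in> W \<longrightarrow> ennreal (norm (h x)) \<le>
    ennreal (20 * whitney_lip TYPE('n) * 20 ^ CARD('n) / uvol TYPE('n)) * N x"
proof -
  define c where "c = 20 * whitney_lip TYPE('n) * 20 ^ CARD('n) / uvol TYPE('n)"
  have c: "0 < c" by (simp add: c_def add_nonneg_pos)
  have [measurable]: "h \<in> borel_measurable borel" using h by (auto dest: borel_measurable_integrable)
  have "AE x in lborel. x \<in> W \<longrightarrow> x \<in> ball 0 (real R) \<longrightarrow> N x \<le> ennreal \<alpha> \<longrightarrow> norm (h x) \<le> c * \<alpha>"
    if \<alpha>: "0 \<le> \<alpha>" for \<alpha> and R :: nat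
  proof -
    define F where "F = (W - {y\<in>W. ennreal \<alpha> < N y}) \<inter> ball 0 (real R)"
    have [measurable]: "F \<in> sets borel" using lsc[OF \<alpha>] W by (auto simp: F_def)
    have "AE x in lborel. indicator F x *\<^sub>R h x \<in> cball 0 (c * \<alpha>)"
    proof (rule sigma_finite_measure.averaging_theorem[OF sigma_finite_lborel])
      show "integrable lborel (\<lambda>x. indicator F x *\<^sub>R h x)" using h by (intro integrable_mult_indicator) auto
      fix A :: "(real^'n) set" assume A[measurable]: "A \<in> sets lborel" and pos: "0 < measure lborel A"
      have fA: "emeasure lborel A < \<infinity>"
        using pos by (auto simp: measure_def less_top[symmetric] enn2real_eq_0_iff)
      have "norm (LINT y|lborel. indicator (A \<inter> F) y *\<^sub>R h y) \<le> c * \<alpha> * measure lborel (A \<inter> F)"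
      proof -
        have AF: "A \<inter> F \<in> sets borel" by measurable
        show ?thesis unfolding c_def
          by (rule integral_bound_sublevel[OF h W \<delta> test \<alpha> AF, where R="real R"]) (auto simp: F_def not_less)
      qed
      also have "\<dots> \<le> c * \<alpha> * measure lborel A"
        using c \<alpha> fA A by (intro mult_left_mono measure_mono_fmeasurable) (auto simp: fmeasurable_def)
      also have "(LINT y|lborel. indicator (A \<inter> F) y *\<^sub>R h y) = set_lebesgue_integral lborel A (\<lambda>x. indicator F x *\<^sub>R h x)"
        unfolding set_lebesgue_integral_def by (intro Bochner_Integration.integral_cong) (auto simp: indicator_def)
      finally show "(1 / measure lborel A) *\<^sub>R set_lebesgue_integral lborel A (\<lambda>x. indicator F x *\<^sub>R h x) \<in> cball 0 (c * \<alpha>)"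
        using pos by (simp add: pos_divide_le_eq)
    qed simp
    then show ?thesis by eventually_elim (auto simp: F_def indicator_def not_less split: if_splits)
  qed
  then have "AE x in lborel. \<forall>R::nat. \<forall>q\<in>{q::rat. 0 \<le> q}. x \<in> W \<longrightarrow> x \<in> ball 0 (real R) \<longrightarrow>
      N x \<le> ennreal (of_rat q) \<longrightarrow> norm (h x) \<le> c * of_rat q"
    by (intro AE_all_countable[THEN iffD2] allI AE_ball_countable[THEN iffD2] ballI) auto
  then show ?thesis
  proof eventually_elim
    case (elim x)
    show ?case
    proof
      assume x: "x \<in> W"
      obtain R :: nat where R: "norm x < real R" using reals_Archimedean2 by blast
      show "ennreal (norm (h x)) \<le> ennreal (20 * whitney_lip TYPE('n) * 20 ^ CARD('n) / uvol TYPE('n)) * N x"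
        unfolding c_def[symmetric]
      proof (cases "N x")
        case (real v)
        have "norm (h x) \<le> c * v"
        proof (rule ccontr)
          assume "\<not> norm (h x) \<le> c * v"
          then have "v < norm (h x) / c" using c by (simp add: pos_less_divide_eq mult.commute)
          then obtain q where q: "v < of_rat q" "of_rat q < norm (h x) / c" using of_rat_dense by blast
          then have q0: "0 \<le> q" using real(1) by (metis le_less_trans less_imp_le zero_le_of_rat_iff order_trans)
          have "N x \<le> ennreal (of_rat q)" using q real by (simp add: ennreal_leI)
          then have "norm (h x) \<le> c * of_rat q" using elim q0 x R by (auto simp: dist_norm)
          with q(2) c show False by (simp add: pos_less_divide_eq mult.commute)
        qed
        then show "ennreal (norm (h x)) \<le> ennreal c * N x"
          using real c by (simp add: ennreal_mult[symmetric] ennreal_leI)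
      next
        case top
        then show "ennreal (norm (h x)) \<le> ennreal c * N x" using c by (simp add: ennreal_mult_top)
      qed
    qed
  qed
qed

subsection \<open>The Calderon--Zygmund decomposition of a local piece\<close>

lemma unit_ball_vol_nz [simp]: "unit_ball_vol (real n) \<noteq> 0"
  using unit_ball_vol_pos[of "real n"] by linarith

text \<open>Carries the mean of a Whitney piece. Because it lives on the undilated ball and not on
  the support of \<open>\<eta> i\<close>, any series of such terms has at most one nonzero term at
  each point, and its sup norm is that of a single term.\<close>

definition nball :: "(nat \<Rightarrow> real^'n) \<Rightarrow> (nat \<Rightarrow> real) \<Rightarrow> nat \<Rightarrow> real^'n \<Rightarrow> real" where
  "nball x s i y = indicator (ball (x i) (s i)) y / (uvol TYPE('n) * s i ^ CARD('n))"

lemma nball_measurable [measurable]: "nball x s i \<in> borel_measurable borel"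
  unfolding nball_def[abs_def] by measurable

lemma nball_integrable: "0 \<le> s i \<Longrightarrow> integrable lborel (nball x s i)"
  and nball_integral: "0 < s i \<Longrightarrow> (LINT y|lborel. nball (x :: nat \<Rightarrow> real^'n) s i y) = 1"
proof -
  have fin: "emeasure lborel (ball (x i) (s i)) < \<infinity>" by (rule emeasure_lborel_ball_finite)
  then have i: "integrable lborel (indicator (ball (x i) (s i)) :: real^'n \<Rightarrow> real)" by simp
  then show "integrable lborel (nball x s i)" unfolding nball_def[abs_def] by simp
  show "(LINT y|lborel. nball x s i y) = 1" if s: "0 < s i"
  proof -
    have "measure lborel (ball (x i) (s i)) = uvol TYPE('n) * s i ^ CARD('n)"
      using s by (simp add: content_ball)
    moreover have "uvol TYPE('n) * s i ^ CARD('n) \<noteq> 0"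
      using s mult_pos_pos[of "uvol TYPE('n)" "s i ^ CARD('n)"] by (metis less_irrefl of_nat_0_le_iff unit_ball_vol_pos zero_less_power)
    ultimately show ?thesis unfolding nball_def by simp
  qed
qed

lemma nball_nonneg: "0 \<le> s i \<Longrightarrow> 0 \<le> nball x s i y"
  unfolding nball_def by simp

lemma nball_eq_0: "y \<notin> ball (x i) (s i) \<Longrightarrow> nball x s i y = 0"
  unfolding nball_def by simp

lemma whitney_nball:
  fixes x :: "nat \<Rightarrow> real^'n"
  assumes W: "whitney \<rho> x s \<eta>"
  obtains j where "\<And>i. i \<noteq> j \<Longrightarrow> nball x s i y = 0"
proof -
  obtain j where "\<And>i. i \<noteq> j \<Longrightarrow> y \<notin> ball (x i) (s i)"
  proof (cases "\<exists>j. y \<in> ball (x j) (s j)")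
    case True
    then obtain j where j: "y \<in> ball (x j) (s j)" ..
    show ?thesis
    proof (rule that)
      fix i assume "i \<noteq> j"
      then show "y \<notin> ball (x i) (s i)" using whitneyD(3)[OF W, of i j] j by blast
    qed
  qed (use that in blast)
  then show ?thesis using that nball_eq_0 by metis
qed

lemma nball_single_sums:
  fixes c :: "nat \<Rightarrow> 'b::real_normed_vector"
  assumes "\<And>i. i \<noteq> j \<Longrightarrow> nball x s i y = 0"
  shows "(\<lambda>i. nball x s i y *\<^sub>R c i) sums (nball x s j y *\<^sub>R c j)"
  using sums_finite[of "{j}" "\<lambda>i. nball x s i y *\<^sub>R c i"] assms by simp

lemma nball_summable:
  fixes c :: "nat \<Rightarrow> 'b::real_normed_vector"
  assumes W: "whitney \<rho> x s \<eta>"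
  shows "summable (\<lambda>i. nball x s i y *\<^sub>R c i)"
  using whitney_nball[OF W, of y] nball_single_sums[of _ x s y c] sums_summable by metis

lemma nball_suminf_bound:
  fixes c :: "nat \<Rightarrow> 'b::banach" and x :: "nat \<Rightarrow> real^'n"
  assumes W: "whitney \<rho> x s \<eta>" and c: "\<And>i. norm (c i) \<le> M * s i ^ CARD('n)" and M: "0 \<le> M"
  shows "norm (\<Sum>i. nball x s i y *\<^sub>R c i) \<le> M / uvol TYPE('n)"
    "norm (nball x s i y *\<^sub>R c i) \<le> M / uvol TYPE('n)"
proof -
  let ?V = "uvol TYPE('n)"
  have V: "0 < ?V" by simp
  have b: "norm (nball x s i y *\<^sub>R c i) \<le> M / ?V" for i
  proof (cases "s i = 0")
    case False
    then have s: "0 < s i ^ CARD('n)" using whitneyD(1)[OF W, of i] by simp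
    have "norm (nball x s i y *\<^sub>R c i) \<le> (1 / (?V * s i ^ CARD('n))) * (M * s i ^ CARD('n))"
      unfolding norm_scaleR nball_def using c[of i] V s
      by (intro mult_mono) (auto simp: indicator_def intro!: divide_nonneg_pos)
    also have "\<dots> = M / ?V" using False by simp
    finally show ?thesis .
  qed (use M V in \<open>simp add: nball_def\<close>)
  obtain j where "\<And>i. i \<noteq> j \<Longrightarrow> nball x s i y = 0" using whitney_nball[OF W, where y=y] by blast
  from nball_single_sums[OF this, where c=c] have "(\<Sum>i. nball x s i y *\<^sub>R c i) = nball x s j y *\<^sub>R c j"
    by (simp add: sums_iff)
  with b show "norm (\<Sum>i. nball x s i y *\<^sub>R c i) \<le> M / ?V" by simp
  show "norm (nball x s i y *\<^sub>R c i) \<le> M / ?V" by (rule b)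
qed

lemma nball_sums_swap:
  fixes c :: "nat \<Rightarrow> nat \<Rightarrow> 'b::real_normed_vector"
  assumes W: "whitney \<rho> x s \<eta>" and c: "\<And>j. (\<lambda>i. c i j) sums d j"
  shows "(\<lambda>i. \<Sum>j. nball x s j y *\<^sub>R c i j) sums (\<Sum>j. nball x s j y *\<^sub>R d j)"
proof -
  obtain j where j: "\<And>i. i \<noteq> j \<Longrightarrow> nball x s i y = 0" using whitney_nball[OF W, where y=y] by blast
  have "(\<Sum>k. nball x s k y *\<^sub>R e k) = nball x s j y *\<^sub>R e j" for e :: "nat \<Rightarrow> 'b"
    using nball_single_sums[OF j, where c=e] by (simp add: sums_iff)
  then show ?thesis using sums_scaleR_right[OF c[of j]] by simp
qed

lemma nball_integral_suminf:
  fixes c :: "nat \<Rightarrow> complex" and x :: "nat \<Rightarrow> real^'n"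
  assumes W: "whitney \<rho> x s \<eta>" and c: "summable (\<lambda>i. norm (c i))" and c0: "\<And>i. s i = 0 \<Longrightarrow> c i = 0"
  shows "integrable lborel (\<lambda>y. \<Sum>i. nball x s i y *\<^sub>R c i)"
    "(LINT y|lborel. (\<Sum>i. nball x s i y *\<^sub>R c i)) = (\<Sum>i. c i)"
proof -
  have int: "integrable lborel (\<lambda>y. nball x s i y *\<^sub>R c i)" for i
    using nball_integrable[of s i x, OF whitneyD(1)[OF W]] by simp
  have ae: "AE y in lborel. summable (\<lambda>i. norm (nball x s i y *\<^sub>R c i))"
  proof (rule AE_I2)
    fix y
    have "norm (nball x s i y *\<^sub>R c i) = nball x s i y *\<^sub>R norm (c i)" for i
      using nball_nonneg[of s i x, OF whitneyD(1)[OF W]] by simp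
    then show "summable (\<lambda>i. norm (nball x s i y *\<^sub>R c i))"
      using nball_summable[OF W, of y "\<lambda>i. norm (c i)"] by (simp only:)
  qed
  have eq: "(LINT y|lborel. nball x s i y *\<^sub>R norm (c i)) = norm (c i)"
    "(LINT y|lborel. nball x s i y *\<^sub>R c i) = c i" for i
    using nball_integral[of s i x] whitneyD(1)[OF W, of i] c0[of i]
      nball_integrable[of s i x, OF whitneyD(1)[OF W]] by (cases "s i = 0"; simp)+
  have nn: "norm (nball x s i y *\<^sub>R c i) = nball x s i y *\<^sub>R norm (c i)" for i y
    using nball_nonneg[of s i x, OF whitneyD(1)[OF W]] by simp
  have sm: "summable (\<lambda>i. LINT y|lborel. norm (nball x s i y *\<^sub>R c i))"
    unfolding nn eq by (rule c)
  show "integrable lborel (\<lambda>y. \<Sum>i. nball x s i y *\<^sub>R c i)" by (rule integrable_suminf[OF int ae sm])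
  show "(LINT y|lborel. (\<Sum>i. nball x s i y *\<^sub>R c i)) = (\<Sum>i. c i)"
    using integral_suminf[OF int ae sm] unfolding eq .
qed

text \<open>The normalisations in \<open>coef_bound\<close>: \<open>110 * 3 * whitney_lip\<close>
  for recentring a function of slope \<open>3 * whitney_lip / s\<close> at a distance of 100 radii,
  and \<open>110^n\<close> for the scale \<open>110 * s\<close>.\<close>

abbreviation coef_const :: "'n::finite itself \<Rightarrow> real" where
  "coef_const _ \<equiv> 330 * whitney_lip TYPE('n) * 110 ^ CARD('n)"

text \<open>\<open>exp 6 * uvol\<close> is the factor of \<open>dec_lebesgue\<close> and
  \<open>25^n\<close> comes from balls of radius \<open>25 * s i\<close>. The bracket bounds a piece
  relative to its level: 1 for \<open>h\<close> outside the superlevel set and twice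
  \<open>coef_const / uvol\<close> for the two redistributed means.\<close>

definition cz_const :: "'n::finite itself \<Rightarrow> real" where
  "cz_const _ = exp 6 * uvol TYPE('n) * (1 + 2 * coef_const TYPE('n) / uvol TYPE('n)) * 25 ^ CARD('n)"

lemma coef_const_pos: "0 < coef_const TYPE('n::finite)" by (simp add: add_nonneg_pos)

lemma cz_const_pos: "0 < cz_const TYPE('n::finite)"
  unfolding cz_const_def by (intro mult_pos_pos add_pos_pos divide_pos_pos) (auto intro: add_nonneg_pos)

text \<open>\<open>N\<close> stands for a maximal function of \<open>h\<close>; recorded are just
  its open superlevel sets, its support and integral, and its control of \<open>h\<close> and of
  tests below the scale \<open>r\<close>. The reserve \<open>10 * r\<close> keeps every ball with
  centre in \<open>ball c (2 * r)\<close> and radius at most \<open>r\<close> admissible.\<close>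

locale local_piece =
  fixes h :: "real^'n \<Rightarrow> complex" and N :: "real^'n \<Rightarrow> ennreal" and c :: "real^'n" and r :: real
  assumes h: "integrable lborel h" and r: "0 < r" and adm: "10 * r \<le> adm_radius c"
    and h_supp: "\<And>y. y \<notin> ball c r \<Longrightarrow> h y = 0" and h_mean: "(LINT y|lborel. h y) = 0"
    and lsc: "\<And>\<alpha>::real. 0 \<le> \<alpha> \<Longrightarrow> open {y. ennreal \<alpha> < N y}"
    and N_supp: "\<And>y. y \<notin> ball c (2 * r) \<Longrightarrow> N y = 0"
    and h_le: "AE y in lborel. ennreal (norm (h y)) \<le> N y"
    and N_fin: "(\<integral>\<^sup>+y. N y \<partial>lborel) < \<infinity>"
    and test: "\<And>z t \<zeta>. 0 < t \<Longrightarrow> t < r \<Longrightarrow> \<zeta> \<in> testf z t \<Longrightarrow>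
        ennreal (norm (LINT y|lborel. \<zeta> y *\<^sub>R h y)) \<le> ennreal (t ^ CARD('n)) * N z"
begin

lemma h_borel [measurable]: "h \<in> borel_measurable borel"
  using h by (auto dest: borel_measurable_integrable)

definition Om :: "real \<Rightarrow> (real^'n) set" where "Om \<alpha> = {y. ennreal \<alpha> < N y}"

definition rho :: "real \<Rightarrow> real^'n \<Rightarrow> real" where "rho \<alpha> y = infdist y (- Om \<alpha>) / 100"

text \<open>The lowest level used. At scales comparable to \<open>r\<close>, where
  \<open>test\<close> gives nothing, the integral of \<open>norm (h y)\<close> is itself at most
  \<alpha> times the volume, up to a dimensional factor, as soon as \<alpha> is at least
  \<open>base\<close>.\<close>

definition base :: real where "base = (LINT y|lborel. norm (h y)) / r ^ CARD('n)"

lemma base_nonneg: "0 \<le> base" using r by (simp add: base_def)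

lemma Om_open: "0 \<le> \<alpha> \<Longrightarrow> open (Om \<alpha>)" unfolding Om_def by (rule lsc)

lemma Om_sub: "Om \<alpha> \<subseteq> ball c (2 * r)"
  using N_supp unfolding Om_def by (metis (mono_tags, lifting) mem_Collect_eq not_less_zero subsetI)

lemma Om_mono: "\<alpha> \<le> \<beta> \<Longrightarrow> Om \<beta> \<subseteq> Om \<alpha>"
  unfolding Om_def by (auto intro: le_less_trans[OF ennreal_leI])

lemma Om_fin: "emeasure lborel (Om \<alpha>) < \<infinity>"
  by (rule le_less_trans[OF emeasure_mono[OF Om_sub] emeasure_lborel_ball_finite]) simp

lemma far_point: obtains p where "p \<notin> ball c (2 * r)" "dist c p = 2 * r"
proof -
  obtain e :: "real^'n" where e: "norm e = 1" using vector_choose_size[of 1] by auto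
  show ?thesis by (rule that[of "c + (2 * r) *\<^sub>R e"]) (use e r in \<open>auto simp: dist_norm\<close>)
qed

lemma Om_compl: "- Om \<alpha> \<noteq> {}"
  using far_point Om_sub[of \<alpha>] by (metis Compl_iff empty_iff subsetD)

lemma rho_lip: "\<bar>rho \<alpha> y - rho \<alpha> z\<bar> \<le> dist y z / 100"
  using infdist_triangle_abs[of y "- Om \<alpha>" z] unfolding rho_def by linarith

lemma rho_pos: assumes "0 \<le> \<alpha>" shows "{y. 0 < rho \<alpha> y} = Om \<alpha>"
proof -
  have "y \<in> - Om \<alpha> \<longleftrightarrow> infdist y (- Om \<alpha>) = 0" for y
    using Om_open[OF assms] Om_compl by (intro in_closed_iff_infdist_zero) auto
  then have "y \<in> Om \<alpha> \<longleftrightarrow> 0 < infdist y (- Om \<alpha>)" for y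
    using infdist_nonneg[of y "- Om \<alpha>"] by (metis ComplI Compl_iff order_less_le)
  then show ?thesis by (auto simp: rho_def)
qed

text \<open>Superlevel sets stay in \<open>ball c (2 * r)\<close>, so from any of their points the
  complement is at most \<open>4 * r\<close> away; division by 100 gives
  \<open>r / 25\<close>.\<close>

lemma rho_le: assumes "0 \<le> \<alpha>" shows "rho \<alpha> y \<le> r / 25"
proof (cases "y \<in> Om \<alpha>")
  case True
  obtain p where p: "p \<notin> ball c (2 * r)" "dist c p = 2 * r" by (rule far_point)
  have "infdist y (- Om \<alpha>) \<le> dist y p" using p Om_sub[of \<alpha>] by (intro infdist_le) auto
  also have "\<dots> \<le> dist c y + dist c p" by (metis dist_commute dist_triangle)
  also have "\<dots> \<le> 4 * r" using True Om_sub[of \<alpha>] p by auto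
  finally show ?thesis by (simp add: rho_def)
next
  case False
  then have "\<not> 0 < rho \<alpha> y" using rho_pos[OF assms] by auto
  then show ?thesis using r by linarith
qed

lemma rho_mono: "\<alpha> \<le> \<beta> \<Longrightarrow> rho \<beta> y \<le> rho \<alpha> y"
  unfolding rho_def using Om_compl Om_mono by (intro divide_right_mono infdist_mono) auto

lemma near_compl: assumes "0 \<le> \<alpha>" obtains z where "N z \<le> ennreal \<alpha>" "dist z y = 100 * rho \<alpha> y"
proof -
  have "closed (- Om \<alpha>)" using Om_open[OF assms] by auto
  from infdist_attains_inf[OF this Om_compl, of y] obtain z where "z \<in> - Om \<alpha>" "infdist y (- Om \<alpha>) = dist y z" .
  then show ?thesis using that[of z] by (auto simp: rho_def Om_def dist_commute not_less)
qed

text \<open>If \<open>110 * s < r\<close>, the function is a multiple of a test function at a point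
  \<open>z\<close> where \<open>N\<close> is at most \<alpha>. Otherwise \<open>s\<close> is
  comparable to \<open>r\<close>, and the trivial bound \<open>base * r^n\<close> is good enough
  because \<alpha> is at least \<open>base\<close>.\<close>

lemma coef_bound:
  assumes \<zeta>: "C1 \<zeta>" "\<And>y. \<bar>\<zeta> y\<bar> \<le> 1" "\<And>y. 10 * s \<le> dist y p \<Longrightarrow> \<zeta> y = 0"
      "\<And>y z. \<bar>\<zeta> y - \<zeta> z\<bar> \<le> 3 * whitney_lip TYPE('n) / s * dist y z"
    and s: "0 < s" and z: "dist z p \<le> 100 * s" "N z \<le> ennreal \<alpha>" and \<alpha>: "base \<le> \<alpha>"
  shows "norm (LINT y|lborel. \<zeta> y *\<^sub>R h y) \<le> coef_const TYPE('n) * \<alpha> * s ^ CARD('n)"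
proof -
  let ?L = "3 * whitney_lip TYPE('n)"
  have \<alpha>0: "0 \<le> \<alpha>" using base_nonneg \<alpha> by simp
  have L: "1 \<le> ?L" using mult_mono[OF _ whitney_lip_ge_1[where 'n='n], of 1 3] by simp
  show ?thesis
  proof (cases "110 * s < r")
    case True
    have "(\<lambda>y. \<zeta> y / ((100 + 10) * ?L)) \<in> testf z ((100 + 10) * s)"
      by (rule testf_of_lipschitz[OF \<zeta> s L z(1)]) simp_all
    then have tf: "(\<lambda>y. \<zeta> y / (110 * ?L)) \<in> testf z (110 * s)" by (simp only: numeral_plus_numeral add_num_simps)
    have "ennreal (norm (LINT y|lborel. (\<zeta> y / (110 * ?L)) *\<^sub>R h y)) \<le> ennreal ((110 * s) ^ CARD('n)) * N z"
      by (rule test[OF _ True tf]) (use s in simp)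
    also have "\<dots> \<le> ennreal ((110 * s) ^ CARD('n)) * ennreal \<alpha>" using z(2) by (intro mult_left_mono) auto
    also have "\<dots> = ennreal ((110 * s) ^ CARD('n) * \<alpha>)" using s \<alpha>0 by (simp add: ennreal_mult)
    finally have "norm (LINT y|lborel. (\<zeta> y / (110 * ?L)) *\<^sub>R h y) \<le> (110 * s) ^ CARD('n) * \<alpha>"
      using s \<alpha>0 by (subst (asm) ennreal_le_iff) auto
    also have "(LINT y|lborel. (\<zeta> y / (110 * ?L)) *\<^sub>R h y) = (1 / (110 * ?L)) *\<^sub>R (LINT y|lborel. \<zeta> y *\<^sub>R h y)"
      by (subst integral_scaleR_right[symmetric]) (simp add: divide_inverse mult_ac)
    also have "norm \<dots> = norm (LINT y|lborel. \<zeta> y *\<^sub>R h y) / (110 * ?L)" using L by simp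
    finally have "norm (LINT y|lborel. \<zeta> y *\<^sub>R h y) \<le> ((110 * s) ^ CARD('n) * \<alpha>) * (110 * ?L)"
      using L by (subst (asm) pos_divide_le_eq) linarith+
    also have "\<dots> = coef_const TYPE('n) * \<alpha> * s ^ CARD('n)" unfolding power_mult_distrib by (simp add: algebra_simps)
    finally show ?thesis .
  next
    case False
    have "norm (LINT y|lborel. \<zeta> y *\<^sub>R h y) \<le> (LINT y|lborel. norm (\<zeta> y *\<^sub>R h y))" by (rule integral_norm_bound)
    also have "\<dots> \<le> (LINT y|lborel. norm (h y))"
    proof (rule integral_mono)
      show "integrable lborel (\<lambda>y. norm (\<zeta> y *\<^sub>R h y))"
        using C1_measurable[OF \<zeta>(1)] \<zeta>(2) by (intro integrable_norm integrable_bounded_scaleR[OF h, of _ 1]) simp_all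
      show "integrable lborel (\<lambda>y. norm (h y))" using h by simp
      show "norm (\<zeta> y *\<^sub>R h y) \<le> norm (h y)" for y
        using mult_right_mono[OF \<zeta>(2)[of y], of "norm (h y)"] by simp
    qed
    also have "\<dots> = base * r ^ CARD('n)" using r by (simp add: base_def)
    also have "\<dots> \<le> \<alpha> * (110 * s) ^ CARD('n)"
      using False r \<alpha> \<alpha>0 by (intro mult_mono power_mono) auto
    also have "\<dots> = 1 * (110 ^ CARD('n) * (\<alpha> * s ^ CARD('n)))" by (simp add: power_mult_distrib)
    also have "\<dots> \<le> (330 * whitney_lip TYPE('n)) * (110 ^ CARD('n) * (\<alpha> * s ^ CARD('n)))"
    proof (rule mult_right_mono)
      show "1 \<le> 330 * whitney_lip TYPE('n)" using mult_mono[OF _ whitney_lip_ge_1[where 'n='n], of 1 330] by simp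
      show "0 \<le> 110 ^ CARD('n) * (\<alpha> * s ^ CARD('n))" using \<alpha>0 s by simp
    qed
    also have "\<dots> = coef_const TYPE('n) * \<alpha> * s ^ CARD('n)" by (simp only: mult_ac)
    finally show ?thesis .
  qed
qed

definition coef1 :: "(nat \<Rightarrow> real^'n \<Rightarrow> real) \<Rightarrow> nat \<Rightarrow> complex" where
  "coef1 \<eta> i = (LINT y|lborel. \<eta> i y *\<^sub>R h y)"

text \<open>On the superlevel set each Whitney piece of \<open>h\<close> is replaced by a constant
  multiple of the indicator of its ball with the same integral.\<close>

definition good_part :: "real \<Rightarrow> (nat \<Rightarrow> real^'n) \<Rightarrow> (nat \<Rightarrow> real) \<Rightarrow> (nat \<Rightarrow> real^'n \<Rightarrow> real) \<Rightarrow> real^'n \<Rightarrow> complex" where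
  "good_part \<alpha> x s \<eta> y = indicator (- Om \<alpha>) y *\<^sub>R h y + (\<Sum>i. nball x s i y *\<^sub>R coef1 \<eta> i)"

text \<open>Moving the centre by less than \<open>2 * r\<close> leaves an admissible radius above
  \<open>8 * r\<close>, whereas \<open>25 * s i\<close> is at most \<open>r\<close>.\<close>

lemma center_in:
  assumes W: "whitney (rho \<alpha>) x s \<eta>" and \<alpha>: "0 \<le> \<alpha>" and s: "0 < s i"
  shows "x i \<in> ball c (2 * r)" "s i \<le> r / 25" "admissible (x i) (25 * s i)"
proof -
  have e: "rho \<alpha> (x i) = s i" by (rule whitneyD(2)[OF W s])
  then have "x i \<in> Om \<alpha>" using rho_pos[OF \<alpha>] s by auto
  then show x: "x i \<in> ball c (2 * r)" by (rule subsetD[OF Om_sub])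
  show s': "s i \<le> r / 25" using rho_le[OF \<alpha>, of "x i"] e by simp
  have "adm_radius c - adm_radius (x i) \<le> dist c (x i)" using adm_radius_lipschitz[of c "x i"] by linarith
  then show "admissible (x i) (25 * s i)" unfolding admissible_def using x s s' adm r by auto
qed

lemma coef1_zero: "whitney (rho \<alpha>) x s \<eta> \<Longrightarrow> s i = 0 \<Longrightarrow> coef1 \<eta> i = 0"
  unfolding coef1_def by (simp add: whitney_zero)

lemma coef1_bound:
  assumes W: "whitney (rho \<alpha>) x s \<eta>" and \<alpha>: "base \<le> \<alpha>"
  shows "norm (coef1 \<eta> i) \<le> coef_const TYPE('n) * \<alpha> * s i ^ CARD('n)"
proof (cases "s i = 0")
  case True
  then show ?thesis using coef1_zero[OF W True] by (simp add: power_0_left)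
next
  case False
  then have s: "0 < s i" using whitneyD(1)[OF W, of i] by simp
  have \<alpha>0: "0 \<le> \<alpha>" using base_nonneg \<alpha> by simp
  obtain z where z: "N z \<le> ennreal \<alpha>" "dist z (x i) = 100 * rho \<alpha> (x i)" by (rule near_compl[OF \<alpha>0])
  show ?thesis unfolding coef1_def
  proof (rule coef_bound[where p="x i" and z=z])
    show "\<bar>\<eta> i y - \<eta> i w\<bar> \<le> 3 * whitney_lip TYPE('n) / s i * dist y w" for y w
      by (rule order_trans[OF whitneyD(8)[OF W s]], intro mult_right_mono divide_right_mono) (use s in auto)
  qed (use z whitneyD(2)[OF W s] whitneyD(4)[OF W] whitney_abs[OF W] whitneyD(7)[OF W] s \<alpha> in auto)
qed

lemma coef1_sums: "0 \<le> \<alpha> \<Longrightarrow> whitney (rho \<alpha>) x s \<eta> \<Longrightarrow> (\<lambda>i. coef1 \<eta> i) sums (LINT y|lborel. indicator (Om \<alpha>) y *\<^sub>R h y)"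
  unfolding coef1_def using whitney_sums_integral[of "rho \<alpha>" x s \<eta>, OF _ h] by (simp add: rho_pos)

lemma whitney_int_bounded:
  assumes W: "whitney (rho \<alpha>) x s \<eta>" and k: "\<kappa> \<in> borel_measurable borel" "\<And>y. \<bar>\<kappa> y\<bar> \<le> 1"
  shows "summable (\<lambda>i. norm (LINT y|lborel. (\<kappa> y * \<eta> i y) *\<^sub>R h y))"
proof (rule summable_comparison_test)
  have "integrable lborel (\<lambda>y. norm (h y))" using h by simp
  from sums_summable[OF whitney_sums_integral[OF W this]]
  show "summable (\<lambda>i. LINT y|lborel. \<eta> i y *\<^sub>R norm (h y))" .
  have "norm (LINT y|lborel. (\<kappa> y * \<eta> i y) *\<^sub>R h y) \<le> (LINT y|lborel. \<eta> i y *\<^sub>R norm (h y))" for i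
  proof -
    have "norm (LINT y|lborel. (\<kappa> y * \<eta> i y) *\<^sub>R h y) \<le> (LINT y|lborel. norm ((\<kappa> y * \<eta> i y) *\<^sub>R h y))"
      by (rule integral_norm_bound)
    also have "\<dots> \<le> (LINT y|lborel. \<eta> i y *\<^sub>R norm (h y))"
    proof (rule integral_mono)
      show "integrable lborel (\<lambda>y. norm ((\<kappa> y * \<eta> i y) *\<^sub>R h y))"
        using k whitney_measurable[OF W] whitney_abs[OF W]
        by (intro integrable_norm integrable_bounded_scaleR[OF h, of _ 1]) (auto simp: abs_mult intro!: mult_le_one)
      show "integrable lborel (\<lambda>y. \<eta> i y *\<^sub>R norm (h y))" using h by (intro whitney_integrable[OF W]) simp
      show "norm ((\<kappa> y * \<eta> i y) *\<^sub>R h y) \<le> \<eta> i y *\<^sub>R norm (h y)" for y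
        using k(2)[of y] whitneyD(5)[OF W, of i y] mult_right_mono[OF k(2)[of y], of "\<eta> i y"]
        by (simp add: abs_mult mult_right_mono)
    qed
    finally show ?thesis .
  qed
  then show "\<exists>M. \<forall>n\<ge>M. norm (norm (LINT y|lborel. (\<kappa> y * \<eta> n y) *\<^sub>R h y)) \<le> (LINT y|lborel. \<eta> n y *\<^sub>R norm (h y))"
    by auto
qed

lemma coef1_summable: "whitney (rho \<alpha>) x s \<eta> \<Longrightarrow> summable (\<lambda>i. norm (coef1 \<eta> i))"
  using whitney_int_bounded[of \<alpha> x s \<eta> "\<lambda>_. 1"] by (simp add: coef1_def)

lemma h_le_off_Om: "AE y in lborel. y \<notin> Om \<alpha> \<longrightarrow> 0 \<le> \<alpha> \<longrightarrow> norm (h y) \<le> \<alpha>"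
  using h_le by eventually_elim (auto simp: Om_def not_less dest: order_trans)

lemma Om_measurable: "0 \<le> \<alpha> \<Longrightarrow> Om \<alpha> \<in> sets borel" using Om_open by auto

lemma good_part_measurable: "0 \<le> \<alpha> \<Longrightarrow> good_part \<alpha> x s \<eta> \<in> borel_measurable borel"
  unfolding good_part_def[abs_def] using Om_measurable[of \<alpha>] by measurable

lemma nball_off:
  assumes W: "whitney (rho \<alpha>) x s \<eta>" and \<alpha>: "0 \<le> \<alpha>" and y: "y \<notin> Om \<alpha>"
  shows "nball x s i y = 0"
proof (rule nball_eq_0, rule notI)
  assume "y \<in> ball (x i) (s i)"
  then have "dist y (x i) < 20 * s i" using whitneyD(1)[OF W, of i] by (auto simp: dist_commute)
  from whitney_near[OF W rho_lip this] have "0 < rho \<alpha> y" by simp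
  then show False using rho_pos[OF \<alpha>] y by auto
qed

lemma good_part_off: "whitney (rho \<alpha>) x s \<eta> \<Longrightarrow> 0 \<le> \<alpha> \<Longrightarrow> y \<notin> Om \<alpha> \<Longrightarrow> good_part \<alpha> x s \<eta> y = h y"
  by (simp add: good_part_def nball_off)

text \<open>At level \<open>base\<close> the good part is bounded by a multiple of
  \<open>base\<close>, lives in \<open>cball c (2 * r)\<close> and inherits mean zero from
  \<open>h\<close>. It is one multiple of an atom, of size comparable to \<open>base * r^n\<close>,
  the integral of \<open>norm (h y)\<close>.\<close>

lemma dec_bottom:
  assumes W: "whitney (rho base) x s \<eta>"
  shows "dec (\<lambda>y. good_part base x s \<eta> y / of_real (gdens y)) (cz_const TYPE('n) * (LINT y|lborel. norm (h y)))"
proof -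
  let ?V = "uvol TYPE('n)" and ?C = "coef_const TYPE('n)"
  have V: "0 < ?V" by simp
  define b where "b = base * (1 + 2 * ?C / ?V)"
  have "dec (\<lambda>y. good_part base x s \<eta> y / of_real (gdens y)) (exp 6 * ?V * b * (2 * r) ^ CARD('n))"
  proof (rule dec_lebesgue)
    show "admissible c (2 * r)" using r adm by (auto simp: admissible_def)
    show "good_part base x s \<eta> \<in> borel_measurable borel" by (rule good_part_measurable[OF base_nonneg])
    show "good_part base x s \<eta> y = 0" if "y \<notin> cball c (2 * r)" for y
    proof -
      have "y \<notin> ball c (2 * r)" "y \<notin> ball c r" using that r by auto
      moreover from this have "y \<notin> Om base" using subsetD[OF Om_sub, of y base] by blast
      ultimately show ?thesis using good_part_off[OF W base_nonneg] h_supp by simp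
    qed
    show "AE y in lborel. norm (good_part base x s \<eta> y) \<le> b"
      using h_le_off_Om[of base]
    proof eventually_elim
      case (elim y)
      have "norm (good_part base x s \<eta> y) \<le> norm (indicator (- Om base) y *\<^sub>R h y) + norm (\<Sum>i. nball x s i y *\<^sub>R coef1 \<eta> i)"
        unfolding good_part_def by (rule norm_triangle_ineq)
      also have "\<dots> \<le> base + ?C * base / ?V"
        using elim base_nonneg coef_const_pos[where 'n='n]
        by (intro add_mono nball_suminf_bound(1)[OF W] coef1_bound[OF W order_refl]) (auto simp: indicator_def)
      \<comment> \<open>The second copy is added merely to reach the shape of
        \<open>cz_const\<close>.\<close>
      also have "\<dots> \<le> base + ?C * base / ?V + ?C * base / ?V"
      proof -
        have "0 \<le> ?C * base / ?V"
          by (intro divide_nonneg_nonneg mult_nonneg_nonneg base_nonneg less_imp_le[OF coef_const_pos] less_imp_le[OF V])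
        then show ?thesis by linarith
      qed
      also have "\<dots> = b" by (simp add: b_def algebra_simps add_divide_distrib)
      finally show ?case .
    qed
    show "0 \<le> b" unfolding b_def using base_nonneg coef_const_pos[where 'n='n] V by (intro mult_nonneg_nonneg add_nonneg_nonneg divide_nonneg_pos) auto
    have i1: "integrable lborel (\<lambda>y. indicator S y *\<^sub>R h y)" if "S \<in> sets borel" for S
      using that by (intro integrable_mult_indicator h) auto
    have "(LINT y|lborel. good_part base x s \<eta> y) = (LINT y|lborel. indicator (- Om base) y *\<^sub>R h y) + (\<Sum>i. coef1 \<eta> i)"
      unfolding good_part_def using Om_measurable[OF base_nonneg] nball_integral_suminf[OF W coef1_summable[OF W] coef1_zero[OF W]]
      by (subst Bochner_Integration.integral_add) (auto intro!: i1)
    also have "\<dots> = (LINT y|lborel. indicator (- Om base) y *\<^sub>R h y) + (LINT y|lborel. indicator (Om base) y *\<^sub>R h y)"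
      using coef1_sums[OF base_nonneg W] by (simp add: sums_iff)
    also have "\<dots> = (LINT y|lborel. indicator (- Om base) y *\<^sub>R h y + indicator (Om base) y *\<^sub>R h y)"
      using Om_measurable[OF base_nonneg] by (intro Bochner_Integration.integral_add[symmetric] i1) auto
    also have "\<dots> = (LINT y|lborel. h y)"
      by (intro Bochner_Integration.integral_cong) (auto simp: indicator_def)
    finally show "(LINT y|lborel. good_part base x s \<eta> y) = 0" using h_mean by simp
  qed
  moreover have "exp 6 * ?V * b * (2 * r) ^ CARD('n) \<le> cz_const TYPE('n) * (LINT y|lborel. norm (h y))"
  proof -
    define D where "D = 1 + 2 * ?C / ?V"
    have D: "0 \<le> D" unfolding D_def using coef_const_pos[where 'n='n] V by (intro add_nonneg_nonneg divide_nonneg_pos) auto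
    have I: "base * r ^ CARD('n) = (LINT y|lborel. norm (h y))" using r by (simp add: base_def)
    have "exp 6 * ?V * b * (2 * r) ^ CARD('n) = exp 6 * ?V * D * 2 ^ CARD('n) * (base * r ^ CARD('n))"
      unfolding b_def D_def[symmetric] power_mult_distrib by (simp only: mult_ac)
    also have "\<dots> \<le> exp 6 * ?V * D * 25 ^ CARD('n) * (base * r ^ CARD('n))"
      using D V base_nonneg r by (intro mult_right_mono mult_left_mono power_mono) auto
    finally show ?thesis unfolding I cz_const_def D_def .
  qed
  ultimately show ?thesis by (rule dec_mono)
qed

definition coef2 :: "(nat \<Rightarrow> real^'n \<Rightarrow> real) \<Rightarrow> (nat \<Rightarrow> real^'n \<Rightarrow> real) \<Rightarrow> nat \<Rightarrow> nat \<Rightarrow> complex" where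
  "coef2 \<eta> \<eta>' i j = (LINT y|lborel. (\<eta> i y * \<eta>' j y) *\<^sub>R h y)"

text \<open>The mean of \<open>h \<eta>\<^sub>i \<eta>'\<^sub>j\<close> is put on the \<open>j\<close>-th ball of the finer covering; as these balls are
  disjoint, the sum over \<open>j\<close> is bounded by its largest term.\<close>

definition cz_atom where
  "cz_atom \<beta> x s \<eta> x' s' \<eta>' i y = indicator (- Om \<beta>) y *\<^sub>R (\<eta> i y *\<^sub>R h y) - nball x s i y *\<^sub>R coef1 \<eta> i +
     (\<Sum>j. nball x' s' j y *\<^sub>R coef2 \<eta> \<eta>' i j)"

text \<open>Where the two Whitney functions overlap, each radius is comparable to its own distance
  function, and the distance to the complement of the smaller superlevel set is the smaller one.
  Hence the finer ball cannot be much larger than the coarser ball and stays within 25 coarse radii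
  of its centre.\<close>

lemma coef2_overlap:
  assumes W: "whitney (rho \<alpha>) x s \<eta>" and W': "whitney (rho \<beta>) x' s' \<eta>'" and ab: "\<alpha> \<le> \<beta>"
    and nz: "coef2 \<eta> \<eta>' i j \<noteq> 0"
  shows "0 < s i" "0 < s' j" "s' j \<le> 3/2 * s i" "dist (x i) (x' j) < 25 * s i - s' j"
proof -
  obtain y where y: "\<eta> i y * \<eta>' j y \<noteq> 0"
  proof (rule ccontr)
    assume "\<not> thesis"
    then have "\<eta> i y * \<eta>' j y = 0" for y using that by blast
    then have "coef2 \<eta> \<eta>' i j = 0" by (simp only: coef2_def scaleR_zero_left Bochner_Integration.integral_zero)
    with nz show False ..
  qed
  then have y1: "\<eta> i y \<noteq> 0" and y2: "\<eta>' j y \<noteq> 0" by auto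
  note e = whitney_eta_pos[OF W y1] and e' = whitney_eta_pos[OF W' y2]
  show s: "0 < s i" "0 < s' j" by fact+
  have "dist y (x i) < 20 * s i" "dist y (x' j) < 20 * s' j" using e e' by linarith+
  from whitney_near(3)[OF W rho_lip this(1)] whitney_near(2)[OF W' rho_lip this(2)] rho_mono[OF ab, of y]
  show le: "s' j \<le> 3/2 * s i" by linarith
  \<comment> \<open>The ratio 3/2 alone would only give \<open>10 + 11 * 3/2 = 26.5\<close> radii.
    The overlap point is within 10 radii of each centre, where \<open>\<rho>\<close> varies by at
    most a tenth of the radius; this sharpens the ratio to \<open>14/11\<close> and the total to
    24.\<close>
  have "\<rho>1 \<le> 11/10 * s i" if "\<rho>1 = rho \<alpha> y" for \<rho>1
    using rho_lip[of \<alpha> y "x i"] whitneyD(2)[OF W s(1)] e(2) that by linarith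
  moreover have "9/10 * s' j \<le> rho \<beta> y"
    using rho_lip[of \<beta> y "x' j"] whitneyD(2)[OF W' s(2)] e'(2) by linarith
  ultimately have "9/10 * s' j \<le> 11/10 * s i" using rho_mono[OF ab, of y] by force
  then have "11 * s' j \<le> 14 * s i" using s by linarith
  moreover have "dist (x i) (x' j) \<le> dist y (x i) + dist y (x' j)" by (metis dist_commute dist_triangle)
  ultimately show "dist (x i) (x' j) < 25 * s i - s' j" using e(2) e'(2) s by linarith
qed

lemma coef2_bound:
  assumes W: "whitney (rho \<alpha>) x s \<eta>" and W': "whitney (rho \<beta>) x' s' \<eta>'" and ab: "\<alpha> \<le> \<beta>" and \<alpha>: "base \<le> \<alpha>"
  shows "norm (coef2 \<eta> \<eta>' i j) \<le> coef_const TYPE('n) * \<beta> * s' j ^ CARD('n)"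
proof (cases "coef2 \<eta> \<eta>' i j = 0")
  case True
  have "0 \<le> coef_const TYPE('n) * \<beta> * s' j ^ CARD('n)"
    using base_nonneg \<alpha> ab whitneyD(1)[OF W', of j] by (intro mult_nonneg_nonneg zero_le_power less_imp_le[OF coef_const_pos]) auto
  then show ?thesis using True by simp
next
  case False
  note o = coef2_overlap[OF W W' ab False]
  have \<beta>: "base \<le> \<beta>" "0 \<le> \<beta>" using \<alpha> ab base_nonneg by auto
  obtain z where z: "N z \<le> ennreal \<beta>" "dist z (x' j) = 100 * rho \<beta> (x' j)" by (rule near_compl[OF \<beta>(2)])
  show ?thesis unfolding coef2_def
  proof (rule coef_bound[where p="x' j" and z=z])
    show "C1 (\<lambda>y. \<eta> i y * \<eta>' j y)" by (intro C1_mult whitneyD(4)[OF W] whitneyD(4)[OF W'])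
    show "\<bar>\<eta> i y * \<eta>' j y\<bar> \<le> 1" for y
      unfolding abs_mult by (intro mult_le_one whitney_abs[OF W] whitney_abs[OF W']) simp
    show "10 * s' j \<le> dist y (x' j) \<Longrightarrow> \<eta> i y * \<eta>' j y = 0" for y using whitneyD(7)[OF W'] by simp
    show "\<bar>\<eta> i y * \<eta>' j y - \<eta> i w * \<eta>' j w\<bar> \<le> 3 * whitney_lip TYPE('n) / s' j * dist y w" for y w
    proof -
      let ?L = "whitney_lip TYPE('n)"
      have L: "0 \<le> ?L" by simp
      have "\<eta> i y * \<eta>' j y - \<eta> i w * \<eta>' j w = (\<eta> i y - \<eta> i w) * \<eta>' j y + \<eta> i w * (\<eta>' j y - \<eta>' j w)"
        by (simp add: algebra_simps)
      then have "\<bar>\<eta> i y * \<eta>' j y - \<eta> i w * \<eta>' j w\<bar> \<le> \<bar>\<eta> i y - \<eta> i w\<bar> * \<bar>\<eta>' j y\<bar> + \<bar>\<eta> i w\<bar> * \<bar>\<eta>' j y - \<eta>' j w\<bar>"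
        by (metis abs_mult abs_triangle_ineq)
      also have "\<dots> \<le> (?L / s i * dist y w) * 1 + 1 * (?L / s' j * dist y w)"
        using whitney_abs[OF W] whitney_abs[OF W'] whitneyD(8)[OF W o(1)] whitneyD(8)[OF W' o(2)] L o(1)
        by (intro add_mono mult_mono) auto
      \<comment> \<open>The slope of the coarser function is converted to the finer scale. The total
        \<open>3/2 + 1\<close> is at most 3, which is the origin of the factor 3 in
        \<open>coef_bound\<close>.\<close>
      also have "?L / s i \<le> 3/2 * ?L / s' j"
      proof -
        have "1 / s i \<le> (3/2) / s' j" using o by (simp add: field_simps)
        then have "?L * (1 / s i) \<le> ?L * ((3/2) / s' j)" by (rule mult_left_mono[OF _ L])
        then show ?thesis by (simp add: mult.commute)
      qed
      finally have "\<bar>\<eta> i y * \<eta>' j y - \<eta> i w * \<eta>' j w\<bar> \<le> (3/2 * ?L / s' j * dist y w) * 1 + 1 * (?L / s' j * dist y w)"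
        by (simp add: mult_right_mono)
      also have "\<dots> = 5/2 * (?L / s' j * dist y w)"
      proof -
        have "3/2 * l / u * d * 1 + 1 * (l / u * d) = 5/2 * (l / u * d)" for l u d :: real
          by (simp add: algebra_simps)
        then show ?thesis .
      qed
      also have "\<dots> \<le> 3 * (?L / s' j * dist y w)"
        using L o(2) by (intro mult_right_mono mult_nonneg_nonneg divide_nonneg_pos) auto
      finally show ?thesis by (simp only: times_divide_eq_right mult.assoc times_divide_eq_left)
    qed
  qed (use z whitneyD(2)[OF W' o(2)] o \<beta> in auto)
qed

text \<open>Summing over a family removes its partition of unity. For the coarser family nothing is
  left behind, because the finer functions live where the coarser ones add up to 1; for the finer
  family the indicator of \<open>Om \<beta>\<close> remains.\<close>

lemma coef2_sums:
  assumes W: "whitney (rho \<alpha>) x s \<eta>" and W': "whitney (rho \<beta>) x' s' \<eta>'" and ab: "\<alpha> \<le> \<beta>" and \<alpha>: "0 \<le> \<alpha>"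
  shows "(\<lambda>i. coef2 \<eta> \<eta>' i j) sums coef1 \<eta>' j"
    "(\<lambda>j. coef2 \<eta> \<eta>' i j) sums (LINT y|lborel. indicator (Om \<beta>) y *\<^sub>R (\<eta> i y *\<^sub>R h y))"
proof -
  have \<beta>: "0 \<le> \<beta>" using \<alpha> ab by simp
  have "(\<lambda>i. LINT y|lborel. \<eta> i y *\<^sub>R (\<eta>' j y *\<^sub>R h y)) sums (LINT y|lborel. indicator (Om \<alpha>) y *\<^sub>R (\<eta>' j y *\<^sub>R h y))"
    using whitney_sums_integral[OF W whitney_integrable[OF W' h]] unfolding rho_pos[OF \<alpha>] .
  moreover have "indicator (Om \<alpha>) y *\<^sub>R (\<eta>' j y *\<^sub>R h y) = \<eta>' j y *\<^sub>R h y" for y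
  proof (cases "\<eta>' j y = 0")
    case False
    from whitney_eta_pos[OF W' False] have "dist y (x' j) < 20 * s' j" by linarith
    from whitney_near[OF W' rho_lip this] have "0 < rho \<beta> y" by simp
    then have "y \<in> Om \<beta>" using rho_pos[OF \<beta>] by auto
    then have "y \<in> Om \<alpha>" by (rule subsetD[OF Om_mono[OF ab]])
    then show ?thesis by simp
  qed simp
  ultimately show "(\<lambda>i. coef2 \<eta> \<eta>' i j) sums coef1 \<eta>' j"
    unfolding coef2_def coef1_def by (simp only: scaleR_scaleR[symmetric])
  have "(\<lambda>j. LINT y|lborel. \<eta>' j y *\<^sub>R (\<eta> i y *\<^sub>R h y)) sums (LINT y|lborel. indicator (Om \<beta>) y *\<^sub>R (\<eta> i y *\<^sub>R h y))"
    using whitney_sums_integral[OF W' whitney_integrable[OF W h]] unfolding rho_pos[OF \<beta>] .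
  then show "(\<lambda>j. coef2 \<eta> \<eta>' i j) sums (LINT y|lborel. indicator (Om \<beta>) y *\<^sub>R (\<eta> i y *\<^sub>R h y))"
    unfolding coef2_def by (simp add: mult.commute)
qed

text \<open>The integral of \<open>\<eta> i\<close> times \<open>h\<close> is split along
  \<open>Om \<beta>\<close>: the outer part is kept, the inner part is replaced by terms with the
  same integral, and \<open>coef1 \<eta> i\<close> subtracts the total, so the mean is zero. Outside
  \<open>Om \<beta>\<close> the values of \<open>h\<close> are at most \<beta>, and both corrections
  are of order \<beta> too.\<close>

lemma dec_cz_atom:
  assumes W: "whitney (rho \<alpha>) x s \<eta>" and W': "whitney (rho \<beta>) x' s' \<eta>'" and ab: "\<alpha> \<le> \<beta>" and \<alpha>: "base \<le> \<alpha>"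
  shows "dec (\<lambda>y. cz_atom \<beta> x s \<eta> x' s' \<eta>' i y / of_real (gdens y)) (cz_const TYPE('n) * \<beta> * s i ^ CARD('n))"
proof (cases "s i = 0")
  case True
  have "coef2 \<eta> \<eta>' i j = 0" for j using coef2_overlap(1)[OF W W' ab, of i j] True by auto
  then have "cz_atom \<beta> x s \<eta> x' s' \<eta>' i y = 0" for y
    by (simp add: cz_atom_def whitney_zero[OF W True] coef1_zero[OF W True])
  then show ?thesis using dec_zero True by (simp add: power_0_left)
next
  case False
  then have s: "0 < s i" using whitneyD(1)[OF W, of i] by simp
  have \<alpha>0: "0 \<le> \<alpha>" and \<beta>0: "0 \<le> \<beta>" and \<beta>: "base \<le> \<beta>" using \<alpha> ab base_nonneg by auto
  let ?V = "uvol TYPE('n)" and ?C = "coef_const TYPE('n)"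
  have V: "0 < ?V" by simp
  note C0 = less_imp_le[OF coef_const_pos[where 'n='n]]
  define b where "b = \<beta> * (1 + 2 * ?C / ?V)"
  have [measurable]: "Om \<beta> \<in> sets borel" "\<eta> i \<in> borel_measurable borel"
    using Om_measurable[OF \<beta>0] whitney_measurable[OF W] by auto
  have "dec (\<lambda>y. cz_atom \<beta> x s \<eta> x' s' \<eta>' i y / of_real (gdens y)) (exp 6 * ?V * b * (25 * s i) ^ CARD('n))"
  proof (rule dec_lebesgue)
    show "admissible (x i) (25 * s i)" by (rule center_in(3)[OF W \<alpha>0 s])
    show "cz_atom \<beta> x s \<eta> x' s' \<eta>' i \<in> borel_measurable borel"
      unfolding cz_atom_def[abs_def] by measurable
    show "cz_atom \<beta> x s \<eta> x' s' \<eta>' i y = 0" if y: "y \<notin> cball (x i) (25 * s i)" for y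
    proof -
      have "\<eta> i y = 0" using y s by (intro whitneyD(7)[OF W]) (auto simp: dist_commute)
      moreover have "nball x s i y = 0" using y s by (intro nball_eq_0) auto
      moreover have "(\<Sum>j. nball x' s' j y *\<^sub>R coef2 \<eta> \<eta>' i j) = (\<Sum>j::nat. 0)"
      proof (rule suminf_cong)
      fix j
      show "nball x' s' j y *\<^sub>R coef2 \<eta> \<eta>' i j = 0"
      proof (cases "coef2 \<eta> \<eta>' i j = 0")
        case False
        have "y \<notin> ball (x' j) (s' j)"
        proof
          assume "y \<in> ball (x' j) (s' j)"
          then have "dist (x i) y < 25 * s i"
            using coef2_overlap(4)[OF W W' ab False] dist_triangle[of "x i" y "x' j"] by simp
          with y show False by simp
        qed
        then show ?thesis by (simp add: nball_eq_0)
      qed simp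
      qed
      ultimately show ?thesis by (simp add: cz_atom_def)
    qed
    show "AE y in lborel. norm (cz_atom \<beta> x s \<eta> x' s' \<eta>' i y) \<le> b"
      using h_le_off_Om[of \<beta>]
    proof eventually_elim
      case (elim y)
      have "norm (indicator (- Om \<beta>) y *\<^sub>R (\<eta> i y *\<^sub>R h y)) \<le> \<beta>"
      proof (cases "y \<in> Om \<beta>")
        case False
        have "norm (indicator (- Om \<beta>) y *\<^sub>R (\<eta> i y *\<^sub>R h y)) = \<bar>\<eta> i y\<bar> * norm (h y)" using False by simp
        also have "\<dots> \<le> 1 * \<beta>" using whitney_abs[OF W] elim False \<beta>0 by (intro mult_mono) auto
        finally show ?thesis by simp
      qed (use \<beta>0 in simp)
      moreover have "norm (nball x s i y *\<^sub>R coef1 \<eta> i) \<le> ?C * \<beta> / ?V"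
      proof (rule nball_suminf_bound(2)[OF W])
        show "norm (coef1 \<eta> i) \<le> ?C * \<beta> * s i ^ CARD('n)" for i
          by (rule order_trans[OF coef1_bound[OF W \<alpha>]], intro mult_right_mono mult_left_mono ab C0)
             (use whitneyD(1)[OF W, of i] in simp)
      qed (use C0 \<beta>0 in simp)
      moreover have "norm (\<Sum>j. nball x' s' j y *\<^sub>R coef2 \<eta> \<eta>' i j) \<le> ?C * \<beta> / ?V"
        by (rule nball_suminf_bound(1)[OF W' coef2_bound[OF W W' ab \<alpha>]]) (use C0 \<beta>0 in simp)
      ultimately have "norm (cz_atom \<beta> x s \<eta> x' s' \<eta>' i y) \<le> \<beta> + ?C * \<beta> / ?V + ?C * \<beta> / ?V"
        unfolding cz_atom_def by (intro norm_triangle_le add_mono order_trans[OF norm_triangle_ineq4])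
      also have "\<dots> = b" by (simp add: b_def algebra_simps add_divide_distrib)
      finally show ?case .
    qed
    show "0 \<le> b" unfolding b_def using \<beta>0 C0 V by (intro mult_nonneg_nonneg add_nonneg_nonneg divide_nonneg_pos) auto
    have sm: "summable (\<lambda>j. norm (coef2 \<eta> \<eta>' i j))"
      unfolding coef2_def using whitney_abs[OF W] by (intro whitney_int_bounded[OF W']) auto
    have z: "s' j = 0 \<Longrightarrow> coef2 \<eta> \<eta>' i j = 0" for j using coef2_overlap(2)[OF W W' ab, of i j] by auto
    note I = nball_integral_suminf[OF W' sm z]
    have hi: "integrable lborel (\<lambda>y. \<eta> i y *\<^sub>R h y)" by (rule whitney_integrable[OF W h])
    have i1: "integrable lborel (\<lambda>y. indicator S y *\<^sub>R (\<eta> i y *\<^sub>R h y))" if "S \<in> sets borel" for S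
      using that by (intro integrable_mult_indicator hi) auto
    have i2: "integrable lborel (\<lambda>y. nball x s i y *\<^sub>R coef1 \<eta> i)" using nball_integrable[of s i x] s by simp
    have "(LINT y|lborel. cz_atom \<beta> x s \<eta> x' s' \<eta>' i y) =
      (LINT y|lborel. indicator (- Om \<beta>) y *\<^sub>R (\<eta> i y *\<^sub>R h y)) - (LINT y|lborel. nball x s i y *\<^sub>R coef1 \<eta> i)
        + (LINT y|lborel. (\<Sum>j. nball x' s' j y *\<^sub>R coef2 \<eta> \<eta>' i j))"
    proof -
      have m: "- Om \<beta> \<in> sets borel" by auto
      have "(LINT y|lborel. cz_atom \<beta> x s \<eta> x' s' \<eta>' i y) =
          (LINT y|lborel. indicator (- Om \<beta>) y *\<^sub>R (\<eta> i y *\<^sub>R h y) - nball x s i y *\<^sub>R coef1 \<eta> i)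
          + (LINT y|lborel. (\<Sum>j. nball x' s' j y *\<^sub>R coef2 \<eta> \<eta>' i j))"
        unfolding cz_atom_def by (rule Bochner_Integration.integral_add[OF Bochner_Integration.integrable_diff[OF i1[OF m] i2] I(1)])
      also have "(LINT y|lborel. indicator (- Om \<beta>) y *\<^sub>R (\<eta> i y *\<^sub>R h y) - nball x s i y *\<^sub>R coef1 \<eta> i) =
         (LINT y|lborel. indicator (- Om \<beta>) y *\<^sub>R (\<eta> i y *\<^sub>R h y)) - (LINT y|lborel. nball x s i y *\<^sub>R coef1 \<eta> i)"
        by (rule Bochner_Integration.integral_diff[OF i1[OF m] i2])
      finally show ?thesis .
    qed
    also have "(LINT y|lborel. nball x s i y *\<^sub>R coef1 \<eta> i) = coef1 \<eta> i"
      using nball_integral[of s i x, OF s] nball_integrable[of s i x] s by simp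
    also have "(LINT y|lborel. (\<Sum>j. nball x' s' j y *\<^sub>R coef2 \<eta> \<eta>' i j)) = (LINT y|lborel. indicator (Om \<beta>) y *\<^sub>R (\<eta> i y *\<^sub>R h y))"
      by (rule trans[OF I(2) sums_unique[OF coef2_sums(2)[OF W W' ab \<alpha>0, of i], symmetric]])
    also have "(LINT y|lborel. indicator (- Om \<beta>) y *\<^sub>R (\<eta> i y *\<^sub>R h y)) - coef1 \<eta> i +
        (LINT y|lborel. indicator (Om \<beta>) y *\<^sub>R (\<eta> i y *\<^sub>R h y)) =
      (LINT y|lborel. indicator (- Om \<beta>) y *\<^sub>R (\<eta> i y *\<^sub>R h y) + indicator (Om \<beta>) y *\<^sub>R (\<eta> i y *\<^sub>R h y)) - coef1 \<eta> i"
    proof -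
      have m: "- Om \<beta> \<in> sets borel" "Om \<beta> \<in> sets borel" by auto
      show ?thesis unfolding Bochner_Integration.integral_add[OF i1[OF m(1)] i1[OF m(2)]] by (simp only: algebra_simps)
    qed
    also have "(LINT y|lborel. indicator (- Om \<beta>) y *\<^sub>R (\<eta> i y *\<^sub>R h y) + indicator (Om \<beta>) y *\<^sub>R (\<eta> i y *\<^sub>R h y)) = coef1 \<eta> i"
      unfolding coef1_def by (intro Bochner_Integration.integral_cong) (auto simp: indicator_def)
    finally show "(LINT y|lborel. cz_atom \<beta> x s \<eta> x' s' \<eta>' i y) = 0" by simp
  qed
  moreover have "exp 6 * ?V * b * (25 * s i) ^ CARD('n) = cz_const TYPE('n) * \<beta> * s i ^ CARD('n)"
    unfolding b_def cz_const_def power_mult_distrib by (simp only: mult_ac)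
  ultimately show ?thesis by (simp only:)
qed

text \<open>Term by term: the \<open>\<eta> i\<close> add up to the indicator of
  \<open>Om \<alpha>\<close>, the subtracted terms form the averaged part at level \<alpha>, and by
  exchanging the sums the \<open>coef2\<close> terms form the averaged part at level
  \<beta>.\<close>

lemma cz_atom_sums:
  assumes W: "whitney (rho \<alpha>) x s \<eta>" and W': "whitney (rho \<beta>) x' s' \<eta>'" and ab: "\<alpha> \<le> \<beta>" and \<alpha>: "0 \<le> \<alpha>"
  shows "(\<lambda>i. cz_atom \<beta> x s \<eta> x' s' \<eta>' i y) sums (good_part \<beta> x' s' \<eta>' y - good_part \<alpha> x s \<eta> y)"
proof -
  have "(\<lambda>i. \<eta> i y) sums indicator (Om \<alpha>) y"
  proof -
    have "0 < rho \<alpha> y \<longleftrightarrow> y \<in> Om \<alpha>" using rho_pos[OF \<alpha>] by blast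
    then show ?thesis using whitneyD(9)[OF W, of y] by (simp add: indicator_def split: if_splits)
  qed
  from sums_scaleR_right[OF sums_scaleR_left[OF this, of "h y"], of "indicator (- Om \<beta>) y"]
  have 1: "(\<lambda>i. indicator (- Om \<beta>) y *\<^sub>R (\<eta> i y *\<^sub>R h y)) sums (indicator (- Om \<beta>) y *\<^sub>R (indicator (Om \<alpha>) y *\<^sub>R h y))" .
  have 2: "(\<lambda>i. nball x s i y *\<^sub>R coef1 \<eta> i) sums (\<Sum>i. nball x s i y *\<^sub>R coef1 \<eta> i)"
    by (rule summable_sums[OF nball_summable[OF W]])
  have 3: "(\<lambda>i. \<Sum>j. nball x' s' j y *\<^sub>R coef2 \<eta> \<eta>' i j) sums (\<Sum>j. nball x' s' j y *\<^sub>R coef1 \<eta>' j)"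
    by (rule nball_sums_swap[OF W' coef2_sums(1)[OF W W' ab \<alpha>]])
  have "indicator (- Om \<beta>) y *\<^sub>R (indicator (Om \<alpha>) y *\<^sub>R h y) = indicator (- Om \<beta>) y *\<^sub>R h y - indicator (- Om \<alpha>) y *\<^sub>R h y"
    using Om_mono[OF ab] by (auto simp: indicator_def)
  then have "indicator (- Om \<beta>) y *\<^sub>R (indicator (Om \<alpha>) y *\<^sub>R h y) - (\<Sum>i. nball x s i y *\<^sub>R coef1 \<eta> i) +
     (\<Sum>j. nball x' s' j y *\<^sub>R coef1 \<eta>' j) = good_part \<beta> x' s' \<eta>' y - good_part \<alpha> x s \<eta> y"
    by (simp only: good_part_def) (simp only: algebra_simps)
  with sums_add[OF sums_diff[OF 1 2] 3] show ?thesis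
    unfolding cz_atom_def by (simp only:)
qed

text \<open>The cost of the \<open>i\<close>-th piece is proportional to
  \<open>\<beta> * s i ^ n\<close>, and the disjoint Whitney balls of \<open>Om \<alpha>\<close>
  turn the sum into \<beta> times the measure of \<open>Om \<alpha>\<close>.\<close>

lemma dec_step:
  assumes W: "whitney (rho \<alpha>) x s \<eta>" and W': "whitney (rho \<beta>) x' s' \<eta>'" and ab: "\<alpha> \<le> \<beta>" and \<alpha>: "base \<le> \<alpha>"
  shows "dec (\<lambda>y. (good_part \<beta> x' s' \<eta>' y - good_part \<alpha> x s \<eta> y) / of_real (gdens y))
     (cz_const TYPE('n) / uvol TYPE('n) * \<beta> * measure lborel (Om \<alpha>))"
proof -
  let ?V = "uvol TYPE('n)"
  have V: "0 < ?V" by simp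
  have \<alpha>0: "0 \<le> \<alpha>" and \<beta>0: "0 \<le> \<beta>" using \<alpha> ab base_nonneg by auto
  have vol: "summable (\<lambda>i. s i ^ CARD('n))" "?V * (\<Sum>i. s i ^ CARD('n)) \<le> measure lborel (Om \<alpha>)"
    using whitney_volume[OF W rho_lip] Om_fin unfolding rho_pos[OF \<alpha>0] by auto
  have "dec (\<lambda>y. (good_part \<beta> x' s' \<eta>' y - good_part \<alpha> x s \<eta> y) / of_real (gdens y)) (\<Sum>i. cz_const TYPE('n) * \<beta> * s i ^ CARD('n))"
    by (rule dec_sums[OF dec_cz_atom[OF W W' ab \<alpha>]])
       (auto intro!: AE_I2 summable_mult vol sums_divide cz_atom_sums[OF W W' ab \<alpha>0])
  moreover have "(\<Sum>i. cz_const TYPE('n) * \<beta> * s i ^ CARD('n)) \<le> cz_const TYPE('n) / ?V * \<beta> * measure lborel (Om \<alpha>)"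
  proof -
    have "(\<Sum>i. s i ^ CARD('n)) \<le> measure lborel (Om \<alpha>) / ?V" using vol(2) V by (subst pos_le_divide_eq) (auto simp: mult.commute)
    then have "cz_const TYPE('n) * \<beta> * (\<Sum>i. s i ^ CARD('n)) \<le> cz_const TYPE('n) * \<beta> * (measure lborel (Om \<alpha>) / ?V)"
      using \<beta>0 less_imp_le[OF cz_const_pos[where 'n='n]] by (intro mult_left_mono) auto
    then show ?thesis unfolding suminf_mult[OF vol(1)] by simp
  qed
  ultimately show ?thesis by (rule dec_mono)
qed

lemma level_sum_le: "0 \<le> v \<Longrightarrow> (\<Sum>k<m. if 2 ^ k * base < v then 2 ^ k * base else 0) \<le> 2 * v"
proof -
  assume v: "0 \<le> v"
  \<comment> \<open>The bound \<open>2 ^ m * base\<close> is carried along to close the induction: a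
    further level below \<open>v\<close> at most doubles it, and twice that level is still below
    \<open>2 * v\<close>.\<close>
  have "(\<Sum>k<m. if 2 ^ k * base < v then 2 ^ k * base else 0) \<le> min (2 ^ m * base) (2 * v)"
    using v base_nonneg by (induction m) (auto simp: algebra_simps)
  then show ?thesis by simp
qed

text \<open>A discrete layer cake formula: at each point the levels below \<open>N y\<close> form a
  geometric sum of at most \<open>2 * N y\<close>, which is then integrated.\<close>

lemma level_measure_sum:
  "summable (\<lambda>k. 2 ^ k * base * measure lborel (Om (2 ^ k * base)))"
  "(\<Sum>k. 2 ^ k * base * measure lborel (Om (2 ^ k * base))) \<le> 2 * enn2real (\<integral>\<^sup>+y. N y \<partial>lborel)"
proof -
  let ?a = "\<lambda>k::nat. 2 ^ k * base"
  have a0: "0 \<le> ?a k" for k using base_nonneg by simp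
  have Nm: "(\<lambda>y. N y) \<in> borel_measurable borel"
  proof (rule borel_measurableI_greater)
    fix u :: ennreal
    show "{y \<in> space borel. u < N y} \<in> sets borel"
    proof (cases u)
      case (real v) then show ?thesis using Om_measurable[of v] by (simp add: Om_def)
    qed simp
  qed
  have pt: "(\<Sum>k. ennreal (?a k) * indicator (Om (?a k)) y) \<le> 2 * N y" for y
  proof (cases "N y")
    case (real v)
    show ?thesis
    proof (rule suminf_le_const[OF summableI])
      fix m
      have "(\<Sum>k<m. ennreal (?a k) * indicator (Om (?a k)) y) = (\<Sum>k<m. ennreal (if ?a k < v then ?a k else 0))"
        using real a0 by (intro sum.cong) (auto simp: Om_def indicator_def ennreal_less_iff)
      also have "\<dots> = ennreal (\<Sum>k<m. if ?a k < v then ?a k else 0)"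
        using a0 by (intro sum_ennreal) auto
      also have "\<dots> \<le> ennreal (2 * v)" using level_sum_le[OF real(1)] by (rule ennreal_leI)
      also have "\<dots> = 2 * N y" using real by (simp add: ennreal_mult)
      finally show "(\<Sum>k<m. ennreal (?a k) * indicator (Om (?a k)) y) \<le> 2 * N y" .
    qed
  qed (simp add: ennreal_mult_top)
  have "(\<Sum>k. ennreal (?a k * measure lborel (Om (?a k)))) = (\<Sum>k. \<integral>\<^sup>+y. ennreal (?a k) * indicator (Om (?a k)) y \<partial>lborel)"
  proof (rule suminf_cong)
    fix k
    have "emeasure lborel (Om (?a k)) = ennreal (measure lborel (Om (?a k)))"
      using Om_fin[of "?a k"] by (intro emeasure_eq_ennreal_measure) auto
    then show "ennreal (?a k * measure lborel (Om (?a k))) = (\<integral>\<^sup>+y. ennreal (?a k) * indicator (Om (?a k)) y \<partial>lborel)"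
      using Om_measurable[OF a0] a0 by (subst nn_integral_cmult_indicator) (auto simp: ennreal_mult)
  qed
  also have "\<dots> = (\<integral>\<^sup>+y. (\<Sum>k. ennreal (?a k) * indicator (Om (?a k)) y) \<partial>lborel)"
    using Om_measurable[OF a0] by (intro nn_integral_suminf[symmetric] borel_measurable_times_ennreal borel_measurable_indicator) auto
  also have "\<dots> \<le> (\<integral>\<^sup>+y. 2 * N y \<partial>lborel)" by (intro nn_integral_mono pt)
  also have "\<dots> = 2 * (\<integral>\<^sup>+y. N y \<partial>lborel)" using Nm by (intro nn_integral_cmult) auto
  also have "\<dots> = ennreal (2 * enn2real (\<integral>\<^sup>+y. N y \<partial>lborel))"
    using N_fin by (simp add: ennreal_mult ennreal_enn2real_if)
  finally have le: "(\<Sum>k. ennreal (?a k * measure lborel (Om (?a k)))) \<le> ennreal (2 * enn2real (\<integral>\<^sup>+y. N y \<partial>lborel))" .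
  have nn: "0 \<le> ?a k * measure lborel (Om (?a k))" for k using a0 by simp
  show sm: "summable (\<lambda>k. ?a k * measure lborel (Om (?a k)))"
    by (rule summable_suminf_not_top[OF nn neq_top_trans[OF ennreal_neq_top le]])
  from le show "(\<Sum>k. ?a k * measure lborel (Om (?a k))) \<le> 2 * enn2real (\<integral>\<^sup>+y. N y \<partial>lborel)"
    unfolding suminf_ennreal2[OF nn sm] by (subst (asm) ennreal_le_iff) simp_all
qed

text \<open>\<open>h\<close> is the good part at level \<open>base\<close> plus all differences of
  good parts along the doubling levels. Each difference costs a multiple of twice the lower level
  times the measure of its superlevel set, and these costs add up to a multiple of the integral of
  \<open>N\<close>.\<close>

lemma dec_local:
  "dec (\<lambda>y. h y / of_real (gdens y))
     (cz_const TYPE('n) * (LINT y|lborel. norm (h y)) + 4 * cz_const TYPE('n) / uvol TYPE('n) * enn2real (\<integral>\<^sup>+y. N y \<partial>lborel))"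
\<comment> \<open>For \<open>base = 0\<close> the levels would not grow, but then \<open>h\<close>
  vanishes almost everywhere.\<close>
proof (cases "base = 0")
  case True
  have V: "0 < uvol TYPE('n)" by simp
  have "(LINT y|lborel. norm (h y)) = 0" using True r by (simp add: base_def)
  then have "AE y in lborel. h y = 0" using h by (subst (asm) integral_nonneg_eq_0_iff_AE) auto
  then have "AE y in gauss. 0 = h y / of_real (gdens y)" unfolding AE_gauss by eventually_elim simp
  from dec_cong[OF dec_zero this] show ?thesis
    by (rule dec_mono) (intro add_nonneg_nonneg mult_nonneg_nonneg divide_nonneg_pos V; simp add: less_imp_le[OF cz_const_pos])
next
  case False
  then have b: "0 < base" using base_nonneg by simp
  let ?a = "\<lambda>k::nat. 2 ^ k * base" and ?V = "uvol TYPE('n)"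
  have a0: "0 \<le> ?a k" and ab: "base \<le> ?a k" and inc: "?a k \<le> ?a (Suc k)" for k
    using b by (auto simp: mult_le_cancel_right1)
  have "\<exists>x s \<eta>. whitney (rho (?a k)) x s \<eta>" for k
    using whitney_exists[OF rho_lip rho_le[OF a0]] by metis
  then obtain X S E where W: "\<And>k. whitney (rho (?a k)) (X k) (S k) (E k)" by metis
  define g where "g k = good_part (?a k) (X k) (S k) (E k)" for k
  define F where "F m y = (case m of 0 \<Rightarrow> g 0 y | Suc k \<Rightarrow> g (Suc k) y - g k y) / of_real (gdens y)" for m y
  define \<Lambda> where "\<Lambda> m = (case m of 0 \<Rightarrow> cz_const TYPE('n) * (LINT y|lborel. norm (h y))
     | Suc k \<Rightarrow> 2 * cz_const TYPE('n) / ?V * (?a k * measure lborel (Om (?a k))))" for m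
  have d: "dec (F m) (\<Lambda> m)" for m
  proof (cases m)
    case 0
    then show ?thesis using dec_bottom[of "X 0" "S 0" "E 0"] W[of 0] by (simp add: F_def[abs_def] \<Lambda>_def g_def)
  next
    case (Suc k)
    have "cz_const TYPE('n) / ?V * ?a (Suc k) * measure lborel (Om (?a k)) = \<Lambda> m"
      by (simp add: \<Lambda>_def Suc)
    then show ?thesis using dec_step[OF W[of k] W[of "Suc k"] inc ab] by (simp add: F_def[abs_def] Suc g_def)
  qed
  have \<Lambda>s: "(\<lambda>k. \<Lambda> (Suc k)) sums (2 * cz_const TYPE('n) / ?V * (\<Sum>k. ?a k * measure lborel (Om (?a k))))"
    unfolding \<Lambda>_def nat.case by (intro sums_mult summable_sums level_measure_sum)
  then have \<Lambda>t: "\<Lambda> sums (2 * cz_const TYPE('n) / ?V * (\<Sum>k. ?a k * measure lborel (Om (?a k))) + \<Lambda> 0)"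
    by (simp only: sums_Suc_iff)
  have "dec (\<lambda>y. h y / of_real (gdens y)) (\<Sum>m. \<Lambda> m)"
  proof (rule dec_sums[OF d])
    show "summable \<Lambda>" using \<Lambda>t by (rule sums_summable)
    have Nm: "N \<in> borel_measurable lborel"
    proof (rule borel_measurableI_greater)
      fix u :: ennreal
      show "{y \<in> space lborel. u < N y} \<in> sets lborel"
      proof (cases u)
        case (real v) then show ?thesis using Om_measurable[of v] by (simp add: Om_def)
      qed simp
    qed
    have "AE y in lborel. N y \<noteq> \<infinity>" using N_fin by (intro nn_integral_PInf_AE Nm) auto
    then show "AE y in gauss. (\<lambda>m. F m y) sums (h y / of_real (gdens y))"
      unfolding AE_gauss
    proof eventually_elim
      case (elim y)
      then obtain v where v: "N y = ennreal v" "0 \<le> v" by (cases "N y") auto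
      obtain k0 :: nat where k0: "v / base < 2 ^ k0" using real_arch_pow[of 2] by auto
      \<comment> \<open>Where \<open>N y\<close> is finite, the point leaves the superlevel sets
        from some level on, and there the good part is \<open>h\<close> itself: the telescoping sum
        is eventually constant.\<close>
      have gk: "g k y = h y" if "k0 \<le> k" for k
      proof -
        have "(2::real) ^ k0 \<le> 2 ^ k" using that by (intro power_increasing) auto
        then have "v \<le> ?a k" using k0 b by (simp add: pos_divide_less_eq mult_right_mono order_trans[OF less_imp_le])
        then have "y \<notin> Om (?a k)" using v by (auto simp: Om_def not_less intro: ennreal_leI)
        then show ?thesis unfolding g_def by (rule good_part_off[OF W a0])
      qed
      have part: "(\<Sum>m<Suc k. F m y) = g k y / of_real (gdens y)" for k
        by (induction k) (auto simp: F_def add_divide_distrib[symmetric] diff_divide_distrib)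
      have "(\<lambda>k. \<Sum>m<Suc k. F m y) \<longlonglongrightarrow> h y / of_real (gdens y)"
        unfolding part by (rule tendsto_eventually) (use gk in \<open>auto simp: eventually_at_top_linorder\<close>)
      then show ?case unfolding sums_def by (rule LIMSEQ_offset[where k=1, simplified])
    qed
  qed
  moreover have "(\<Sum>m. \<Lambda> m) \<le> cz_const TYPE('n) * (LINT y|lborel. norm (h y)) + 4 * cz_const TYPE('n) / ?V * enn2real (\<integral>\<^sup>+y. N y \<partial>lborel)"
  proof -
    have "0 \<le> 2 * cz_const TYPE('n) / ?V" using less_imp_le[OF cz_const_pos[where 'n='n]] by simp
    from mult_left_mono[OF level_measure_sum(2) this] show ?thesis
      unfolding sums_unique[OF \<Lambda>t, symmetric] by (simp add: \<Lambda>_def)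
  qed
  ultimately show ?thesis by (rule dec_mono)
qed

end

subsection \<open>The local maximal function and transport of mass\<close>

lemma gdens_ge_on_ball: "norm y \<le> R \<Longrightarrow> pi powr (- (real CARD('n) / 2)) * exp (- R\<^sup>2) \<le> gdens (y::real^'n)"
  unfolding gdens_def by (intro mult_left_mono) (auto intro: power_mono)

text \<open>The density is bounded below on bounded sets, so functions in \<open>L^1\<close> of the
  Gauss measure are locally Lebesgue integrable; this is why the convolutions in \<open>Mloc\<close>
  exist.\<close>

lemma gauss_local_integrable:
  fixes f :: "real^'n \<Rightarrow> complex"
  assumes f: "integrable gauss f" and \<kappa>: "\<kappa> \<in> borel_measurable borel" "\<And>y. \<bar>\<kappa> y\<bar> \<le> B"
    and supp: "\<And>y. y \<notin> ball 0 R \<Longrightarrow> \<kappa> y = 0"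
  shows "integrable lborel (\<lambda>y. \<kappa> y *\<^sub>R f y)"
proof -
  have fm: "f \<in> borel_measurable borel" using f by (auto dest: borel_measurable_integrable)
  define m where "m = pi powr (- (real CARD('n) / 2)) * exp (- R\<^sup>2)"
  have m: "0 < m" by (simp add: m_def)
  have "integrable lborel (\<lambda>y. (\<kappa> y / gdens y) *\<^sub>R (gdens y *\<^sub>R f y))"
  proof (rule integrable_bounded_scaleR)
    show "integrable lborel (\<lambda>y. gdens y *\<^sub>R f y)" using f integrable_gauss[OF fm] by simp
    show "(\<lambda>y. \<kappa> y / gdens y) \<in> borel_measurable lborel" using \<kappa>(1) by measurable
    show "\<bar>\<kappa> y / gdens y\<bar> \<le> \<bar>B\<bar> / m" for y
    proof (cases "y \<in> ball 0 R")
      case True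
      then have "m \<le> gdens y" unfolding m_def by (intro gdens_ge_on_ball) auto
      then show ?thesis using m \<kappa>(2)[of y] unfolding abs_divide by (intro frac_le) auto
    qed (use supp m in simp)
  qed
  then show ?thesis by simp
qed

lemma test_functionsD:
  assumes "\<phi> \<in> test_functions"
  shows "continuous_on UNIV \<phi>" "norm (\<phi> z) \<le> 1" "1 \<le> norm z \<Longrightarrow> \<phi> z = 0"
proof -
  have d: "\<phi> differentiable_on UNIV" and c: "closure {x. \<phi> x \<noteq> 0} \<subseteq> ball 0 1" and n: "\<forall>x. norm (\<phi> x) \<le> 1"
    using assms unfolding test_functions_def by blast+
  show "continuous_on UNIV \<phi>" by (rule differentiable_imp_continuous_on[OF d])
  show "norm (\<phi> z) \<le> 1" using n by blast
  show "\<phi> z = 0" if "1 \<le> norm z"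
  proof (rule ccontr)
    assume "\<phi> z \<noteq> 0"
    then have "z \<in> ball 0 1" using closure_subset[of "{x. \<phi> x \<noteq> 0}"] c by blast
    then show False using that by simp
  qed
qed

lemma dilate_bound:
  fixes x y :: "real^'n"
  assumes \<phi>: "\<phi> \<in> test_functions" and t: "0 < t"
  shows "norm (dilate t \<phi> (x - y)) \<le> indicator (ball x t) y / t ^ CARD('n)"
proof (cases "y \<in> ball x t")
  case False
  then have "1 \<le> norm ((1 / t) *\<^sub>R (x - y))" using t by (simp add: dist_norm)
  then show ?thesis using False test_functionsD(3)[OF \<phi>] by (simp add: dilate_def)
next
  case True
  then show ?thesis using t test_functionsD(2)[OF \<phi>] by (simp add: dilate_def divide_right_mono)
qed

lemma dilate_measurable:
  assumes "\<phi> \<in> test_functions"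
  shows "(\<lambda>y. dilate t \<phi> (x - y)) \<in> borel_measurable borel"
  unfolding dilate_def
  by (intro borel_measurable_continuous_onI continuous_on_scaleR continuous_on_const
      continuous_on_compose2[OF test_functionsD(1)[OF assms]] continuous_on_diff continuous_on_id) auto

lemma convol_integrable:
  fixes f :: "real^'n \<Rightarrow> complex"
  assumes f: "integrable gauss f" and \<phi>: "\<phi> \<in> test_functions" and t: "0 < t"
  shows "integrable lborel (\<lambda>y. dilate t \<phi> (x - y) * f y)"
proof (rule Bochner_Integration.integrable_bound)
  have "integrable lborel (\<lambda>y. (indicator (ball x t) y / t ^ CARD('n)) *\<^sub>R f y)"
  proof (rule gauss_local_integrable[OF f])
    show "\<bar>indicator (ball x t) y / t ^ CARD('n)\<bar> \<le> 1 / t ^ CARD('n)" for y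
      using t by (simp add: indicator_def)
    show "indicator (ball x t) y / t ^ CARD('n) = 0" if "y \<notin> ball 0 (norm x + t)" for y
      using that norm_triangle_sub[of y x] by (auto simp: indicator_def dist_norm norm_minus_commute)
  qed measurable
  then show "integrable lborel (\<lambda>y. (indicator (ball x t) y / t ^ CARD('n)) *\<^sub>R f y)" .
  have "norm (dilate t \<phi> (x - y) * f y) \<le> norm ((indicator (ball x t) y / t ^ CARD('n)) *\<^sub>R f y)" for y
    using mult_right_mono[OF dilate_bound[OF \<phi> t, of x y], of "norm (f y)"] t by (simp add: norm_mult)
  then show "AE y in lborel. norm (dilate t \<phi> (x - y) * f y) \<le> norm ((indicator (ball x t) y / t ^ CARD('n)) *\<^sub>R f y)"
    by simp
  have "f \<in> borel_measurable borel" using f by (auto dest: borel_measurable_integrable)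
  then show "(\<lambda>y. dilate t \<phi> (x - y) * f y) \<in> borel_measurable lborel"
    using dilate_measurable[OF \<phi>] by (auto intro: borel_measurable_times)
qed

text \<open>Dominated convergence: for all centres in a unit ball the kernels are supported in one
  fixed ball of radius \<open>R\<close>.\<close>

lemma convol_continuous:
  fixes f :: "real^'n \<Rightarrow> complex"
  assumes f: "integrable gauss f" and \<phi>: "\<phi> \<in> test_functions" and t: "0 < t"
  shows "continuous_on (ball a 1) (convol (dilate t \<phi>) f)"
  unfolding continuous_on_sequentially
proof (intro allI ballI impI, elim conjE)
  fix u :: "nat \<Rightarrow> real^'n" and x
  assume x: "x \<in> ball a 1" and u: "\<forall>k. u k \<in> ball a 1" and lim: "u \<longlonglongrightarrow> x"
  have fm: "f \<in> borel_measurable borel" using f by (auto dest: borel_measurable_integrable)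
  define R where "R = norm a + 1 + t"
  have "(\<lambda>k. LINT y|lborel. dilate t \<phi> (u k - y) * f y) \<longlonglongrightarrow> (LINT y|lborel. dilate t \<phi> (x - y) * f y)"
  proof (rule integral_dominated_convergence[where w="\<lambda>y. norm ((indicator (ball 0 R) y / t ^ CARD('n)) *\<^sub>R f y)"])
    show "(\<lambda>y. dilate t \<phi> (u k - y) * f y) \<in> borel_measurable lborel" for k
      using dilate_measurable[OF \<phi>] fm by (auto intro: borel_measurable_times)
    show "(\<lambda>y. dilate t \<phi> (x - y) * f y) \<in> borel_measurable lborel"
      using dilate_measurable[OF \<phi>] fm by (auto intro: borel_measurable_times)
    show "integrable lborel (\<lambda>y. norm ((indicator (ball 0 R) y / t ^ CARD('n)) *\<^sub>R f y))"
    proof (intro integrable_norm gauss_local_integrable[OF f])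
      show "\<bar>indicator (ball 0 R) y / t ^ CARD('n)\<bar> \<le> 1 / t ^ CARD('n)" for y :: "real^'n"
        using t by (simp add: indicator_def)
      show "y \<notin> ball 0 R \<Longrightarrow> indicator (ball 0 R) y / t ^ CARD('n) = 0" for y :: "real^'n"
        by simp
    qed measurable
    have "(\<lambda>k. dilate t \<phi> (u k - y) * f y) \<longlonglongrightarrow> dilate t \<phi> (x - y) * f y" for y
      unfolding dilate_def
      by (intro tendsto_intros lim continuous_on_tendsto_compose[OF test_functionsD(1)[OF \<phi>]]) auto
    then show "AE y in lborel. (\<lambda>k. dilate t \<phi> (u k - y) * f y) \<longlonglongrightarrow> dilate t \<phi> (x - y) * f y" by simp
    show "AE y in lborel. norm (dilate t \<phi> (u k - y) * f y) \<le> norm ((indicator (ball 0 R) y / t ^ CARD('n)) *\<^sub>R f y)" for k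
    proof (rule AE_I2)
      fix y
      have "norm y < R" if "y \<in> ball (u k) t"
      proof -
        have "norm y \<le> norm a + dist a (u k) + dist (u k) y"
          using dist_triangle[of 0 y a] dist_triangle[of a y "u k"] by simp
        then show ?thesis using that u[rule_format, of k] by (auto simp: R_def)
      qed
      then have "indicator (ball (u k) t) y \<le> (indicator (ball 0 R) y :: real)" by (auto simp: indicator_def)
      then have "norm (dilate t \<phi> (u k - y)) \<le> indicator (ball 0 R) y / t ^ CARD('n)"
        using dilate_bound[OF \<phi> t, of "u k" y] t by (meson divide_right_mono less_imp_le order_trans zero_less_power)
      from mult_right_mono[OF this, of "norm (f y)"]
      show "norm (dilate t \<phi> (u k - y) * f y) \<le> norm ((indicator (ball 0 R) y / t ^ CARD('n)) *\<^sub>R f y)"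
        using t by (simp add: norm_mult)
    qed
  qed
  then show "(convol (dilate t \<phi>) f \<circ> u) \<longlonglongrightarrow> convol (dilate t \<phi>) f x" by (simp add: convol_def o_def)
qed

lemma adm_radius_continuous: "continuous_on UNIV adm_radius"
  unfolding adm_radius_eq[abs_def] by (intro continuous_intros) (auto simp: max_def)

text \<open>\<open>Mloc\<close> is a supremum of continuous functions, except that the range of
  \<open>t\<close> moves with the point. As \<open>adm_radius\<close> is continuous, a scale allowed
  at \<open>a\<close> remains allowed nearby. The open superlevel sets give measurability and later
  carry the Whitney coverings.\<close>

lemma Mloc_lsc:
  fixes f :: "real^'n \<Rightarrow> complex"
  assumes f: "integrable gauss f"
  shows "open {x. u < Mloc f x}"
proof (rule openI)
  fix a assume "a \<in> {x. u < Mloc f x}"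
  then obtain \<phi> t where \<phi>: "\<phi> \<in> test_functions" and t: "0 < t" "t < adm_radius a"
    and lt: "u < ennreal (norm (convol (dilate t \<phi>) f a))"
    unfolding Mloc_def by (auto simp: less_SUP_iff)
  define S where "S = {x\<in>ball a 1. u < ennreal (norm (convol (dilate t \<phi>) f x))} \<inter> {x. t < adm_radius x}"
  have "continuous_on (ball a 1) (\<lambda>x. ennreal (norm (convol (dilate t \<phi>) f x)))"
    by (intro continuous_on_ennreal continuous_on_norm convol_continuous[OF f \<phi> t(1)])
  then have "open ((\<lambda>x. ennreal (norm (convol (dilate t \<phi>) f x))) -` {u<..} \<inter> ball a 1)"
    by (intro continuous_on_open_vimage[THEN iffD1, rule_format]) auto
  moreover have "(\<lambda>x. ennreal (norm (convol (dilate t \<phi>) f x))) -` {u<..} \<inter> ball a 1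
      = {x\<in>ball a 1. u < ennreal (norm (convol (dilate t \<phi>) f x))}" by auto
  moreover have "open {x::real^'n. t < adm_radius x}"
    by (intro open_Collect_less continuous_on_const adm_radius_continuous)
  ultimately have "open S" unfolding S_def by auto
  moreover have "a \<in> S" using t lt by (simp add: S_def)
  moreover have "S \<subseteq> {x. u < Mloc f x}"
  proof
    fix x assume "x \<in> S"
    then have "u < ennreal (norm (convol (dilate t \<phi>) f x))" "t \<in> {0<..<adm_radius x}" using t by (auto simp: S_def)
    then have "\<exists>\<phi>\<in>test_functions. \<exists>t\<in>{0<..<adm_radius x}. u < ennreal (norm (convol (dilate t \<phi>) f x))"
      using \<phi> by (intro bexI[of _ \<phi>] bexI[of _ t])
    then show "x \<in> {x. u < Mloc f x}" unfolding Mloc_def by (simp only: less_SUP_iff mem_Collect_eq)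
  qed
  ultimately show "\<exists>e>0. ball a e \<subseteq> {x. u < Mloc f x}"
    by (meson open_contains_ball subset_trans)
qed

lemma Mloc_measurable:
  assumes f: "integrable gauss f"
  shows "Mloc f \<in> borel_measurable borel"
  using Mloc_lsc[OF f] by (intro borel_measurableI_greater) auto

text \<open>The threshold moves from \<alpha> to \<open>(\<alpha> - b) / a\<close>. The cases are
  due to \<open>ennreal\<close>, which truncates negative numbers to 0: if \<alpha> is negative or
  below \<open>b\<close>, the comparison has to be settled directly.\<close>

lemma lsc_affine:
  fixes M :: "'a::topological_space \<Rightarrow> ennreal"
  assumes M: "\<And>u. open {y. u < M y}" and a: "0 < a" and b: "0 \<le> b"
  shows "open {y. ennreal \<alpha> < ennreal a * M y + ennreal b}"
proof (cases "0 \<le> \<alpha>")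
  case \<alpha>: True
  show ?thesis
  proof (cases "\<alpha> < b")
    case True
    have "ennreal \<alpha> < ennreal a * M y + ennreal b" for y
    proof (rule less_le_trans[of _ "ennreal b"])
      show "ennreal \<alpha> < ennreal b" using True \<alpha> by (simp add: ennreal_less_iff)
    qed simp
    then show ?thesis by simp
  next
    case False
    have "ennreal \<alpha> < ennreal a * M y + ennreal b \<longleftrightarrow> ennreal ((\<alpha> - b) / a) < M y" for y
    proof (cases "M y")
      case (real v)
      have "ennreal a * M y + ennreal b = ennreal (a * v + b)" using real a b by (simp add: ennreal_mult)
      then have "ennreal \<alpha> < ennreal a * M y + ennreal b \<longleftrightarrow> ennreal \<alpha> < ennreal (a * v + b)" by (simp only:)
      also have "\<dots> \<longleftrightarrow> \<alpha> < a * v + b" by (rule ennreal_less_iff[OF \<alpha>])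
      also have "\<dots> \<longleftrightarrow> (\<alpha> - b) / a < v" using a by (subst pos_divide_less_eq) (auto simp: mult.commute)
      also have "\<dots> \<longleftrightarrow> ennreal ((\<alpha> - b) / a) < M y"
        unfolding real(2) using a False by (intro ennreal_less_iff[symmetric]) simp
      finally show ?thesis .
    qed (use a in \<open>simp add: ennreal_mult_top\<close>)
    then show ?thesis using M by simp
  qed
next
  case False
  then have e: "ennreal \<alpha> = 0" by (simp add: ennreal_neg)
  show ?thesis
  proof (cases "b = 0")
    case True
    have "0 < ennreal a * M y + ennreal b \<longleftrightarrow> 0 < M y" for y
      using a unfolding True by (simp add: ennreal_zero_less_mult_iff)
    then show ?thesis using M[of 0] unfolding e by (simp only:)
  next
    case False
    have "0 < ennreal a * M y + ennreal b" for y
    proof (rule less_le_trans[of _ "ennreal b"])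
      show "0 < ennreal b" using False b by simp
    qed simp
    then show ?thesis unfolding e by (simp only: Collect_const if_True) simp
  qed
qed

text \<open>The constant of \<open>AE_le_maximal\<close> times \<open>2 * 2^n\<close>, the price of
  \<open>Mloc_testf\<close> relative to \<open>t^n\<close>.\<close>

abbreviation ae_const :: "'n::finite itself \<Rightarrow> real" where
  "ae_const _ \<equiv> 20 * whitney_lip TYPE('n) * 20 ^ CARD('n) / uvol TYPE('n) * (2 * 2 ^ CARD('n))"

lemma ae_const_nonneg: "0 \<le> ae_const TYPE('n::finite)"
  by (intro mult_nonneg_nonneg divide_nonneg_nonneg) auto

text \<open>\<open>f\<close> is only locally Lebesgue integrable and the admissible radius has no
  positive lower bound, so the comparison is made on balls of radius \<open>R\<close>. There
  \<open>f\<close> can be cut off beyond \<open>R + 1\<close>, and all scales below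
  \<open>1 / (2 * (R + 1))\<close> are allowed.\<close>

lemma AE_le_Mloc:
  fixes f :: "real^'n \<Rightarrow> complex"
  assumes f: "integrable gauss f"
  shows "AE y in lborel. ennreal (norm (f y)) \<le> ennreal (ae_const TYPE('n)) * Mloc f y"
proof -
  have "AE y in lborel. y \<in> ball 0 (real R) \<longrightarrow> ennreal (norm (f y)) \<le> ennreal (ae_const TYPE('n)) * Mloc f y" for R :: nat
  proof -
    let ?h = "\<lambda>y. indicator (ball 0 (real R + 1)) y *\<^sub>R f y"
    let ?c = "2 * 2 ^ CARD('n) :: real"
    define \<delta> where "\<delta> = 1 / (2 * (real R + 1))"
    have "AE y in lborel. y \<in> ball 0 (real R) \<longrightarrow> ennreal (norm (?h y)) \<le>
      ennreal (20 * whitney_lip TYPE('n) * 20 ^ CARD('n) / uvol TYPE('n)) * (ennreal ?c * Mloc f y)"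
    proof (rule AE_le_maximal)
      show "integrable lborel ?h"
        by (rule gauss_local_integrable[OF f, of _ 1]) (auto simp: indicator_def)
      show "open (ball (0::real^'n) (real R))" by simp
      show "0 < \<delta>" by (simp add: \<delta>_def)
      show "open {y\<in>ball 0 (real R). ennreal \<alpha> < ennreal ?c * Mloc f y}" for \<alpha>
      proof -
        have "open ({y. ennreal \<alpha> < ennreal ?c * Mloc f y + ennreal 0} \<inter> ball 0 (real R))"
          by (intro open_Int lsc_affine Mloc_lsc[OF f]) auto
        then show ?thesis by (simp add: Int_def conj_commute)
      qed
      fix x :: "real^'n" and t \<zeta> assume x: "x \<in> ball 0 (real R)" and t: "0 < t" "t < \<delta>" and \<zeta>: "\<zeta> \<in> testf x t"
      have "max 1 (norm x) \<le> real R + 1" using x by auto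
      then have "1 / (real R + 1) \<le> adm_radius x" unfolding adm_radius_eq by (intro divide_left_mono) auto
      moreover have "2 * t < 1 / (real R + 1)" using t(2) by (simp add: \<delta>_def field_simps)
      ultimately have t2: "2 * t < adm_radius x" by linarith
      have t1: "t < 1" using t2 t adm_radius_le_1[of x] by linarith
      have "\<zeta> y *\<^sub>R ?h y = \<zeta> y *\<^sub>R f y" for y :: "real^'n"
      proof (cases "y \<in> ball 0 (real R + 1)")
        case False
        have "norm y \<le> norm x + dist x y" using dist_triangle[of 0 y x] by simp
        then have "t \<le> dist x y" using False x t1 by auto
        then show ?thesis using \<zeta> by (simp add: testf_def)
      qed simp
      then have "ennreal (norm (LINT y|lborel. \<zeta> y *\<^sub>R ?h y)) = ennreal (norm (LINT y|lborel. \<zeta> y *\<^sub>R f y))"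
        by (simp only:)
      also have "\<dots> \<le> ennreal (2 * (2 * t) ^ CARD('n)) * Mloc f x"
        by (rule Mloc_testf[OF t(1) t2 \<zeta>])
      also have "2 * (2 * t) ^ CARD('n) = t ^ CARD('n) * ?c" by (simp add: power_mult_distrib)
      also have "ennreal (t ^ CARD('n) * ?c) * Mloc f x = ennreal (t ^ CARD('n)) * (ennreal ?c * Mloc f x)"
        using t by (simp only: ennreal_mult zero_le_power less_imp_le mult.assoc) (simp add: ennreal_mult mult.assoc)
      finally show "ennreal (norm (LINT y|lborel. \<zeta> y *\<^sub>R ?h y)) \<le> ennreal (t ^ CARD('n)) * (ennreal ?c * Mloc f x)" .
    qed
    then show ?thesis
    proof eventually_elim
      case (elim y)
      show ?case
      proof
        assume y: "y \<in> ball 0 (real R)"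
        then have "?h y = f y" by (simp add: indicator_def)
        with elim y have "ennreal (norm (f y)) \<le> ennreal (20 * whitney_lip TYPE('n) * 20 ^ CARD('n) / uvol TYPE('n)) * (ennreal ?c * Mloc f y)"
          by (simp only:)
        also have "\<dots> = ennreal (ae_const TYPE('n)) * Mloc f y"
          by (subst ennreal_mult) (auto simp: mult.assoc)
        finally show "ennreal (norm (f y)) \<le> ennreal (ae_const TYPE('n)) * Mloc f y" .
      qed
    qed
  qed
  then have "AE y in lborel. \<forall>R::nat. y \<in> ball 0 (real R) \<longrightarrow> ennreal (norm (f y)) \<le> ennreal (ae_const TYPE('n)) * Mloc f y"
    unfolding AE_all_countable ..
  then show ?thesis
  proof eventually_elim
    case (elim y)
    obtain R :: nat where "norm y < real R" using reals_Archimedean2 by blast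
    then have "y \<in> ball 0 (real R)" by simp
    then show ?case by (rule elim[rule_format])
  qed
qed

text \<open>Mass is transported to the origin along a chain of these densities (with respect to Lebesgue measure),
  each step lowering \<open>|x|\<^sup>2\<close> by at least 1/100.\<close>

definition tau :: "real^'n \<Rightarrow> real^'n \<Rightarrow> real" where
  "tau p y = indicator (ball p (adm_radius p / 100)) y / (uvol TYPE('n) * (adm_radius p / 100) ^ CARD('n))"

lemma tau_nball: "s i = adm_radius (x i) / 100 \<Longrightarrow> nball x s i = tau (x i)"
  by (rule ext) (simp only: nball_def tau_def)

lemma tau_measurable [measurable]: "tau p \<in> borel_measurable borel"
  unfolding tau_def[abs_def] by measurable

lemma tau_integral: "integrable lborel (tau p)" "(LINT y|lborel. tau p y) = 1"
  using nball_integrable[of "\<lambda>_. adm_radius p / 100" 0 "\<lambda>_. p"] nball_integral[of "\<lambda>_. adm_radius p / 100" 0 "\<lambda>_. p"]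
    tau_nball[of "\<lambda>_. adm_radius p / 100" 0 "\<lambda>_. p"] adm_radius_pos[of p] by (auto simp: less_imp_le)

lemma tau_range:
  assumes s: "R / 200 \<le> adm_radius p / 100" and R: "0 < R"
  shows "0 \<le> tau (p::real^'n) y" "tau p y \<le> 200 ^ CARD('n) / (uvol TYPE('n) * R ^ CARD('n))"
proof -
  let ?V = "uvol TYPE('n)"
  have V: "0 < ?V" by simp
  show "0 \<le> tau p y" using less_imp_le[OF adm_radius_pos[of p]] by (simp add: tau_def)
  have "tau p y \<le> 1 / (?V * (adm_radius p / 100) ^ CARD('n))"
    unfolding tau_def using less_imp_le[OF adm_radius_pos[of p]] by (intro divide_right_mono) (auto simp: indicator_def)
  also have "\<dots> \<le> 1 / (?V * (R / 200) ^ CARD('n))"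
    using R s V by (intro divide_left_mono mult_left_mono power_mono mult_pos_pos) auto
  also have "\<dots> = 200 ^ CARD('n) / (?V * R ^ CARD('n))" using R by (simp add: power_divide)
  finally show "tau p y \<le> 200 ^ CARD('n) / (?V * R ^ CARD('n))" .
qed

text \<open>Both densities live in one admissible ball on balls of radius at least
  \<open>R / 200\<close>, so their difference has mean zero and height at most \<open>200^n\<close>
  divided by the volume of \<open>cball u R\<close>. This is a bounded multiple of an atom,
  uniformly in \<open>u\<close> and \<open>R\<close>.\<close>

lemma dec_tau_step:
  fixes p q u :: "real^'n"
  assumes adm: "admissible u R" and p: "dist u p + adm_radius p / 100 \<le> R" "R / 200 \<le> adm_radius p / 100"
    and q: "dist u q + adm_radius q / 100 \<le> R" "R / 200 \<le> adm_radius q / 100"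
  shows "dec (\<lambda>y. of_real (tau p y - tau q y) / of_real (gdens y)) (exp 6 * 200 ^ CARD('n))"
proof -
  let ?V = "uvol TYPE('n)"
  have V: "0 < ?V" by simp
  have R: "0 < R" using adm by (simp add: admissible_def)
  define b where "b = 200 ^ CARD('n) / (?V * R ^ CARD('n))"
  have b: "0 \<le> b" using R V unfolding b_def by (intro divide_nonneg_nonneg mult_nonneg_nonneg) auto
  have z: "tau p' y = 0" if "y \<notin> cball u R" "dist u p' + adm_radius p' / 100 \<le> R" for y p'
  proof -
    have "y \<notin> ball p' (adm_radius p' / 100)" using that dist_triangle[of u y p'] by auto
    then show ?thesis by (simp add: tau_def)
  qed
  have "dec (\<lambda>y. of_real (tau p y - tau q y) / of_real (gdens y)) (exp 6 * ?V * b * R ^ CARD('n))"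
  proof (rule dec_lebesgue[OF adm])
    show "(\<lambda>y. of_real (tau p y - tau q y) :: complex) \<in> borel_measurable borel" by measurable
    show "of_real (tau p y - tau q y) = (0::complex)" if "y \<notin> cball u R" for y using z[OF that] p q by simp
    have "\<bar>tau p y - tau q y\<bar> \<le> b" for y
      using tau_range[OF p(2) R, of y] tau_range[OF q(2) R, of y] unfolding b_def by linarith
    then show "AE y in lborel. norm (of_real (tau p y - tau q y) :: complex) \<le> b"
      by (intro AE_I2) (simp only: norm_of_real)
    have "(LINT y|lborel. of_real (tau p y - tau q y) :: complex) = of_real (LINT y|lborel. tau p y - tau q y)"
      by (rule integral_complex_of_real)
    also have "(LINT y|lborel. tau p y - tau q y) = 0"
      by (subst Bochner_Integration.integral_diff) (simp_all add: tau_integral)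
    finally show "(LINT y|lborel. of_real (tau p y - tau q y) :: complex) = 0" by simp
  qed (use b in simp)
  moreover have "exp 6 * ?V * b * R ^ CARD('n) = exp 6 * 200 ^ CARD('n)" using R by (simp add: b_def)
  ultimately show ?thesis by (simp only:)
qed

lemma dec_tau_chain:
  fixes x :: "real^'n"
  shows "(norm x)\<^sup>2 \<le> 1 + real m / 100 \<Longrightarrow>
    dec (\<lambda>y. of_real (tau x y - tau 0 y) / of_real (gdens y)) ((real m + 1) * (exp 6 * 200 ^ CARD('n)))"
proof (induction m arbitrary: x)
  \<comment> \<open>Within the unit ball one link suffices: the ball of radius 1 about
    \<open>x / 2\<close> contains both supports.\<close>
  have small: "dec (\<lambda>y. of_real (tau x y - tau 0 y) / of_real (gdens y)) (exp 6 * 200 ^ CARD('n))"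
    if "norm x \<le> 1" for x :: "real^'n"
  proof (rule dec_tau_step)
    have a: "adm_radius x = 1" "adm_radius (0::real^'n) = 1" "adm_radius ((1/2) *\<^sub>R x) = 1"
      using that by (auto simp: adm_radius_eq max_def)
    show "admissible ((1/2) *\<^sub>R x) 1" using a by (simp add: admissible_def)
    have "(1/2) *\<^sub>R x - x = (1/2 - 1) *\<^sub>R x" by (simp only: scaleR_left_diff_distrib scaleR_one)
    moreover have "norm ((1/2 - 1) *\<^sub>R x) = norm x / 2" by simp
    ultimately have "dist ((1/2) *\<^sub>R x) x = norm x / 2" unfolding dist_norm by (simp only:)
    then show "dist ((1/2) *\<^sub>R x) x + adm_radius x / 100 \<le> 1" using that a by simp
    show "dist ((1/2) *\<^sub>R x) 0 + adm_radius (0::real^'n) / 100 \<le> 1" using that a by simp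
  qed (use that in \<open>auto simp: adm_radius_eq max_def\<close>)
  {
    case 0
    then have "norm x \<le> 1" by (simp add: power_le_one_iff abs_square_le_1)
    from small[OF this] show ?case by simp
  next
    case (Suc m)
    show ?case
    proof (cases "norm x \<le> 1")
      case True
      have "1 * (exp 6 * 200 ^ CARD('n)) \<le> (real (Suc m) + 1) * (exp 6 * 200 ^ CARD('n) :: real)"
        by (intro mult_right_mono) auto
      with dec_mono[OF small[OF True]] show ?thesis by simp
    next
      case False
      then have x: "1 < norm x" by simp
      \<comment> \<open>The distance moved, \<open>k * norm x\<close>, is exactly a hundredth of the
        admissible radius \<open>1 / norm x\<close>, while \<open>k\<close> times the squared norm
        is 1/100; as \<open>(1 - k)^2 <= 1 - k\<close>, at least this much is lost from the squared
        norm.\<close>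
      define k where "k = 1 / (100 * (norm x)\<^sup>2)"
      have x2: "1 < (norm x)\<^sup>2" using x by (simp add: one_less_power)
      have x3: "1 < 100 * (norm x)\<^sup>2" using x2 by linarith
      have "x \<noteq> 0" using x by auto
      then have k: "0 < k" "k * (norm x)\<^sup>2 = 1 / 100"
        unfolding k_def by auto
      have k1: "k < 1" unfolding k_def using x3 by (subst divide_less_eq_1_pos) linarith+
      define x' where "x' = (1 - k) *\<^sub>R x"
      have ax: "adm_radius x = 1 / norm x" using x by (simp add: adm_radius_eq)
      have "x - x' = k *\<^sub>R x" by (simp add: x'_def scaleR_left_diff_distrib)
      then have "dist x x' = k * norm x" using k(1) by (simp only: dist_norm norm_scaleR abs_of_pos)
      also have "\<dots> = adm_radius x / 100"
      proof -
        have "norm x \<noteq> 0" using x by auto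
        then show ?thesis unfolding ax k_def power2_eq_square by (simp only: divide_simps) simp
      qed
      finally have d: "dist x x' = adm_radius x / 100" .
      have "(norm x')\<^sup>2 = (1 - k)\<^sup>2 * (norm x)\<^sup>2" using k by (simp add: x'_def power_mult_distrib)
      also have "\<dots> \<le> (1 - k) * (norm x)\<^sup>2"
      proof (rule mult_right_mono)
        have "(1 - k) * (1 - k) \<le> (1 - k) * 1" using k k1 by (intro mult_left_mono) auto
        then show "(1 - k)\<^sup>2 \<le> 1 - k" by (simp add: power2_eq_square)
      qed simp
      also have "\<dots> = (norm x)\<^sup>2 - 1 / 100" using k by (simp add: left_diff_distrib)
      finally have "(norm x')\<^sup>2 \<le> 1 + real m / 100" using Suc.prems by (simp add: add_divide_distrib)
      note IH = Suc.IH[OF this]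
      have ax': "adm_radius x' \<le> 101/100 * adm_radius x" "99/100 * adm_radius x \<le> adm_radius x'"
        using adm_radius_lipschitz[of x x'] d by linarith+
      have "dec (\<lambda>y. of_real (tau x y - tau x' y) / of_real (gdens y)) (exp 6 * 200 ^ CARD('n))"
      proof (rule dec_tau_step)
        show "admissible x (adm_radius x)" by (simp add: admissible_def)
      qed (use d ax' adm_radius_pos[of x] in auto)
      from dec_add[OF this IH]
      have "dec (\<lambda>y. of_real (tau x y - tau 0 y) / of_real (gdens y))
          (exp 6 * 200 ^ CARD('n) + (real m + 1) * (exp 6 * 200 ^ CARD('n)))"
        by (simp add: add_divide_distrib[symmetric])
      then show ?thesis by (simp add: algebra_simps)
    qed
  }
qed

abbreviation chain_const :: "'n::finite itself \<Rightarrow> real" where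
  "chain_const _ \<equiv> 200 * (exp 6 * 200 ^ CARD('n))"

text \<open>The chain is used with \<open>m\<close> the least integer not below
  \<open>100 * |x|^2\<close>; its \<open>m + 1\<close> links are at most
  \<open>200 * (1 + |x|^2)\<close> in number.\<close>

lemma dec_tau:
  fixes x :: "real^'n"
  shows "dec (\<lambda>y. of_real (tau x y - tau 0 y) / of_real (gdens y)) (chain_const TYPE('n) * (1 + (norm x)\<^sup>2))"
proof -
  define m where "m = nat \<lceil>100 * (norm x)\<^sup>2\<rceil>"
  have m: "100 * (norm x)\<^sup>2 \<le> real m" "real m \<le> 100 * (norm x)\<^sup>2 + 1"
  proof -
    have "0 \<le> 100 * (norm x)\<^sup>2" by simp
    then have "0 \<le> \<lceil>100 * (norm x)\<^sup>2\<rceil>" by linarith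
    then have "real m = of_int \<lceil>100 * (norm x)\<^sup>2\<rceil>" unfolding m_def by (rule of_nat_nat)
    then show "100 * (norm x)\<^sup>2 \<le> real m" "real m \<le> 100 * (norm x)\<^sup>2 + 1" by linarith+
  qed
  have d: "dec (\<lambda>y. of_real (tau x y - tau 0 y) / of_real (gdens y)) ((real m + 1) * (exp 6 * 200 ^ CARD('n)))"
  proof (rule dec_tau_chain)
    show "(norm x)\<^sup>2 \<le> 1 + real m / 100" using m(1) by simp
  qed
  have "(real m + 1) * (exp 6 * 200 ^ CARD('n)) \<le> (200 * (1 + (norm x)\<^sup>2)) * (exp 6 * 200 ^ CARD('n) :: real)"
  proof (rule mult_right_mono)
    show "real m + 1 \<le> 200 * (1 + (norm x)\<^sup>2)"
      using m(2) zero_le_power2[of "norm x"] by (simp add: algebra_simps)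
  qed simp
  also have "a * b * e = a * e * b" for a b e :: real by simp
  finally show ?thesis by (rule dec_mono[OF d])
qed

subsection \<open>Localisation to admissible balls\<close>

lemma exp_minus_lipschitz:
  fixes a b :: real
  assumes "exp (- a) \<le> M" "exp (- b) \<le> M"
  shows "\<bar>exp (- a) - exp (- b)\<bar> \<le> M * \<bar>a - b\<bar>"
proof -
  have *: "exp (- a) - exp (- b) \<le> M * (b - a)" if "a \<le> b" "exp (- a) \<le> M" for a b
  proof -
    have "exp (- b) = exp (- a) * exp (a - b)" by (simp add: exp_add[symmetric])
    then have "exp (- a) - exp (- b) = exp (- a) * (1 - exp (a - b))" by (simp add: algebra_simps)
    also have "\<dots> \<le> exp (- a) * (b - a)"
    proof (rule mult_left_mono)
      show "1 - exp (a - b) \<le> b - a" using exp_ge_add_one_self[of "a - b"] by linarith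
    qed simp
    also have "\<dots> \<le> M * (b - a)" using that by (intro mult_right_mono) auto
    finally show ?thesis .
  qed
  show ?thesis
  proof (cases "a \<le> b")
    case True
    then have "exp (- b) \<le> exp (- a)" by simp
    then show ?thesis using *[OF True assms(1)] True by simp
  next
    case False
    then have "exp (- a) \<le> exp (- b)" by simp
    then show ?thesis using *[of b a] assms False by simp
  qed
qed

text \<open>The ratio is an exponential of a difference of squared norms, so its increments are at
  most \<open>M\<close>, a bound for the ratio itself, times the increments of
  \<open>|y|^2\<close>.\<close>

lemma gdens_ratio_lipschitz:
  fixes c y z :: "real^'n"
  assumes "gdens y \<le> M * gdens c" "gdens z \<le> M * gdens c"
  shows "\<bar>gdens y / gdens c - gdens z / gdens c\<bar> \<le> M * (dist y z * (norm y + norm z))"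
proof -
  define P where "P = pi powr (- (real CARD('n) / 2))"
  have P: "0 < P" by (simp add: P_def)
  have r: "gdens w / gdens c = exp (- ((norm w)\<^sup>2 - (norm c)\<^sup>2))" for w :: "real^'n"
    using P by (simp add: gdens_def P_def[symmetric] exp_diff[symmetric])
  have M: "0 \<le> M" using assms(1) gdens_pos(1)[of y] gdens_pos(1)[of c]
    by (meson less_le_trans less_imp_le zero_less_mult_pos2)
  have "\<bar>gdens y / gdens c - gdens z / gdens c\<bar> \<le> M * \<bar>((norm y)\<^sup>2 - (norm c)\<^sup>2) - ((norm z)\<^sup>2 - (norm c)\<^sup>2)\<bar>"
    unfolding r by (rule exp_minus_lipschitz; unfold r[symmetric]; use assms in \<open>simp add: pos_divide_le_eq\<close>)
  also have "\<dots> = M * \<bar>(norm y)\<^sup>2 - (norm z)\<^sup>2\<bar>" by simp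
  also have "\<dots> \<le> M * (dist y z * (norm y + norm z))" by (intro mult_left_mono norm_sq_diff_le M)
  finally show ?thesis .
qed

abbreviation cutoff_lip :: "'n::finite itself \<Rightarrow> real" where
  "cutoff_lip _ \<equiv> exp 3 * whitney_lip TYPE('n) + exp 3"

text \<open>The first summand comes from the pointwise bound of a localised piece, the second one from the
  bound for its integrals against test functions.\<close>

definition part_const :: "'n::finite itself \<Rightarrow> real" where
  "part_const _ = exp 3 * ae_const TYPE('n) + (exp 3 + 10 * cutoff_lip TYPE('n)) * (2 * 2 ^ CARD('n))"

text \<open>The first summand bounds the height of the subtracted density, the second one its
  integrals against test functions.\<close>

definition mean_const :: "'n::finite itself \<Rightarrow> real" where
  "mean_const _ = 1 / uvol TYPE('n) + 1"

lemma cutoff_lip_pos: "0 < cutoff_lip TYPE('n::finite)" by (intro add_nonneg_pos) auto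

lemma part_const_pos: "0 < part_const TYPE('n::finite)"
  unfolding part_const_def using ae_const_nonneg[where 'n='n] cutoff_lip_pos[where 'n='n]
  by (intro add_nonneg_pos mult_nonneg_nonneg mult_pos_pos add_pos_pos) auto

lemma mean_const_pos: "0 < mean_const TYPE('n::finite)"
proof -
  have "0 < uvol TYPE('n)" by simp
  then show ?thesis unfolding mean_const_def by (intro add_pos_pos divide_pos_pos) auto
qed

text \<open>The 4 is \<open>1 + 3\<close>: on the support of \<open>\<eta> i\<close> the numbers
  \<open>|y|^2\<close> and \<open>|x i|^2\<close> differ by at most 3, so the weight dominates the
  chain length \<open>1 + |x i|^2\<close>.\<close>

definition moment_weight :: "(real^'n \<Rightarrow> complex) \<Rightarrow> real^'n \<Rightarrow> real" where
  "moment_weight f y = gdens y * (norm (f y) * (4 + (norm y)\<^sup>2))"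

abbreviation local_const :: "'n::finite itself \<Rightarrow> real" where
  "local_const _ \<equiv> cz_const TYPE('n) + 4 * cz_const TYPE('n) / uvol TYPE('n)"

abbreviation maximal_const :: "'n::finite itself \<Rightarrow> real" where
  "maximal_const _ \<equiv> local_const TYPE('n) * (exp 3 * part_const TYPE('n))"

abbreviation moment_const :: "'n::finite itself \<Rightarrow> real" where
  "moment_const _ \<equiv> local_const TYPE('n) * (mean_const TYPE('n) * uvol TYPE('n) * 20 ^ CARD('n)) + chain_const TYPE('n)"

text \<open>With a hundredth of the admissible radius as \<open>\<rho>\<close>, the balls of radius
  \<open>100 * s i\<close> are exactly of maximal admissible size. As this \<open>\<rho>\<close> is
  positive everywhere, the \<open>\<eta> i\<close> form a partition of unity of the whole
  space.\<close>

locale adm_cover =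
  fixes x :: "nat \<Rightarrow> real^'n" and s :: "nat \<Rightarrow> real" and \<eta> :: "nat \<Rightarrow> real^'n \<Rightarrow> real"
  assumes W: "whitney (\<lambda>y. adm_radius y / 100) x s \<eta>"
begin

lemma rho_lip: "\<bar>adm_radius y / 100 - adm_radius z / 100\<bar> \<le> dist y z / 100" for y z :: "real^'n"
  using adm_radius_lipschitz[of y z] by linarith

lemma s_eq: "0 < s i \<Longrightarrow> 100 * s i = adm_radius (x i)"
  using whitneyD(2)[OF W, of i] by simp

text \<open>Multiplying a test function by this cutoff turns an integral of the weighted piece into
  one of \<open>f\<close> itself, which \<open>Mloc f\<close> controls. Normalising the density at
  the centre makes the bounds uniform in \<open>i\<close>.\<close>

definition cutoff :: "nat \<Rightarrow> real^'n \<Rightarrow> real" where "cutoff i y = \<eta> i y * (gdens y / gdens (x i))"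

lemma gdens_near:
  assumes "0 < s i" "dist y (x i) < 20 * s i"
  shows "gdens y \<le> exp 3 * gdens (x i)" "gdens (x i) \<le> exp 3 * gdens y"
  using gdens_admissible[of "x i" "adm_radius (x i)" y] s_eq[OF assms(1)] assms
  by (auto simp: admissible_def dist_commute)

lemma cutoff_bound: "\<bar>cutoff i y\<bar> \<le> exp 3"
proof (cases "\<eta> i y = 0")
  case False
  note e = whitney_eta_pos[OF W False]
  then have "gdens y / gdens (x i) \<le> exp 3" using gdens_near(1)[of i y] by (simp add: pos_divide_le_eq)
  then have "\<bar>\<eta> i y\<bar> * \<bar>gdens y / gdens (x i)\<bar> \<le> 1 * exp 3"
    using whitney_abs[OF W] by (intro mult_mono) auto
  then show ?thesis by (simp add: cutoff_def abs_mult)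
qed (simp add: cutoff_def)

lemma cutoff_C1: "C1 (cutoff i)"
proof -
  have "C1 (\<lambda>y. \<eta> i y * (gdens y * (1 / gdens (x i))))" by (intro C1_mult C1_gdens C1_const whitneyD(4)[OF W])
  then show ?thesis unfolding cutoff_def[abs_def] by simp
qed

text \<open>The density ratio has slope of order \<open>norm y + norm z\<close>. By admissibility
  \<open>100 * s i * norm (x i)\<close> is at most 1, so this is at most \<open>1 / s i\<close>: the
  weight varies no faster than the Whitney function up to a constant.\<close>

lemma cutoff_lipschitz_near:
  assumes s: "0 < s i" and y: "dist y (x i) < 10 * s i"
  shows "\<bar>cutoff i y - cutoff i z\<bar> \<le> cutoff_lip TYPE('n) / s i * dist y z"
proof -
  let ?L = "whitney_lip TYPE('n)" and ?g = "\<lambda>y. gdens y / gdens (x i)"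
  have gy: "gdens y \<le> exp 3 * gdens (x i)" using gdens_near(1)[OF s, of y] y s by auto
  have "cutoff i y - cutoff i z = ?g y * (\<eta> i y - \<eta> i z) + \<eta> i z * (?g y - ?g z)"
    by (simp add: cutoff_def algebra_simps)
  then have "\<bar>cutoff i y - cutoff i z\<bar> \<le> \<bar>?g y * (\<eta> i y - \<eta> i z)\<bar> + \<bar>\<eta> i z * (?g y - ?g z)\<bar>"
    by (metis abs_triangle_ineq)
  also have "\<bar>?g y * (\<eta> i y - \<eta> i z)\<bar> \<le> exp 3 * (?L / s i * dist y z)"
    unfolding abs_mult using gy whitneyD(8)[OF W s, of y z] by (intro mult_mono) (auto simp: pos_divide_le_eq)
  also have "\<bar>\<eta> i z * (?g y - ?g z)\<bar> \<le> exp 3 / s i * dist y z"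
  proof (cases "\<eta> i z = 0")
    case False
    note z = whitney_eta_pos(2)[OF W False]
    have gz: "gdens z \<le> exp 3 * gdens (x i)" using gdens_near(1)[OF s, of z] z s by auto
    have "norm y \<le> norm (x i) + 10 * s i" "norm z \<le> norm (x i) + 10 * s i"
      using y z norm_triangle_sub[of y "x i"] norm_triangle_sub[of z "x i"] unfolding dist_norm by linarith+
    then have "norm y + norm z \<le> 2 * norm (x i) + 20 * s i" by linarith
    also have "\<dots> \<le> 1 / s i"
    proof -
      have "100 * s i * norm (x i) \<le> 1" using adm_radius_mult_norm_le[of "x i"] unfolding s_eq[OF s, symmetric] .
      moreover have "100 * s i \<le> 1" using adm_radius_le_1[of "x i"] s_eq[OF s] by linarith
      then have "(100 * s i) * (100 * s i) \<le> 1" using s mult_mono[of "100 * s i" 1 "100 * s i" 1] by simp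
      ultimately have "(2 * norm (x i) + 20 * s i) * s i \<le> 1" by (simp add: algebra_simps)
      then show ?thesis using s by (simp add: pos_le_divide_eq)
    qed
    finally have nn: "norm y + norm z \<le> 1 / s i" .
    have "\<bar>\<eta> i z * (?g y - ?g z)\<bar> \<le> 1 * (exp 3 * (dist y z * (norm y + norm z)))"
      unfolding abs_mult using whitney_abs[OF W] by (intro mult_mono gdens_ratio_lipschitz[OF gy gz]) auto
    also have "\<dots> \<le> 1 * (exp 3 * (dist y z * (1 / s i)))" using nn by (intro mult_left_mono) auto
    finally show ?thesis by (simp add: mult_ac)
  qed (use s in simp)
  finally have "\<bar>cutoff i y - cutoff i z\<bar> \<le> exp 3 * (?L / s i * dist y z) + exp 3 / s i * dist y z" by simp
  also have "\<dots> = cutoff_lip TYPE('n) / s i * dist y z"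
  proof -
    have "e * (l / t * d) + e / t * d = (e * l + e) / t * d" for e l t d :: real
      by (simp add: add_divide_distrib distrib_right)
    then show ?thesis .
  qed
  finally show ?thesis .
qed

lemma cutoff_lipschitz:
  assumes s: "0 < s i"
  shows "\<bar>cutoff i y - cutoff i z\<bar> \<le> cutoff_lip TYPE('n) / s i * dist y z"
proof -
  consider "dist y (x i) < 10 * s i" | "dist z (x i) < 10 * s i" | "10 * s i \<le> dist y (x i)" "10 * s i \<le> dist z (x i)"
    by linarith
  then show ?thesis
  proof cases
    case 1 then show ?thesis by (rule cutoff_lipschitz_near[OF s])
  next
    case 2
    from cutoff_lipschitz_near[OF s 2, of y] show ?thesis by (simp only: dist_commute abs_minus_commute)
  next
    case 3
    then have "cutoff i y = 0" "cutoff i z = 0" using whitneyD(7)[OF W] by (simp_all add: cutoff_def)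
    then show ?thesis using s cutoff_lip_pos[where 'n='n] by simp
  qed
qed

definition part_mean :: "(real^'n \<Rightarrow> complex) \<Rightarrow> nat \<Rightarrow> complex" where
  "part_mean f i = (LINT y|lborel. \<eta> i y *\<^sub>R (gdens y *\<^sub>R f y))"

text \<open>The mean is subtracted in the form of \<open>nball\<close>, which coincides with
  \<open>tau (x i)\<close> here, so that exactly this density can be transported to the origin
  afterwards.\<close>

definition local_part :: "(real^'n \<Rightarrow> complex) \<Rightarrow> nat \<Rightarrow> real^'n \<Rightarrow> complex" where
  "local_part f i y = \<eta> i y *\<^sub>R (gdens y *\<^sub>R f y) - nball x s i y *\<^sub>R part_mean f i"

text \<open>A multiple of \<open>Mloc f\<close> plus a constant that pays for the subtracted mean.
  The cut at 20 radii is where a test function of scale below \<open>10 * s i\<close> ceases to meet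
  the piece.\<close>

definition local_max :: "(real^'n \<Rightarrow> complex) \<Rightarrow> nat \<Rightarrow> real^'n \<Rightarrow> ennreal" where
  "local_max f i y = indicator (ball (x i) (20 * s i)) y *
     (ennreal (part_const TYPE('n) * gdens (x i)) * Mloc f y + ennreal (mean_const TYPE('n) * norm (part_mean f i) / s i ^ CARD('n)))"

definition ball_max :: "(real^'n \<Rightarrow> complex) \<Rightarrow> nat \<Rightarrow> ennreal" where
  "ball_max f i = (\<integral>\<^sup>+y. indicator (ball (x i) (20 * s i)) y * Mloc f y \<partial>gauss)"

lemma gf_integrable: "integrable gauss f \<Longrightarrow> integrable lborel (\<lambda>y. gdens y *\<^sub>R f y)" for f :: "real^'n \<Rightarrow> complex"
  using integrable_gauss by (metis borel_measurable_integrable measurable_gauss_iff)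

text \<open>Replacing \<open>gdens (x i)\<close> by \<open>exp 3 * gdens y\<close> under the
  integral passes from Lebesgue to Gauss measure; the constant term contributes its height times the
  volume of the ball.\<close>

lemma local_max_integral:
  assumes f: "integrable gauss f" and s: "0 < s i"
  shows "(\<integral>\<^sup>+y. local_max f i y \<partial>lborel) \<le> ennreal (exp 3 * part_const TYPE('n)) * ball_max f i
     + ennreal (mean_const TYPE('n) * uvol TYPE('n) * 20 ^ CARD('n) * norm (part_mean f i))"
proof -
  note [measurable] = Mloc_measurable[OF f]
  let ?B = "ball (x i) (20 * s i)" and ?b = "mean_const TYPE('n) * norm (part_mean f i) / s i ^ CARD('n)"
  have b0: "0 \<le> ?b" using s less_imp_le[OF mean_const_pos[where 'n='n]] by simp
  have "local_max f i y \<le> ennreal (exp 3 * part_const TYPE('n)) * (ennreal (gdens y) * (indicator ?B y * Mloc f y)) + ennreal ?b * indicator ?B y" for y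
  proof (cases "y \<in> ?B")
    case True
    then have "part_const TYPE('n) * gdens (x i) \<le> part_const TYPE('n) * (exp 3 * gdens y)"
      using gdens_near(2)[OF s, of y] less_imp_le[OF part_const_pos[where 'n='n]] by (intro mult_left_mono) (auto simp: dist_commute)
    then have "ennreal (part_const TYPE('n) * gdens (x i)) \<le> ennreal ((exp 3 * part_const TYPE('n)) * gdens y)"
      by (intro ennreal_leI) (simp add: mult_ac)
    also have "\<dots> = ennreal (exp 3 * part_const TYPE('n)) * ennreal (gdens y)"
      using less_imp_le[OF part_const_pos[where 'n='n]] by (intro ennreal_mult) auto
    finally have "ennreal (part_const TYPE('n) * gdens (x i)) * Mloc f y \<le> ennreal (exp 3 * part_const TYPE('n)) * ennreal (gdens y) * Mloc f y"
      by (rule mult_right_mono) simp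
    then have "ennreal (part_const TYPE('n) * gdens (x i)) * Mloc f y + ennreal ?b \<le>
        ennreal (exp 3 * part_const TYPE('n)) * ennreal (gdens y) * Mloc f y + ennreal ?b" by (rule add_right_mono)
    then show ?thesis using True by (simp add: local_max_def mult.assoc)
  qed (simp add: local_max_def)
  then have "(\<integral>\<^sup>+y. local_max f i y \<partial>lborel) \<le> (\<integral>\<^sup>+y. ennreal (exp 3 * part_const TYPE('n)) * (ennreal (gdens y) * (indicator ?B y * Mloc f y)) + ennreal ?b * indicator ?B y \<partial>lborel)"
    by (rule nn_integral_mono)
  also have "\<dots> = (\<integral>\<^sup>+y. ennreal (exp 3 * part_const TYPE('n)) * (ennreal (gdens y) * (indicator ?B y * Mloc f y)) \<partial>lborel)
      + (\<integral>\<^sup>+y. ennreal ?b * indicator ?B y \<partial>lborel)"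
    by (rule nn_integral_add) measurable
  also have "(\<integral>\<^sup>+y. ennreal (exp 3 * part_const TYPE('n)) * (ennreal (gdens y) * (indicator ?B y * Mloc f y)) \<partial>lborel)
      = ennreal (exp 3 * part_const TYPE('n)) * (\<integral>\<^sup>+y. ennreal (gdens y) * (indicator ?B y * Mloc f y) \<partial>lborel)"
    by (rule nn_integral_cmult) measurable
  also have "(\<integral>\<^sup>+y. ennreal (gdens y) * (indicator ?B y * Mloc f y) \<partial>lborel) = ball_max f i"
    unfolding ball_max_def by (rule nn_integral_gauss[symmetric]) measurable
  also have "(\<integral>\<^sup>+y. ennreal ?b * indicator ?B y \<partial>lborel) = ennreal ?b * emeasure lborel ?B"
    by (rule nn_integral_cmult_indicator) simp
  also have "\<dots> = ennreal ?b * ennreal (uvol TYPE('n) * (20 * s i) ^ CARD('n))"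
    using s by (subst emeasure_ball_vec) auto
  also have "\<dots> = ennreal (?b * (uvol TYPE('n) * (20 * s i) ^ CARD('n)))"
    by (rule ennreal_mult[symmetric]) (use b0 s in auto)
  also have "?b * (uvol TYPE('n) * (20 * s i) ^ CARD('n)) = mean_const TYPE('n) * uvol TYPE('n) * 20 ^ CARD('n) * norm (part_mean f i)"
    using s by (simp add: power_mult_distrib)
  finally show ?thesis .
qed

lemma local_part_zero: "10 * s i \<le> dist y (x i) \<Longrightarrow> local_part f i y = 0"
  using whitneyD(7)[OF W, of i y] whitneyD(1)[OF W, of i] nball_eq_0[of y x i s]
  by (simp add: local_part_def dist_commute not_less)

text \<open>The piece has radius \<open>10 * s i\<close>, a tenth of the admissible radius, as the
  locale demands. Its two parts are estimated separately: the weighted part by absorbing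
  \<open>cutoff i\<close> into the test function, the subtracted density by its height.\<close>

lemma local_piece_local_part:
  fixes f :: "real^'n \<Rightarrow> complex"
  assumes f: "integrable gauss f" and Ifin: "ball_max f i < \<infinity>" and s: "0 < s i"
  shows "local_piece (local_part f i) (local_max f i) (x i) (10 * s i)"
proof
  let ?V = "uvol TYPE('n)"
  have V: "0 < ?V" by simp
  have si: "0 < s i ^ CARD('n)" using s by simp
  note nbi = nball_integrable[of s i x, OF whitneyD(1)[OF W]]
  have i1: "integrable lborel (\<lambda>y. \<eta> i y *\<^sub>R (gdens y *\<^sub>R f y))" by (rule whitney_integrable[OF W gf_integrable[OF f]])
  have i2: "integrable lborel (\<lambda>y. nball x s i y *\<^sub>R part_mean f i)" using nbi by simp
  show "integrable lborel (local_part f i)" unfolding local_part_def[abs_def] by (intro Bochner_Integration.integrable_diff i1 i2)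
  show "0 < 10 * s i" using s by simp
  show "10 * (10 * s i) \<le> adm_radius (x i)" using s_eq[OF s] by simp
  show "local_part f i y = 0" if "y \<notin> ball (x i) (10 * s i)" for y
    using that by (intro local_part_zero) (auto simp: dist_commute)
  have "(LINT y|lborel. local_part f i y) = part_mean f i - (LINT y|lborel. nball x s i y *\<^sub>R part_mean f i)"
    unfolding local_part_def part_mean_def by (rule Bochner_Integration.integral_diff[OF i1 i2[unfolded part_mean_def]])
  also have "(LINT y|lborel. nball x s i y *\<^sub>R part_mean f i) = part_mean f i"
    using nball_integral[of s i x] s nbi by simp
  finally show "(LINT y|lborel. local_part f i y) = 0" by simp
  have a: "0 < part_const TYPE('n) * gdens (x i)" by (intro mult_pos_pos part_const_pos gdens_pos)
  have b: "0 \<le> mean_const TYPE('n) * norm (part_mean f i) / s i ^ CARD('n)"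
    using s less_imp_le[OF mean_const_pos[where 'n='n]] by simp
  show "open {y. ennreal \<alpha> < local_max f i y}" for \<alpha>
  proof -
    have "open ({y. ennreal \<alpha> < ennreal (part_const TYPE('n) * gdens (x i)) * Mloc f y + ennreal (mean_const TYPE('n) * norm (part_mean f i) / s i ^ CARD('n))}
       \<inter> ball (x i) (20 * s i))" by (intro open_Int lsc_affine a b Mloc_lsc[OF f] open_ball)
    also have "({y. ennreal \<alpha> < ennreal (part_const TYPE('n) * gdens (x i)) * Mloc f y + ennreal (mean_const TYPE('n) * norm (part_mean f i) / s i ^ CARD('n))}
       \<inter> ball (x i) (20 * s i)) = {y. ennreal \<alpha> < local_max f i y}"
      by (auto simp: local_max_def indicator_def)
    finally show ?thesis .
  qed
  show "local_max f i y = 0" if "y \<notin> ball (x i) (2 * (10 * s i))" for y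
    using that by (simp add: local_max_def)
  have pA: "exp 3 * ae_const TYPE('n) \<le> part_const TYPE('n)" "(exp 3 + 10 * cutoff_lip TYPE('n)) * (2 * 2 ^ CARD('n)) \<le> part_const TYPE('n)"
    unfolding part_const_def using ae_const_nonneg[where 'n='n] cutoff_lip_pos[where 'n='n]
    by (auto intro!: mult_nonneg_nonneg add_nonneg_nonneg)
  have pB: "1 / ?V \<le> mean_const TYPE('n)" "1 \<le> mean_const TYPE('n)" using V by (auto simp: mean_const_def)
  show "AE y in lborel. ennreal (norm (local_part f i y)) \<le> local_max f i y"
    using AE_le_Mloc[OF f]
  proof eventually_elim
    case (elim y)
    show ?case
    proof (cases "y \<in> ball (x i) (10 * s i)")
      case True
      then have d: "dist y (x i) < 20 * s i" "y \<in> ball (x i) (20 * s i)" using s by (auto simp: dist_commute)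
      have "norm (\<eta> i y *\<^sub>R (gdens y *\<^sub>R f y)) = \<bar>\<eta> i y\<bar> * (gdens y * norm (f y))" by (simp add: abs_mult)
      also have "\<dots> \<le> 1 * (exp 3 * gdens (x i) * norm (f y))"
        using whitney_abs[OF W] gdens_near(1)[OF s d(1)] by (intro mult_mono mult_right_mono) auto
      finally have n1: "norm (\<eta> i y *\<^sub>R (gdens y *\<^sub>R f y)) \<le> exp 3 * gdens (x i) * norm (f y)" by simp
      have "norm (nball x s i y *\<^sub>R part_mean f i) \<le> 1 / (?V * s i ^ CARD('n)) * norm (part_mean f i)"
        unfolding norm_scaleR nball_def using V si by (intro mult_right_mono) (auto simp: indicator_def)
      also have "\<dots> = (1 / ?V) * (norm (part_mean f i) / s i ^ CARD('n))" by simp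
      also have "\<dots> \<le> mean_const TYPE('n) * (norm (part_mean f i) / s i ^ CARD('n))" using pB si by (intro mult_right_mono) auto
      finally have n2: "norm (nball x s i y *\<^sub>R part_mean f i) \<le> mean_const TYPE('n) * norm (part_mean f i) / s i ^ CARD('n)" by simp
      have "ennreal (norm (local_part f i y)) \<le> ennreal (exp 3 * gdens (x i) * norm (f y) + mean_const TYPE('n) * norm (part_mean f i) / s i ^ CARD('n))"
        unfolding local_part_def by (intro ennreal_leI order_trans[OF norm_triangle_ineq4] add_mono n1 n2)
      also have "\<dots> = ennreal (exp 3 * gdens (x i)) * ennreal (norm (f y)) + ennreal (mean_const TYPE('n) * norm (part_mean f i) / s i ^ CARD('n))"
        using b by (simp add: ennreal_mult less_imp_le)
      also have "\<dots> \<le> ennreal (exp 3 * gdens (x i)) * (ennreal (ae_const TYPE('n)) * Mloc f y) + ennreal (mean_const TYPE('n) * norm (part_mean f i) / s i ^ CARD('n))"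
        by (intro add_right_mono mult_left_mono elim) simp
      also have "ennreal (exp 3 * gdens (x i)) * (ennreal (ae_const TYPE('n)) * Mloc f y) = ennreal (exp 3 * ae_const TYPE('n) * gdens (x i)) * Mloc f y"
      proof -
        have "ennreal (exp 3 * ae_const TYPE('n) * gdens (x i)) = ennreal ((exp 3 * gdens (x i)) * ae_const TYPE('n))"
          by (simp only: mult_ac)
        also have "\<dots> = ennreal (exp 3 * gdens (x i)) * ennreal (ae_const TYPE('n))"
          by (rule ennreal_mult[OF _ ae_const_nonneg]) (simp add: less_imp_le)
        finally show ?thesis by (simp only: mult.assoc)
      qed
      also have "\<dots> \<le> ennreal (part_const TYPE('n) * gdens (x i)) * Mloc f y"
        by (intro mult_right_mono ennreal_leI pA) (auto simp: less_imp_le)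
      finally show ?thesis using d(2) by (simp add: local_max_def add_right_mono)
    next
      case False
      then show ?thesis using local_part_zero[of i y f] by (simp add: dist_commute)
    qed
  qed
  show "(\<integral>\<^sup>+y. local_max f i y \<partial>lborel) < \<infinity>"
    by (rule le_less_trans[OF local_max_integral[OF f s]]) (use Ifin in \<open>auto simp: ennreal_mult_less_top\<close>)
  fix z :: "real^'n" and t and \<zeta> :: "real^'n \<Rightarrow> real"
  assume t: "0 < t" "t < 10 * s i" and \<zeta>: "\<zeta> \<in> testf z t"
  have \<zeta>0: "t \<le> dist z y \<Longrightarrow> \<zeta> y = 0" and \<zeta>1: "\<bar>\<zeta> y\<bar> \<le> 1" for y using \<zeta> by (auto simp: testf_def)
  have \<zeta>m: "\<zeta> \<in> borel_measurable borel" using \<zeta> C1_measurable by (auto simp: testf_def)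
  show "ennreal (norm (LINT y|lborel. \<zeta> y *\<^sub>R local_part f i y)) \<le> ennreal (t ^ CARD('n)) * local_max f i z"
  proof (cases "z \<in> ball (x i) (20 * s i)")
    case False
    have "\<zeta> y *\<^sub>R local_part f i y = 0" for y
    proof (cases "10 * s i \<le> dist y (x i)")
      case F: False
      then have "t \<le> dist z y" using False t dist_triangle[of z "x i" y] by (auto simp: dist_commute)
      then show ?thesis using \<zeta>0 by simp
    qed (simp add: local_part_zero)
    then show ?thesis by (simp only: Bochner_Integration.integral_zero norm_zero ennreal_0 zero_le)
  next
    case True
    let ?M = "exp 3 + 10 * cutoff_lip TYPE('n)"
    have M: "0 < ?M" using cutoff_lip_pos[where 'n='n] by (intro add_pos_pos) auto
    have tf: "(\<lambda>y. \<zeta> y * cutoff i y / ?M) \<in> testf z t"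
    proof (rule testf_mult[OF \<zeta> cutoff_C1 cutoff_bound])
      show "\<bar>cutoff i y - cutoff i w\<bar> \<le> 10 * cutoff_lip TYPE('n) * dist y w / t" for y w
      proof -
        have "1 / s i \<le> 10 / t" using t s by (simp add: field_simps)
        then have "cutoff_lip TYPE('n) * dist y w * (1 / s i) \<le> cutoff_lip TYPE('n) * dist y w * (10 / t)"
          using cutoff_lip_pos[where 'n='n] by (intro mult_left_mono mult_nonneg_nonneg) auto
        with cutoff_lipschitz[OF s, of y w] show ?thesis by (simp only: times_divide_eq_right times_divide_eq_left mult.right_neutral mult_ac)
      qed
    qed (use cutoff_lip_pos[where 'n='n] t in auto)
    have "adm_radius (x i) - adm_radius z \<le> dist (x i) z" using adm_radius_lipschitz[of "x i" z] by linarith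
    \<comment> \<open>The admissible radius at \<open>z\<close> is more than
      \<open>100 * s i - 20 * s i\<close>, whereas \<open>2 * t < 20 * s i\<close>.\<close>
    then have t2: "2 * t < adm_radius z" using True t s_eq[OF s] by auto
    define I1 where "I1 = (LINT y|lborel. (\<zeta> y * cutoff i y / ?M) *\<^sub>R f y)"
    have m1: "ennreal (norm I1) \<le> ennreal (2 * (2 * t) ^ CARD('n)) * Mloc f z"
      unfolding I1_def by (rule Mloc_testf[OF t(1) t2 tf])
    have eq1: "\<zeta> y *\<^sub>R (\<eta> i y *\<^sub>R (gdens y *\<^sub>R f y)) = (?M * gdens (x i)) *\<^sub>R ((\<zeta> y * cutoff i y / ?M) *\<^sub>R f y)" for y
    proof -
      have "\<zeta> y * (\<eta> i y * gdens y) = (?M * gdens (x i)) * (\<zeta> y * cutoff i y / ?M)"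
        using M by (simp add: cutoff_def)
      then show ?thesis by (simp only: scaleR_scaleR mult.assoc)
    qed
    have j1: "(LINT y|lborel. \<zeta> y *\<^sub>R (\<eta> i y *\<^sub>R (gdens y *\<^sub>R f y))) = (?M * gdens (x i)) *\<^sub>R I1"
      unfolding eq1 I1_def by (rule integral_scaleR_right)
    define I2 where "I2 = (LINT y|lborel. \<zeta> y * nball x s i y)"
    \<comment> \<open>The test function is at most 1 on a ball of volume \<open>uvol * t^n\<close>,
      and the density is at most \<open>1 / (uvol * s i ^ n)\<close>; the unit ball volumes
      cancel.\<close>
    have I2b: "\<bar>I2\<bar> \<le> t ^ CARD('n) / s i ^ CARD('n)"
    proof -
      have "\<bar>I2\<bar> \<le> (LINT y|lborel. norm (\<zeta> y * nball x s i y))"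
        unfolding I2_def real_norm_def[symmetric] by (rule integral_norm_bound)
      also have "\<dots> \<le> (LINT y|lborel. indicator (ball z t) y * (1 / (?V * s i ^ CARD('n))))"
      proof (rule integral_mono)
        show "integrable lborel (\<lambda>y. norm (\<zeta> y * nball x s i y))"
          using integrable_bounded_scaleR[OF nbi, of \<zeta> 1] \<zeta>m \<zeta>1 by simp
        show "integrable lborel (\<lambda>y. indicator (ball z t) y * (1 / (?V * s i ^ CARD('n))))"
          using emeasure_lborel_ball_finite[of z t] by (intro integrable_mult_left) simp
        show "norm (\<zeta> y * nball x s i y) \<le> indicator (ball z t) y * (1 / (?V * s i ^ CARD('n)))" for y
        proof (cases "y \<in> ball z t")
          case True
          have "\<bar>\<zeta> y\<bar> * \<bar>nball x s i y\<bar> \<le> 1 * (1 / (?V * s i ^ CARD('n)))"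
            using \<zeta>1 V si by (intro mult_mono) (auto simp: nball_def indicator_def)
          then show ?thesis using True by (simp add: abs_mult)
        next
          case F: False
          then show ?thesis using \<zeta>0 by simp
        qed
      qed
      also have "\<dots> = (?V * t ^ CARD('n)) * (1 / (?V * s i ^ CARD('n)))"
        using t by (simp add: content_ball)
      also have "\<dots> = t ^ CARD('n) / s i ^ CARD('n)" using V by simp
      finally show ?thesis .
    qed
    have "(LINT y|lborel. \<zeta> y *\<^sub>R local_part f i y) = (LINT y|lborel. \<zeta> y *\<^sub>R (\<eta> i y *\<^sub>R (gdens y *\<^sub>R f y)) - (\<zeta> y * nball x s i y) *\<^sub>R part_mean f i)"
      by (rule Bochner_Integration.integral_cong[OF refl]) (simp add: local_part_def scaleR_diff_right)
    also have "\<dots> = (LINT y|lborel. \<zeta> y *\<^sub>R (\<eta> i y *\<^sub>R (gdens y *\<^sub>R f y))) - (LINT y|lborel. (\<zeta> y * nball x s i y) *\<^sub>R part_mean f i)"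
    proof (rule Bochner_Integration.integral_diff)
      show "integrable lborel (\<lambda>y. \<zeta> y *\<^sub>R (\<eta> i y *\<^sub>R (gdens y *\<^sub>R f y)))"
        using \<zeta>m \<zeta>1 by (intro integrable_bounded_scaleR[OF i1, of _ 1]) auto
      have "integrable lborel (\<lambda>y. \<zeta> y * nball x s i y)"
        using integrable_bounded_scaleR[OF nbi, of \<zeta> 1] \<zeta>m \<zeta>1 by simp
      then show "integrable lborel (\<lambda>y. (\<zeta> y * nball x s i y) *\<^sub>R part_mean f i)" by (rule integrable_scaleR_left)
    qed
    also have "(LINT y|lborel. (\<zeta> y * nball x s i y) *\<^sub>R part_mean f i) = I2 *\<^sub>R part_mean f i"
      unfolding I2_def using integrable_bounded_scaleR[OF nbi, of \<zeta> 1] \<zeta>m \<zeta>1 by (intro integral_scaleR_left) simp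
    finally have tot: "(LINT y|lborel. \<zeta> y *\<^sub>R local_part f i y) = (?M * gdens (x i)) *\<^sub>R I1 - I2 *\<^sub>R part_mean f i" unfolding j1 .
    have Mg: "0 \<le> ?M * gdens (x i)" using M by (intro mult_nonneg_nonneg) auto
    have "norm (LINT y|lborel. \<zeta> y *\<^sub>R local_part f i y) \<le> (?M * gdens (x i)) * norm I1 + t ^ CARD('n) * (mean_const TYPE('n) * norm (part_mean f i) / s i ^ CARD('n))"
    proof -
      have "norm (LINT y|lborel. \<zeta> y *\<^sub>R local_part f i y) \<le> norm ((?M * gdens (x i)) *\<^sub>R I1) + norm (I2 *\<^sub>R part_mean f i)"
        unfolding tot by (rule norm_triangle_ineq4)
      also have "norm ((?M * gdens (x i)) *\<^sub>R I1) = (?M * gdens (x i)) * norm I1"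
        unfolding norm_scaleR abs_of_nonneg[OF Mg] ..
      also have "norm (I2 *\<^sub>R part_mean f i) \<le> t ^ CARD('n) * (mean_const TYPE('n) * norm (part_mean f i) / s i ^ CARD('n))"
      proof -
        have "norm (I2 *\<^sub>R part_mean f i) \<le> (t ^ CARD('n) / s i ^ CARD('n)) * (mean_const TYPE('n) * norm (part_mean f i))"
          unfolding norm_scaleR
        proof (intro mult_mono I2b)
          show "norm (part_mean f i) \<le> mean_const TYPE('n) * norm (part_mean f i)" using mult_right_mono[OF pB(2), of "norm (part_mean f i)"] by simp
        qed (use t s in auto)
        then show ?thesis by simp
      qed
      finally show ?thesis by simp
    qed
    then have "ennreal (norm (LINT y|lborel. \<zeta> y *\<^sub>R local_part f i y)) \<le>
        ennreal ((?M * gdens (x i)) * norm I1 + t ^ CARD('n) * (mean_const TYPE('n) * norm (part_mean f i) / s i ^ CARD('n)))"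
      by (rule ennreal_leI)
    also have "\<dots> = ennreal (?M * gdens (x i)) * ennreal (norm I1) + ennreal (t ^ CARD('n)) * ennreal (mean_const TYPE('n) * norm (part_mean f i) / s i ^ CARD('n))"
      using Mg b t by (subst ennreal_plus) (auto simp: ennreal_mult'[symmetric] ennreal_mult''[symmetric] simp del: times_divide_eq_right)
    also have "\<dots> \<le> ennreal (?M * gdens (x i)) * (ennreal (2 * (2 * t) ^ CARD('n)) * Mloc f z) + ennreal (t ^ CARD('n)) * ennreal (mean_const TYPE('n) * norm (part_mean f i) / s i ^ CARD('n))"
      by (intro add_right_mono mult_left_mono m1) simp
    also have "ennreal (?M * gdens (x i)) * (ennreal (2 * (2 * t) ^ CARD('n)) * Mloc f z) = ennreal (t ^ CARD('n)) * (ennreal ((?M * (2 * 2 ^ CARD('n))) * gdens (x i)) * Mloc f z)"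
    proof -
      have "ennreal (?M * gdens (x i)) * ennreal (2 * (2 * t) ^ CARD('n)) = ennreal ((?M * gdens (x i)) * (2 * (2 * t) ^ CARD('n)))"
        using Mg t by (intro ennreal_mult[symmetric]) auto
      also have "(?M * gdens (x i)) * (2 * (2 * t) ^ CARD('n)) = t ^ CARD('n) * ((?M * (2 * 2 ^ CARD('n))) * gdens (x i))"
        unfolding power_mult_distrib by (simp only: mult_ac)
      also have "ennreal (t ^ CARD('n) * ((?M * (2 * 2 ^ CARD('n))) * gdens (x i))) = ennreal (t ^ CARD('n)) * ennreal ((?M * (2 * 2 ^ CARD('n))) * gdens (x i))"
        using t M by (intro ennreal_mult mult_nonneg_nonneg) auto
      finally show ?thesis by (simp only: mult.assoc[symmetric])
    qed
    also have "\<dots> \<le> ennreal (t ^ CARD('n)) * (ennreal (part_const TYPE('n) * gdens (x i)) * Mloc f z)"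
      by (intro mult_left_mono mult_right_mono ennreal_leI pA) auto
    finally show ?thesis using True by (simp add: local_max_def distrib_left add_right_mono)
  qed
qed

lemma local_const_nonneg: "0 \<le> local_const TYPE('n)"
proof -
  have "0 < uvol TYPE('n)" by simp
  then show ?thesis using less_imp_le[OF cz_const_pos[where 'n='n]]
    by (intro add_nonneg_nonneg divide_nonneg_nonneg mult_nonneg_nonneg) auto
qed

text \<open>Since \<open>local_max\<close> dominates the piece almost everywhere, both terms in
  \<open>dec_local\<close> are bounded by the integral of \<open>local_max\<close>.\<close>

lemma dec_local_part:
  fixes f :: "real^'n \<Rightarrow> complex"
  assumes f: "integrable gauss f" and Ifin: "ball_max f i < \<infinity>" and s: "0 < s i"
  shows "dec (\<lambda>y. local_part f i y / of_real (gdens y))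
     (local_const TYPE('n) * (exp 3 * part_const TYPE('n) * enn2real (ball_max f i) + mean_const TYPE('n) * uvol TYPE('n) * 20 ^ CARD('n) * norm (part_mean f i)))"
proof -
  interpret P: local_piece "local_part f i" "local_max f i" "x i" "10 * s i" by (rule local_piece_local_part[OF f Ifin s])
  let ?N = "enn2real (\<integral>\<^sup>+y. local_max f i y \<partial>lborel)"
  let ?b = "exp 3 * part_const TYPE('n) * enn2real (ball_max f i) + mean_const TYPE('n) * uvol TYPE('n) * 20 ^ CARD('n) * norm (part_mean f i)"
  have b0: "0 \<le> exp 3 * part_const TYPE('n)" "0 \<le> mean_const TYPE('n) * uvol TYPE('n) * 20 ^ CARD('n) * norm (part_mean f i)"
    using less_imp_le[OF part_const_pos[where 'n='n]] less_imp_le[OF mean_const_pos[where 'n='n]] by auto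
  have "(LINT y|lborel. norm (local_part f i y)) = enn2real (\<integral>\<^sup>+y. ennreal (norm (local_part f i y)) \<partial>lborel)"
    by (rule integral_eq_nn_integral) auto
  also have "\<dots> \<le> ?N" using P.N_fin P.h_le by (intro enn2real_mono nn_integral_mono_AE) auto
  finally have h1: "(LINT y|lborel. norm (local_part f i y)) \<le> ?N" .
  have N: "?N \<le> ?b"
  proof (rule enn2real_leI)
    have "(\<integral>\<^sup>+y. local_max f i y \<partial>lborel) \<le> ennreal (exp 3 * part_const TYPE('n)) * ball_max f i
     + ennreal (mean_const TYPE('n) * uvol TYPE('n) * 20 ^ CARD('n) * norm (part_mean f i))" by (rule local_max_integral[OF f s])
    also have "ball_max f i = ennreal (enn2real (ball_max f i))" using Ifin by (simp add: ennreal_enn2real_if)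
    also have "ennreal (exp 3 * part_const TYPE('n)) * \<dots> = ennreal (exp 3 * part_const TYPE('n) * enn2real (ball_max f i))"
      using b0 by (intro ennreal_mult[symmetric]) auto
    also have "\<dots> + ennreal (mean_const TYPE('n) * uvol TYPE('n) * 20 ^ CARD('n) * norm (part_mean f i)) = ennreal ?b"
      by (rule ennreal_plus[symmetric, OF mult_nonneg_nonneg[OF b0(1) enn2real_nonneg] b0(2)])
    finally show "(\<integral>\<^sup>+y. local_max f i y \<partial>lborel) \<le> ennreal ?b" .
  qed (rule add_nonneg_nonneg[OF mult_nonneg_nonneg[OF b0(1) enn2real_nonneg] b0(2)])
  have V: "0 < uvol TYPE('n)" by simp
  have "cz_const TYPE('n) * (LINT y|lborel. norm (local_part f i y)) + 4 * cz_const TYPE('n) / uvol TYPE('n) * ?N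
     \<le> cz_const TYPE('n) * ?N + 4 * cz_const TYPE('n) / uvol TYPE('n) * ?N"
    using h1 less_imp_le[OF cz_const_pos[where 'n='n]] by (intro add_right_mono mult_left_mono) auto
  also have "\<dots> = local_const TYPE('n) * ?N" by (simp only: distrib_right)
  also have "\<dots> \<le> local_const TYPE('n) * ?b" by (rule mult_left_mono[OF N local_const_nonneg])
  finally show ?thesis by (rule dec_mono[OF P.dec_local])
qed

text \<open>The Whitney piece of \<open>f\<close> after its mean has been moved all the way to the
  origin; division by the density returns from Lebesgue to Gauss normalisation.\<close>

definition centered_part :: "(real^'n \<Rightarrow> complex) \<Rightarrow> nat \<Rightarrow> real^'n \<Rightarrow> complex" where
  "centered_part f i y = \<eta> i y *\<^sub>R f y - part_mean f i * (of_real (tau 0 y) / of_real (gdens y))"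

lemma part_mean_zero: "s i = 0 \<Longrightarrow> part_mean f i = 0"
  by (simp add: part_mean_def whitney_zero[OF W])

lemma part_mean_le:
  fixes f :: "real^'n \<Rightarrow> complex"
  assumes f: "integrable gauss f" and w: "integrable lborel (moment_weight f)"
  shows "norm (part_mean f i) * (1 + (norm (x i))\<^sup>2) \<le> (LINT y|lborel. \<eta> i y *\<^sub>R moment_weight f y)"
proof -
  have i1: "integrable lborel (\<lambda>y. \<eta> i y *\<^sub>R (gdens y *\<^sub>R f y))" by (rule whitney_integrable[OF W gf_integrable[OF f]])
  have "norm (part_mean f i) \<le> (LINT y|lborel. norm (\<eta> i y *\<^sub>R (gdens y *\<^sub>R f y)))"
    unfolding part_mean_def by (rule integral_norm_bound)
  then have "norm (part_mean f i) * (1 + (norm (x i))\<^sup>2) \<le> (LINT y|lborel. norm (\<eta> i y *\<^sub>R (gdens y *\<^sub>R f y))) * (1 + (norm (x i))\<^sup>2)"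
    by (rule mult_right_mono) simp
  also have "\<dots> = (LINT y|lborel. norm (\<eta> i y *\<^sub>R (gdens y *\<^sub>R f y)) * (1 + (norm (x i))\<^sup>2))"
    by (rule integral_mult_left_zero[symmetric])
  also have "\<dots> \<le> (LINT y|lborel. \<eta> i y *\<^sub>R moment_weight f y)"
  proof (rule integral_mono)
    show "integrable lborel (\<lambda>y. norm (\<eta> i y *\<^sub>R (gdens y *\<^sub>R f y)) * (1 + (norm (x i))\<^sup>2))"
      using i1 by (intro integrable_mult_left integrable_norm)
    show "integrable lborel (\<lambda>y. \<eta> i y *\<^sub>R moment_weight f y)" by (rule whitney_integrable[OF W w])
    fix y
    show "norm (\<eta> i y *\<^sub>R (gdens y *\<^sub>R f y)) * (1 + (norm (x i))\<^sup>2) \<le> \<eta> i y *\<^sub>R moment_weight f y"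
    proof (cases "\<eta> i y = 0")
      case False
      note e = whitney_eta_pos[OF W False]
      have "\<bar>(norm y)\<^sup>2 - (norm (x i))\<^sup>2\<bar> \<le> 2 * 1 + 1\<^sup>2"
        using e s_eq[OF e(1)] by (intro norm_sq_diff_adm) auto
      then have "1 + (norm (x i))\<^sup>2 \<le> 4 + (norm y)\<^sup>2" unfolding abs_le_iff by simp
      then have "(\<eta> i y * (gdens y * norm (f y))) * (1 + (norm (x i))\<^sup>2) \<le> (\<eta> i y * (gdens y * norm (f y))) * (4 + (norm y)\<^sup>2)"
        using whitneyD(5)[OF W] by (intro mult_left_mono) auto
      then show ?thesis using whitneyD(5)[OF W, of i y] by (simp add: moment_weight_def mult_ac abs_mult)
    qed simp
  qed
  finally show ?thesis .
qed

lemma maximal_const_nonneg: "0 \<le> maximal_const TYPE('n)" and moment_const_nonneg: "0 \<le> moment_const TYPE('n)"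
  using local_const_nonneg less_imp_le[OF part_const_pos[where 'n='n]] less_imp_le[OF mean_const_pos[where 'n='n]]
  by (auto intro!: mult_nonneg_nonneg add_nonneg_nonneg)

text \<open>Adds the decomposition of the piece and the chain from \<open>x i\<close> to the origin,
  weighted by the mean. The chain costs a multiple of \<open>1 + |x i|^2\<close>, which
  \<open>part_mean_le\<close> turns into an integral of \<open>moment_weight\<close>.\<close>

lemma dec_centered_part:
  fixes f :: "real^'n \<Rightarrow> complex"
  assumes f: "integrable gauss f" and Ifin: "ball_max f i < \<infinity>" and w: "integrable lborel (moment_weight f)"
  shows "dec (centered_part f i) (maximal_const TYPE('n) * enn2real (ball_max f i) + moment_const TYPE('n) * (LINT y|lborel. \<eta> i y *\<^sub>R moment_weight f y))"
proof (cases "s i = 0")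
  case True
  have "centered_part f i = (\<lambda>_. 0)" using part_mean_zero[OF True] whitney_zero[OF W True] by (simp add: centered_part_def[abs_def])
  moreover have "0 \<le> (LINT y|lborel. \<eta> i y *\<^sub>R moment_weight f y)"
    using whitney_zero[OF W True] by simp
  ultimately show ?thesis
    by (simp only:) (rule dec_mono[OF dec_zero], intro add_nonneg_nonneg mult_nonneg_nonneg maximal_const_nonneg moment_const_nonneg; simp)
next
  case False
  then have s: "0 < s i" using whitneyD(1)[OF W, of i] by simp
  let ?m = "norm (part_mean f i)" and ?T = "LINT y|lborel. \<eta> i y *\<^sub>R moment_weight f y"
  note d = dec_add[OF dec_local_part[OF f Ifin s] dec_cmult[OF dec_tau[of "x i"], of "part_mean f i"]]
  have nb: "nball x s i = tau (x i)" by (rule tau_nball) (use s_eq[OF s] in simp)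
  have eq: "(\<lambda>y. local_part f i y / of_real (gdens y) + part_mean f i * (of_real (tau (x i) y - tau 0 y) / of_real (gdens y))) = centered_part f i"
  proof
    fix y :: "real^'n"
    have g: "complex_of_real (gdens y) \<noteq> 0" by simp
    show "local_part f i y / of_real (gdens y) + part_mean f i * (of_real (tau (x i) y - tau 0 y) / of_real (gdens y)) = centered_part f i y"
      unfolding local_part_def centered_part_def nb scaleR_conv_of_real using g by (simp add: field_simps)
  qed
  have T: "?m * (1 + (norm (x i))\<^sup>2) \<le> ?T" by (rule part_mean_le[OF f w])
  have "?m \<le> ?m * (1 + (norm (x i))\<^sup>2)" by (simp add: mult_le_cancel_left1)
  with T have mT: "?m \<le> ?T" by linarith
  have "local_const TYPE('n) * (exp 3 * part_const TYPE('n) * enn2real (ball_max f i) + mean_const TYPE('n) * uvol TYPE('n) * 20 ^ CARD('n) * ?m)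
      + ?m * (chain_const TYPE('n) * (1 + (norm (x i))\<^sup>2))
     = maximal_const TYPE('n) * enn2real (ball_max f i) + local_const TYPE('n) * (mean_const TYPE('n) * uvol TYPE('n) * 20 ^ CARD('n)) * ?m + chain_const TYPE('n) * (?m * (1 + (norm (x i))\<^sup>2))"
  proof -
    have "D * (a * I + p * m) + m * (t * q) = D * a * I + D * p * m + t * (m * q)" for D a I p m t q :: real
      by (simp add: algebra_simps)
    then show ?thesis .
  qed
  also have "\<dots> \<le> maximal_const TYPE('n) * enn2real (ball_max f i) + local_const TYPE('n) * (mean_const TYPE('n) * uvol TYPE('n) * 20 ^ CARD('n)) * ?T + chain_const TYPE('n) * ?T"
    using T mT local_const_nonneg less_imp_le[OF mean_const_pos[where 'n='n]] by (intro add_mono mult_left_mono order_refl mult_nonneg_nonneg) auto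
  also have "\<dots> = maximal_const TYPE('n) * enn2real (ball_max f i) + moment_const TYPE('n) * ?T" by (simp only: distrib_right add.assoc)
  finally show ?thesis using d unfolding eq by (rule dec_mono[rotated])
qed

text \<open>At most \<open>overlap\<close> of the balls with 20 radii contain a given point, so the
  local integrals add up to a multiple of the global one.\<close>

lemma ball_max_sum:
  fixes f :: "real^'n \<Rightarrow> complex"
  assumes f: "integrable gauss f" and M: "(\<integral>\<^sup>+y. Mloc f y \<partial>gauss) < \<infinity>"
  shows "ball_max f i < \<infinity>" "summable (\<lambda>i. enn2real (ball_max f i))"
    "(\<Sum>i. enn2real (ball_max f i)) \<le> overlap TYPE('n) * enn2real (\<integral>\<^sup>+y. Mloc f y \<partial>gauss)"
proof -
  note [measurable] = Mloc_measurable[OF f]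
  let ?J = "\<integral>\<^sup>+y. Mloc f y \<partial>gauss"
  have "ball_max f i \<le> ?J" for i
    unfolding ball_max_def by (intro nn_integral_mono) (auto simp: indicator_def)
  then show fin: "ball_max f i < \<infinity>" for i using M by (rule le_less_trans)
  then have e: "ball_max f i = ennreal (enn2real (ball_max f i))" for i by (simp add: ennreal_enn2real_if less_top[symmetric])
  have "(\<Sum>i. ball_max f i) = (\<integral>\<^sup>+y. (\<Sum>i. indicator (ball (x i) (20 * s i)) y * Mloc f y) \<partial>gauss)"
    unfolding ball_max_def by (rule nn_integral_suminf[symmetric]) measurable
  also have "\<dots> \<le> (\<integral>\<^sup>+y. ennreal (overlap TYPE('n)) * Mloc f y \<partial>gauss)"
  proof (rule nn_integral_mono)
    fix y
    let ?S = "{i. dist y (x i) < 20 * s i}"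
    note o = whitney_overlap[OF W rho_lip, of y]
    have "(\<Sum>i. indicator (ball (x i) (20 * s i)) y * Mloc f y) = (\<Sum>i\<in>?S. indicator (ball (x i) (20 * s i)) y * Mloc f y)"
      by (rule suminf_finite[OF o(1)]) (auto simp: dist_commute)
    also have "\<dots> = (\<Sum>i\<in>?S. Mloc f y)" by (rule sum.cong) (auto simp: dist_commute)
    also have "\<dots> = of_nat (card ?S) * Mloc f y" by simp
    also have "\<dots> \<le> ennreal (overlap TYPE('n)) * Mloc f y"
    proof (rule mult_right_mono)
      show "of_nat (card ?S) \<le> ennreal (overlap TYPE('n))"
        using ennreal_leI[OF o(2)] by (simp only: ennreal_of_nat_eq_real_of_nat)
    qed simp
    finally show "(\<Sum>i. indicator (ball (x i) (20 * s i)) y * Mloc f y) \<le> ennreal (overlap TYPE('n)) * Mloc f y" .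
  qed
  also have "\<dots> = ennreal (overlap TYPE('n)) * ?J" by (rule nn_integral_cmult) measurable
  also have "?J = ennreal (enn2real ?J)" using M by (simp add: ennreal_enn2real_if)
  also have "ennreal (overlap TYPE('n)) * ennreal (enn2real ?J) = ennreal (overlap TYPE('n) * enn2real ?J)"
    by (rule ennreal_mult[symmetric]) auto
  finally have le: "(\<Sum>i. ennreal (enn2real (ball_max f i))) \<le> ennreal (overlap TYPE('n) * enn2real ?J)"
    unfolding e[symmetric] .
  have nn: "0 \<le> enn2real (ball_max f i)" for i by simp
  show sm: "summable (\<lambda>i. enn2real (ball_max f i))"
    by (rule summable_suminf_not_top[OF nn neq_top_trans[OF ennreal_neq_top le]])
  from le show "(\<Sum>i. enn2real (ball_max f i)) \<le> overlap TYPE('n) * enn2real ?J"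
    unfolding suminf_ennreal2[OF nn sm] by (subst (asm) ennreal_le_iff) simp_all
qed

text \<open>The means of the pieces add up to the Gauss integral of \<open>f\<close>, so all
  transported densities collect into a single multiple of \<open>tau 0\<close>.\<close>

lemma dec_centered_weight:
  fixes f :: "real^'n \<Rightarrow> complex"
  assumes f: "integrable gauss f" and M: "(\<integral>\<^sup>+y. Mloc f y \<partial>gauss) < \<infinity>" and w: "integrable lborel (moment_weight f)"
  shows "dec (\<lambda>y. f y - (LINT y|gauss. f y) * (of_real (tau 0 y) / of_real (gdens y)))
     (maximal_const TYPE('n) * (overlap TYPE('n) * enn2real (\<integral>\<^sup>+y. Mloc f y \<partial>gauss)) + moment_const TYPE('n) * (LINT y|lborel. moment_weight f y))"
proof -
  have fm: "f \<in> borel_measurable borel" using f by (auto dest: borel_measurable_integrable)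
  have pos: "{y::real^'n. 0 < adm_radius y / 100} = UNIV" by simp
  note I = ball_max_sum[OF f M]
  have ws: "(\<lambda>i. LINT y|lborel. \<eta> i y *\<^sub>R moment_weight f y) sums (LINT y|lborel. moment_weight f y)"
    using whitney_sums_integral[OF W w] unfolding pos by simp
  have ms: "(\<lambda>i. part_mean f i) sums (LINT y|gauss. f y)"
    using whitney_sums_integral[OF W gf_integrable[OF f]] unfolding pos part_mean_def integral_gauss[OF fm] by simp
  have s: "(\<lambda>i. maximal_const TYPE('n) * enn2real (ball_max f i) + moment_const TYPE('n) * (LINT y|lborel. \<eta> i y *\<^sub>R moment_weight f y)) sums
     (maximal_const TYPE('n) * (\<Sum>i. enn2real (ball_max f i)) + moment_const TYPE('n) * (LINT y|lborel. moment_weight f y))"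
    by (intro sums_add sums_mult summable_sums I ws)
  have "dec (\<lambda>y. f y - (LINT y|gauss. f y) * (of_real (tau 0 y) / of_real (gdens y)))
     (\<Sum>i. maximal_const TYPE('n) * enn2real (ball_max f i) + moment_const TYPE('n) * (LINT y|lborel. \<eta> i y *\<^sub>R moment_weight f y))"
  proof (rule dec_sums[OF dec_centered_part[OF f I(1) w] sums_summable[OF s]], rule AE_I2)
    fix y
    have "(\<lambda>i. \<eta> i y) sums 1" using whitneyD(9)[OF W, of y] by simp
    from sums_diff[OF sums_scaleR_left[OF this, of "f y"] sums_mult2[OF ms, of "of_real (tau 0 y) / of_real (gdens y)"]]
    show "(\<lambda>i. centered_part f i y) sums (f y - (LINT y|gauss. f y) * (of_real (tau 0 y) / of_real (gdens y)))"
      unfolding centered_part_def by (simp only: scaleR_one)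
  qed
  moreover have "(\<Sum>i. maximal_const TYPE('n) * enn2real (ball_max f i) + moment_const TYPE('n) * (LINT y|lborel. \<eta> i y *\<^sub>R moment_weight f y)) \<le>
      maximal_const TYPE('n) * (overlap TYPE('n) * enn2real (\<integral>\<^sup>+y. Mloc f y \<partial>gauss)) + moment_const TYPE('n) * (LINT y|lborel. moment_weight f y)"
    unfolding sums_unique[OF s, symmetric] by (intro add_right_mono mult_left_mono I maximal_const_nonneg)
  ultimately show ?thesis by (rule dec_mono)
qed

end

subsection \<open>The two implications\<close>

lemma nn_integral_le_Mloc:
  fixes f :: "real^'n \<Rightarrow> complex"
  assumes f: "integrable gauss f"
  shows "(\<integral>\<^sup>+y. ennreal (norm (f y)) \<partial>gauss) \<le> ennreal (ae_const TYPE('n)) * (\<integral>\<^sup>+y. Mloc f y \<partial>gauss)"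
proof -
  have "(\<integral>\<^sup>+y. ennreal (norm (f y)) \<partial>gauss) \<le> (\<integral>\<^sup>+y. ennreal (ae_const TYPE('n)) * Mloc f y \<partial>gauss)"
    by (rule nn_integral_mono_AE) (simp only: AE_gauss AE_le_Mloc[OF f])
  also have "\<dots> = ennreal (ae_const TYPE('n)) * (\<integral>\<^sup>+y. Mloc f y \<partial>gauss)"
    by (rule nn_integral_cmult) (simp add: Mloc_measurable[OF f])
  finally show ?thesis .
qed

text \<open>The constant part of the weight is controlled by \<open>Mloc f\<close> through the
  almost everywhere bound, so only the quadratic part has to be charged to
  \<open>E_plus f\<close>.\<close>

lemma moment_weight_integral:
  fixes f :: "real^'n \<Rightarrow> complex"
  assumes f: "integrable gauss f" and M: "(\<integral>\<^sup>+y. Mloc f y \<partial>gauss) < \<infinity>" and E: "E_plus f < \<infinity>"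
  shows "integrable lborel (moment_weight f)"
    "(LINT y|lborel. moment_weight f y) \<le> 4 * (ae_const TYPE('n) * enn2real (\<integral>\<^sup>+y. Mloc f y \<partial>gauss)) + enn2real (E_plus f)"
proof -
  let ?J = "\<integral>\<^sup>+y. Mloc f y \<partial>gauss" and ?b = "4 * (ae_const TYPE('n) * enn2real (\<integral>\<^sup>+y. Mloc f y \<partial>gauss)) + enn2real (E_plus f)"
  have [measurable]: "f \<in> borel_measurable borel" using f by (auto dest: borel_measurable_integrable)
  have m: "moment_weight f \<in> borel_measurable borel" unfolding moment_weight_def[abs_def] by measurable
  have "(\<integral>\<^sup>+y. ennreal (moment_weight f y) \<partial>lborel) = (\<integral>\<^sup>+y. ennreal (gdens y) * (4 * ennreal (norm (f y)) + ennreal ((norm y)\<^sup>2 * norm (f y))) \<partial>lborel)"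
  proof (rule nn_integral_cong)
    fix y
    have "ennreal (moment_weight f y) = ennreal (gdens y) * ennreal (norm (f y) * (4 + (norm y)\<^sup>2))"
      unfolding moment_weight_def by (rule ennreal_mult) auto
    also have "norm (f y) * (4 + (norm y)\<^sup>2) = 4 * norm (f y) + (norm y)\<^sup>2 * norm (f y)" by (simp add: algebra_simps)
    also have "ennreal \<dots> = 4 * ennreal (norm (f y)) + ennreal ((norm y)\<^sup>2 * norm (f y))"
      by (subst ennreal_plus) (auto simp: ennreal_mult)
    finally show "ennreal (moment_weight f y) = ennreal (gdens y) * (4 * ennreal (norm (f y)) + ennreal ((norm y)\<^sup>2 * norm (f y)))" .
  qed
  also have "\<dots> = (\<integral>\<^sup>+y. 4 * ennreal (norm (f y)) + ennreal ((norm y)\<^sup>2 * norm (f y)) \<partial>gauss)"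
    by (rule nn_integral_gauss[symmetric]) measurable
  also have "\<dots> = (\<integral>\<^sup>+y. 4 * ennreal (norm (f y)) \<partial>gauss) + E_plus f"
    unfolding E_plus_def by (rule nn_integral_add) measurable
  also have "(\<integral>\<^sup>+y. 4 * ennreal (norm (f y)) \<partial>gauss) = 4 * (\<integral>\<^sup>+y. ennreal (norm (f y)) \<partial>gauss)"
    by (rule nn_integral_cmult) measurable
  also have "4 * (\<integral>\<^sup>+y. ennreal (norm (f y)) \<partial>gauss) + E_plus f \<le> 4 * (ennreal (ae_const TYPE('n)) * ?J) + E_plus f"
    by (intro add_right_mono mult_left_mono nn_integral_le_Mloc[OF f]) simp
  also have "\<dots> = ennreal ?b"
  proof -
    have J: "?J = ennreal (enn2real ?J)" using M by (simp add: ennreal_enn2real_if)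
    have E': "E_plus f = ennreal (enn2real (E_plus f))" using E by (simp add: ennreal_enn2real_if)
    have "4 * (ennreal (ae_const TYPE('n)) * ?J) = ennreal 4 * (ennreal (ae_const TYPE('n)) * ennreal (enn2real ?J))"
      by (subst J) simp
    also have "\<dots> = ennreal (4 * (ae_const TYPE('n) * enn2real ?J))"
      using ennreal_mult[OF ae_const_nonneg[where 'n='n] enn2real_nonneg[of ?J]]
        ennreal_mult[of 4 "ae_const TYPE('n) * enn2real ?J"] mult_nonneg_nonneg[OF ae_const_nonneg[where 'n='n] enn2real_nonneg[of ?J]]
      by (simp only: zero_le_numeral)
    finally have "4 * (ennreal (ae_const TYPE('n)) * ?J) + E_plus f = ennreal (4 * (ae_const TYPE('n) * enn2real ?J)) + ennreal (enn2real (E_plus f))"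
      using E' by (simp only:)
    also have "\<dots> = ennreal ?b"
      by (rule ennreal_plus[symmetric, OF mult_nonneg_nonneg[OF zero_le_numeral
          mult_nonneg_nonneg[OF ae_const_nonneg enn2real_nonneg]] enn2real_nonneg])
    finally show ?thesis .
  qed
  finally have le: "(\<integral>\<^sup>+y. ennreal (moment_weight f y) \<partial>lborel) \<le> ennreal ?b" .
  have nn: "0 \<le> moment_weight f y" for y by (simp add: moment_weight_def)
  have b0: "0 \<le> ?b" by (intro add_nonneg_nonneg mult_nonneg_nonneg ae_const_nonneg enn2real_nonneg) simp
  show "integrable lborel (moment_weight f)"
    using le m nn by (intro integrableI_bounded) (auto intro: le_less_trans)
  have "(LINT y|lborel. moment_weight f y) = enn2real (\<integral>\<^sup>+y. ennreal (moment_weight f y) \<partial>lborel)"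
    using m nn by (intro integral_eq_nn_integral) auto
  also have "\<dots> \<le> ?b" by (rule enn2real_leI[OF b0 le])
  finally show "(LINT y|lborel. moment_weight f y) \<le> ?b" .
qed

definition centered_const :: "'n::finite itself \<Rightarrow> real" where
  "centered_const _ = maximal_const TYPE('n) * overlap TYPE('n) + moment_const TYPE('n) * (4 * ae_const TYPE('n)) + moment_const TYPE('n)"

lemma dec_centered:
  fixes f :: "real^'n \<Rightarrow> complex"
  assumes f: "integrable gauss f" and M: "(\<integral>\<^sup>+y. Mloc f y \<partial>gauss) < \<infinity>" and E: "E_plus f < \<infinity>"
  shows "0 \<le> centered_const TYPE('n)"
    "dec (\<lambda>y. f y - (LINT y|gauss. f y) * (of_real (tau 0 y) / of_real (gdens y)))
     (centered_const TYPE('n) * (enn2real (\<integral>\<^sup>+y. Mloc f y \<partial>gauss) + enn2real (E_plus f)))"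
proof -
  have lip: "\<bar>adm_radius y / 100 - adm_radius z / 100\<bar> \<le> dist y z / 100" for y z :: "real^'n"
    using adm_radius_lipschitz[of y z] by linarith
  have bd: "adm_radius y / 100 \<le> 1 / 100" for y :: "real^'n" using adm_radius_le_1[of y] by simp
  obtain x s \<eta> where "whitney (\<lambda>y::real^'n. adm_radius y / 100) x s \<eta>" using whitney_exists[OF lip bd] by blast
  then interpret adm_cover x s \<eta> by unfold_locales
  let ?J = "enn2real (\<integral>\<^sup>+y. Mloc f y \<partial>gauss)" and ?E = "enn2real (E_plus f)"
  define d where "d = maximal_const TYPE('n)"
  define e where "e = moment_const TYPE('n)"
  define a where "a = ae_const TYPE('n)"
  define o' where "o' = overlap TYPE('n)"
  have nn: "0 \<le> d" "0 \<le> e" "0 \<le> a" "0 \<le> o'"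
    using maximal_const_nonneg moment_const_nonneg ae_const_nonneg[where 'n='n] by (auto simp: d_def e_def a_def o'_def)
  have centered_const: "centered_const TYPE('n) = d * o' + e * (4 * a) + e" by (simp only: centered_const_def d_def e_def a_def o'_def)
  show "0 \<le> centered_const TYPE('n)" unfolding centered_const using nn by simp
  have "d * (o' * ?J) + e * (LINT y|lborel. moment_weight f y) \<le> d * (o' * ?J) + e * (4 * (a * ?J) + ?E)"
    using moment_weight_integral(2)[OF f M E] nn unfolding a_def by (intro add_left_mono mult_left_mono) auto
  also have "\<dots> \<le> centered_const TYPE('n) * (?J + ?E)"
  proof -
    have "0 \<le> d * o' * ?E" "0 \<le> e * (4 * a) * ?E" "0 \<le> e * ?J" using nn by auto
    then show ?thesis unfolding centered_const by (simp add: algebra_simps)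
  qed
  finally show "dec (\<lambda>y. f y - (LINT y|gauss. f y) * (of_real (tau 0 y) / of_real (gdens y)))
     (centered_const TYPE('n) * (?J + ?E))"
    using dec_centered_weight[OF f M moment_weight_integral(1)[OF f M E]] unfolding d_def e_def o'_def by (rule dec_mono[rotated])
qed

text \<open>A dilated test function is at most \<open>t^(-n)\<close> and lives on a ball of volume
  \<open>uvol * t^n\<close>.\<close>

lemma Mloc_le_const:
  fixes f :: "real^'n \<Rightarrow> complex"
  assumes f: "integrable gauss f" and b: "AE y in lborel. norm (f y) \<le> b"
  shows "Mloc f x \<le> ennreal (b * uvol TYPE('n))"
  unfolding Mloc_def
proof (intro SUP_least ennreal_leI)
  fix \<phi> :: "real^'n \<Rightarrow> complex" and t assume \<phi>: "\<phi> \<in> test_functions" and "t \<in> {0<..<adm_radius x}"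
  then have t: "0 < t" by simp
  let ?V = "uvol TYPE('n)"
  have int: "integrable lborel (\<lambda>y. indicator (ball x t) y * (b / t ^ CARD('n)))"
    using emeasure_lborel_ball_finite[of x t] by (intro integrable_mult_left) simp
  have "norm (convol (dilate t \<phi>) f x) \<le> (LINT y|lborel. norm (dilate t \<phi> (x - y) * f y))"
    unfolding convol_def by (rule integral_norm_bound)
  also have "\<dots> \<le> (LINT y|lborel. indicator (ball x t) y * (b / t ^ CARD('n)))"
  proof (rule integral_mono_AE[OF integrable_norm[OF convol_integrable[OF f \<phi> t]] int])
    show "AE y in lborel. norm (dilate t \<phi> (x - y) * f y) \<le> indicator (ball x t) y * (b / t ^ CARD('n))"
      using b
    proof eventually_elim
      case (elim y)
      have "norm (dilate t \<phi> (x - y) * f y) \<le> (indicator (ball x t) y / t ^ CARD('n)) * b"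
        unfolding norm_mult using elim t by (intro mult_mono dilate_bound[OF \<phi> t]) (auto simp: indicator_def)
      then show ?case by simp
    qed
  qed
  also have "\<dots> = (?V * t ^ CARD('n)) * (b / t ^ CARD('n))" using t by (simp add: content_ball)
  also have "\<dots> = b * ?V" using t by simp
  finally show "norm (convol (dilate t \<phi>) f x) \<le> b * ?V" .
qed

lemma integrable_gauss_const: "integrable (gauss :: (real^'n) measure) (\<lambda>_. c :: complex)"
  using finite_measure.integrable_const[OF finite_measure_gauss] .

lemma Mloc_one_finite: "(\<integral>\<^sup>+y. Mloc (\<lambda>_. 1) y \<partial>(gauss :: (real^'n) measure)) < \<infinity>"
proof -
  have "(\<integral>\<^sup>+y. Mloc (\<lambda>_. 1) y \<partial>(gauss :: (real^'n) measure)) \<le> (\<integral>\<^sup>+y. ennreal (1 * uvol TYPE('n)) \<partial>(gauss :: (real^'n) measure))"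
    by (intro nn_integral_mono Mloc_le_const integrable_gauss_const) simp
  also have "\<dots> = ennreal (1 * uvol TYPE('n)) * emeasure (gauss :: (real^'n) measure) UNIV" by simp
  also have "\<dots> < \<infinity>" using gauss_finite[where 'n='n] by (simp add: ennreal_mult_less_top)
  finally show ?thesis .
qed

lemma E_plus_one_finite: "E_plus (\<lambda>_::real^'n. 1) < \<infinity>"
proof -
  have "E_plus (\<lambda>_::real^'n. 1) \<le> (\<integral>\<^sup>+x. ennreal (1 + (norm x)\<^sup>2) \<partial>(gauss :: (real^'n) measure))"
    unfolding E_plus_def by (intro nn_integral_mono ennreal_leI) simp
  also note gauss_moment_finite
  finally show ?thesis .
qed

lemma gauss_measure_pos: "0 < measure (gauss :: (real^'n) measure) UNIV"
proof -
  interpret finite_measure "gauss :: (real^'n) measure" by (rule finite_measure_gauss)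
  have "admissible (0::real^'n) 1" by (simp add: admissible_def adm_radius_def)
  from measure_gauss_cball(2)[OF this] have "gdens (0::real^'n) * uvol TYPE('n) \<le> exp 3 * measure gauss (cball (0::real^'n) 1)" by simp
  moreover have "0 < gdens (0::real^'n) * uvol TYPE('n)" by (intro mult_pos_pos gdens_pos) simp
  moreover have "measure gauss (cball (0::real^'n) 1) \<le> measure (gauss :: (real^'n) measure) UNIV"
    by (rule finite_measure_mono) auto
  ultimately show ?thesis by (smt (verit) exp_gt_zero mult_less_0_iff zero_less_mult_iff)
qed

text \<open>With \<open>G\<close> the total mass, \<open>1 - G * tau 0 / gdens\<close> is
  decomposable by centering, and the equation is solved for the density. Ball atoms have mean zero,
  so the constant atom is what supplies the mass.\<close>

lemma dec_tau_origin:
  obtains C where "0 \<le> C" "dec (\<lambda>y::real^'n. of_real (tau 0 y) / of_real (gdens y)) C"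
proof -
  let ?G = "measure (gauss :: (real^'n) measure) UNIV" and ?T = "\<lambda>y::real^'n. complex_of_real (tau 0 y) / of_real (gdens y)"
  have G: "(LINT y|(gauss :: (real^'n) measure). (1::complex)) = of_real ?G"
    by (simp add: scaleR_conv_of_real)
  have g0: "complex_of_real ?G \<noteq> 0" using gauss_measure_pos[where 'n='n] by simp
  obtain C1 where "dec (\<lambda>y::real^'n. 1 - of_real ?G * ?T y) C1"
    using dec_centered(2)[where 'n='n, OF integrable_gauss_const[of 1] Mloc_one_finite E_plus_one_finite] unfolding G by blast
  from dec_add[OF dec_cmult_atom[OF atom_one, of "1 / of_real ?G"] dec_cmult[OF this, of "- 1 / of_real ?G"]]
  obtain C where C: "dec (\<lambda>y. (1 / of_real ?G) * 1 + (- 1 / of_real ?G) * (1 - of_real ?G * ?T y)) C" by blast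
  moreover have "(\<lambda>y. (1 / of_real ?G) * 1 + (- 1 / of_real ?G) * (1 - of_real ?G * ?T y)) = ?T"
  proof
    fix y
    have "1 / z * 1 + - 1 / z * (1 - z * w) = w" if "z \<noteq> 0" for z w :: complex using that by (simp add: field_simps)
    from this[OF g0] show "(1 / of_real ?G) * 1 + (- 1 / of_real ?G) * (1 - of_real ?G * ?T y) = ?T y" .
  qed
  ultimately have "dec ?T C" by (simp only:)
  then show ?thesis using that dec_nonneg by blast
qed

text \<open>After centering, a multiple of the density at the origin is left whose coefficient is
  the Gauss integral of \<open>f\<close>; the almost everywhere bound estimates it by the integral
  of \<open>Mloc f\<close>.\<close>

lemma sufficiency:
  obtains C where "0 < C" "\<And>f :: real^'n \<Rightarrow> complex. integrable gauss f \<Longrightarrow> L1_ennreal (Mloc f) \<Longrightarrow> E_plus f < \<infinity> \<Longrightarrow>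
     dec f (C * (enn2real (\<integral>\<^sup>+y. Mloc f y \<partial>gauss) + enn2real (E_plus f)))"
proof -
  obtain C0 where C0: "0 \<le> C0" "dec (\<lambda>y::real^'n. of_real (tau 0 y) / of_real (gdens y)) C0" by (rule dec_tau_origin)
  define C where "C = centered_const TYPE('n) + ae_const TYPE('n) * C0 + 1"
  have cA0: "0 \<le> centered_const TYPE('n)"
    by (rule dec_centered(1)[OF integrable_gauss_const[of 1] Mloc_one_finite E_plus_one_finite])
  have aC: "0 \<le> ae_const TYPE('n) * C0" by (rule mult_nonneg_nonneg[OF ae_const_nonneg C0(1)])
  have "0 < C" unfolding C_def using cA0 aC by linarith
  then show ?thesis
  proof (rule that)
    fix f :: "real^'n \<Rightarrow> complex"
    assume f: "integrable gauss f" and "L1_ennreal (Mloc f)" and E: "E_plus f < \<infinity>"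
    then have M: "(\<integral>\<^sup>+y. Mloc f y \<partial>gauss) < \<infinity>" by (simp add: L1_ennreal_def)
    let ?J = "enn2real (\<integral>\<^sup>+y. Mloc f y \<partial>gauss)" and ?E = "enn2real (E_plus f)"
    let ?I = "LINT y|gauss. f y"
    have "ennreal (norm ?I) \<le> (\<integral>\<^sup>+y. ennreal (norm (f y)) \<partial>gauss)" by (rule integral_norm_bound_ennreal[OF f])
    also note nn_integral_le_Mloc[OF f]
    also have "(\<integral>\<^sup>+y. Mloc f y \<partial>gauss) = ennreal ?J" using M by (simp add: ennreal_enn2real_if)
    also have "ennreal (ae_const TYPE('n)) * ennreal ?J = ennreal (ae_const TYPE('n) * ?J)"
      by (rule ennreal_mult[symmetric, OF ae_const_nonneg enn2real_nonneg])
    finally have I: "norm ?I \<le> ae_const TYPE('n) * ?J"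
      by (subst (asm) ennreal_le_iff) (rule mult_nonneg_nonneg[OF ae_const_nonneg enn2real_nonneg])
    have "dec (\<lambda>y. (f y - ?I * (of_real (tau 0 y) / of_real (gdens y))) + ?I * (of_real (tau 0 y) / of_real (gdens y)))
       (centered_const TYPE('n) * (?J + ?E) + norm ?I * C0)"
      by (rule dec_add[OF dec_centered(2)[OF f M E] dec_cmult[OF C0(2)]])
    then have d: "dec f (centered_const TYPE('n) * (?J + ?E) + norm ?I * C0)" by (simp only: diff_add_cancel)
    have "norm ?I * C0 \<le> ae_const TYPE('n) * C0 * ?J" using mult_right_mono[OF I C0(1)] by (simp only: mult_ac)
    moreover have "0 \<le> ae_const TYPE('n) * C0 * ?E" by (rule mult_nonneg_nonneg[OF aC enn2real_nonneg])
    moreover have "C * (?J + ?E) = centered_const TYPE('n) * (?J + ?E) + ae_const TYPE('n) * C0 * ?J + ae_const TYPE('n) * C0 * ?E + (?J + ?E)"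
      unfolding C_def by (simp only: distrib_right distrib_left mult_1_left add.assoc)
    moreover have "0 \<le> ?J + ?E" by simp
    ultimately have "centered_const TYPE('n) * (?J + ?E) + norm ?I * C0 \<le> C * (?J + ?E)" by linarith
    then show "dec f (C * (?J + ?E))" by (rule dec_mono[OF d])
  qed
qed

section \<open>Maximal functions of atoms and of atomic series\<close>

lemma convol_le_L1:
  fixes x :: "real^'n"
  assumes \<phi>: "\<phi> \<in> test_functions" and t: "0 < t"
  obtains K where "0 \<le> K" "\<And>f :: real^'n \<Rightarrow> complex. integrable gauss f \<Longrightarrow>
    ennreal (norm (convol (dilate t \<phi>) f x)) \<le> ennreal K * (\<integral>\<^sup>+y. ennreal (norm (f y)) \<partial>gauss)"
proof -
  define m where "m = pi powr (- (real CARD('n) / 2)) * exp (- (norm x + t)\<^sup>2)"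
  have m: "0 < m" by (simp add: m_def)
  define K where "K = 1 / (t ^ CARD('n) * m)"
  have K: "0 \<le> K" using t m by (simp add: K_def)
  show ?thesis
  proof (rule that[OF K])
    fix f :: "real^'n \<Rightarrow> complex" assume f: "integrable gauss f"
    have [measurable]: "f \<in> borel_measurable borel" using f by (auto dest: borel_measurable_integrable)
    have "ennreal (norm (convol (dilate t \<phi>) f x)) \<le> (\<integral>\<^sup>+y. ennreal (norm (dilate t \<phi> (x - y) * f y)) \<partial>lborel)"
      unfolding convol_def by (rule integral_norm_bound_ennreal[OF convol_integrable[OF f \<phi> t]])
    also have "\<dots> \<le> (\<integral>\<^sup>+y. ennreal K * (ennreal (gdens y) * ennreal (norm (f y))) \<partial>lborel)"
    proof (rule nn_integral_mono)
      fix y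
      have "norm (dilate t \<phi> (x - y)) \<le> K * gdens y"
      proof (cases "y \<in> ball x t")
        case True
        have "norm y \<le> norm x + t" using True dist_triangle[of 0 y x] by simp
        then have "m \<le> gdens y" unfolding m_def by (rule gdens_ge_on_ball)
        then have "1 \<le> gdens y / m" using m by simp
        have "norm (dilate t \<phi> (x - y)) \<le> 1 / t ^ CARD('n) * 1" using dilate_bound[OF \<phi> t, of x y] True by simp
        also have "\<dots> \<le> 1 / t ^ CARD('n) * (gdens y / m)" using \<open>1 \<le> gdens y / m\<close> t by (intro mult_left_mono) auto
        finally show ?thesis by (simp add: K_def)
      next
        case False
        then have "norm (dilate t \<phi> (x - y)) \<le> 0" using dilate_bound[OF \<phi> t, of x y] by simp
        also have "0 \<le> K * gdens y" using K by simp
        finally show ?thesis .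
      qed
      then have "norm (dilate t \<phi> (x - y) * f y) \<le> K * (gdens y * norm (f y))"
        unfolding norm_mult mult.assoc[symmetric] by (rule mult_right_mono) simp
      then have "ennreal (norm (dilate t \<phi> (x - y) * f y)) \<le> ennreal (K * (gdens y * norm (f y)))" by (rule ennreal_leI)
      also have "\<dots> = ennreal K * (ennreal (gdens y) * ennreal (norm (f y)))"
        using K by (simp add: ennreal_mult)
      finally show "ennreal (norm (dilate t \<phi> (x - y) * f y)) \<le> ennreal K * (ennreal (gdens y) * ennreal (norm (f y)))" .
    qed
    also have "\<dots> = ennreal K * (\<integral>\<^sup>+y. ennreal (gdens y) * ennreal (norm (f y)) \<partial>lborel)"
      by (rule nn_integral_cmult) measurable
    also have "(\<integral>\<^sup>+y. ennreal (gdens y) * ennreal (norm (f y)) \<partial>lborel) = (\<integral>\<^sup>+y. ennreal (norm (f y)) \<partial>gauss)"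
      by (rule nn_integral_gauss[symmetric]) measurable
    finally show "ennreal (norm (convol (dilate t \<phi>) f x)) \<le> ennreal K * (\<integral>\<^sup>+y. ennreal (norm (f y)) \<partial>gauss)" .
  qed
qed

lemma atom_integrable:
  fixes a :: "real^'n \<Rightarrow> complex"
  assumes "gaussian_atom a"
  shows "integrable gauss a"
proof (rule integrableI_bounded)
  show "a \<in> borel_measurable gauss" using atom_measurable[OF assms] by simp
  show "(\<integral>\<^sup>+y. ennreal (norm (a y)) \<partial>gauss) < \<infinity>" by (rule le_less_trans[OF atom_L1[OF assms]]) simp
qed

text \<open>For fixed \<open>\<phi>\<close>, \<open>t\<close> and \<open>x\<close> the convolution
  is continuous in \<open>L^1\<close> of the Gauss measure, with a constant \<open>K\<close>
  depending on all three. This is enough to pass to the limit of the partial sums, and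
  \<open>K\<close> disappears from the result.\<close>

lemma Mloc_atomic_le:
  fixes f :: "real^'n \<Rightarrow> complex"
  assumes f: "integrable gauss f" and d: "atomic_decomp f l a"
  shows "Mloc f x \<le> (\<Sum>j. ennreal (norm (l j)) * Mloc (a j) x)"
proof -
  have at: "gaussian_atom (a j)" for j using d by (simp add: atomic_decomp_def)
  note ai = atom_integrable[OF at]
  show ?thesis
    unfolding Mloc_def[of f]
  proof (intro SUP_least)
    fix \<phi> :: "real^'n \<Rightarrow> complex" and t assume \<phi>: "\<phi> \<in> test_functions" and t: "t \<in> {0<..<adm_radius x}"
    then have t0: "0 < t" by simp
    let ?D = "\<lambda>N. \<integral>\<^sup>+y. ennreal (norm (f y - (\<Sum>j<N. l j * a j y))) \<partial>gauss"
    obtain K where K: "0 \<le> K" "\<And>f :: real^'n \<Rightarrow> complex. integrable gauss f \<Longrightarrow>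
       ennreal (norm (convol (dilate t \<phi>) f x)) \<le> ennreal K * (\<integral>\<^sup>+y. ennreal (norm (f y)) \<partial>gauss)"
      by (rule convol_le_L1[OF \<phi> t0, of x]) blast
    have b: "ennreal (norm (convol (dilate t \<phi>) f x)) \<le> ennreal K * ?D N + (\<Sum>j. ennreal (norm (l j)) * Mloc (a j) x)" for N
    proof -
      let ?S = "\<lambda>y. \<Sum>j<N. l j * a j y"
      have iS: "integrable gauss ?S" using ai by (intro Bochner_Integration.integrable_sum integrable_mult_right)
      have ci: "integrable lborel (\<lambda>y. dilate t \<phi> (x - y) * g y)" if "integrable gauss g" for g
        by (rule convol_integrable[OF that \<phi> t0])
      have "convol (dilate t \<phi>) f x = (LINT y|lborel. dilate t \<phi> (x - y) * (f y - ?S y) + (\<Sum>j<N. l j * (dilate t \<phi> (x - y) * a j y)))"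
        unfolding convol_def
        by (rule Bochner_Integration.integral_cong[OF refl]) (simp add: right_diff_distrib sum_distrib_left mult_ac)
      also have "\<dots> = convol (dilate t \<phi>) (\<lambda>y. f y - ?S y) x + (LINT y|lborel. (\<Sum>j<N. l j * (dilate t \<phi> (x - y) * a j y)))"
        unfolding convol_def
        by (rule Bochner_Integration.integral_add[OF ci[OF Bochner_Integration.integrable_diff[OF f iS]]])
           (intro Bochner_Integration.integrable_sum integrable_mult_right ci ai)
      also have "(LINT y|lborel. (\<Sum>j<N. l j * (dilate t \<phi> (x - y) * a j y))) = (\<Sum>j<N. LINT y|lborel. l j * (dilate t \<phi> (x - y) * a j y))"
        by (rule Bochner_Integration.integral_sum) (intro integrable_mult_right ci ai)
      also have "\<dots> = (\<Sum>j<N. l j * convol (dilate t \<phi>) (a j) x)"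
        unfolding convol_def by (rule sum.cong[OF refl]) (rule integral_mult_right_zero)
      finally have "norm (convol (dilate t \<phi>) f x) \<le> norm (convol (dilate t \<phi>) (\<lambda>y. f y - ?S y) x) + (\<Sum>j<N. norm (l j) * norm (convol (dilate t \<phi>) (a j) x))"
        using norm_triangle_ineq[of "convol (dilate t \<phi>) (\<lambda>y. f y - ?S y) x" "\<Sum>j<N. l j * convol (dilate t \<phi>) (a j) x"]
          norm_sum[of "\<lambda>j. l j * convol (dilate t \<phi>) (a j) x" "{..<N}"] by (simp add: norm_mult)
      then have "ennreal (norm (convol (dilate t \<phi>) f x)) \<le> ennreal (norm (convol (dilate t \<phi>) (\<lambda>y. f y - ?S y) x) + (\<Sum>j<N. norm (l j) * norm (convol (dilate t \<phi>) (a j) x)))"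
        by (rule ennreal_leI)
      also have "\<dots> = ennreal (norm (convol (dilate t \<phi>) (\<lambda>y. f y - ?S y) x)) + (\<Sum>j<N. ennreal (norm (l j)) * ennreal (norm (convol (dilate t \<phi>) (a j) x)))"
        by (subst ennreal_plus) (auto intro!: sum_nonneg simp: sum_ennreal[symmetric] ennreal_mult)
      also have "\<dots> \<le> ennreal K * ?D N + (\<Sum>j<N. ennreal (norm (l j)) * Mloc (a j) x)"
      proof (intro add_mono sum_mono mult_left_mono)
        show "ennreal (norm (convol (dilate t \<phi>) (\<lambda>y. f y - ?S y) x)) \<le> ennreal K * ?D N"
          by (rule K(2)[OF Bochner_Integration.integrable_diff[OF f iS]])
        show "ennreal (norm (convol (dilate t \<phi>) (a j) x)) \<le> Mloc (a j) x" for j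
          unfolding Mloc_def by (rule SUP_upper2[OF \<phi>], rule SUP_upper2[OF t]) simp
      qed simp
      also have "\<dots> \<le> ennreal K * ?D N + (\<Sum>j. ennreal (norm (l j)) * Mloc (a j) x)"
        by (intro add_left_mono sum_le_suminf summableI) auto
      finally show ?thesis .
    qed
    have D: "?D \<longlonglongrightarrow> 0" using d by (simp add: atomic_decomp_def)
    have "(\<lambda>N. ennreal K * ?D N + (\<Sum>j. ennreal (norm (l j)) * Mloc (a j) x)) \<longlonglongrightarrow> ennreal K * 0 + (\<Sum>j. ennreal (norm (l j)) * Mloc (a j) x)"
      by (intro tendsto_add tendsto_const ennreal_tendsto_cmult D) simp
    then show "ennreal (norm (convol (dilate t \<phi>) f x)) \<le> (\<Sum>j. ennreal (norm (l j)) * Mloc (a j) x)"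
      using b by (intro LIMSEQ_le_const) auto
  qed
qed

text \<open>Only the single partial derivatives are bounded by 1; expanding a direction in
  coordinates costs the factor \<open>n\<close>.\<close>

lemma test_function_lipschitz:
  fixes \<phi> :: "real^'n \<Rightarrow> complex"
  assumes "\<phi> \<in> test_functions"
  shows "norm (\<phi> p - \<phi> q) \<le> real CARD('n) * norm (p - q)"
proof -
  have d: "\<phi> differentiable (at z)" and pb: "norm (partial_deriv i \<phi> z) \<le> 1" for i z
    using assms by (auto simp: test_functions_def differentiable_on_def)
  let ?D = "\<lambda>z. frechet_derivative \<phi> (at z)"
  have D: "(\<phi> has_derivative ?D z) (at z)" for z using d frechet_derivative_works by blast
  have "onorm (?D z) \<le> real CARD('n)" for z
  proof (rule onorm_le)
    fix v :: "real^'n"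
    interpret bounded_linear "?D z" by (rule has_derivative_bounded_linear[OF D])
    have "v = (\<Sum>i\<in>UNIV. (v $ i) *\<^sub>R axis i 1)" using basis_expansion[of v] by (simp add: scalar_mult_eq_scaleR)
    then have "?D z v = ?D z (\<Sum>i\<in>UNIV. (v $ i) *\<^sub>R axis i 1)" by (rule arg_cong)
    also have "\<dots> = (\<Sum>i\<in>UNIV. (v $ i) *\<^sub>R partial_deriv i \<phi> z)" by (simp add: sum scaleR partial_deriv_def)
    also have "norm \<dots> \<le> (\<Sum>i\<in>(UNIV::'n set). norm v * 1)"
    proof (rule sum_norm_le)
      fix i :: 'n
      show "norm ((v $ i) *\<^sub>R partial_deriv i \<phi> z) \<le> norm v * 1"
        unfolding norm_scaleR using component_le_norm_cart[of v i] pb[of i z] by (intro mult_mono) auto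
    qed
    also have "\<dots> = real CARD('n) * norm v" by simp
    finally show "norm (?D z v) \<le> real CARD('n) * norm v" .
  qed
  then show ?thesis
    using differentiable_bound[of UNIV \<phi> ?D "real CARD('n)" p q] D by (simp add: has_derivative_at_withinI)
qed

lemma exp_minus_one_bound: "\<bar>exp u - 1\<bar> \<le> exp 3 * \<bar>u\<bar>" if "\<bar>u\<bar> \<le> 3" for u :: real
  using exp_minus_lipschitz[of "- u" "exp 3" 0] that by simp

abbreviation gauss_mass :: "'n::finite itself \<Rightarrow> real" where
  "gauss_mass _ \<equiv> 1 + measure (gauss :: (real^'n) measure) UNIV"

text \<open>Factor by factor: \<open>exp 8 * exp 3\<close> compares densities, \<open>n + 9\<close>
  is the slope of the kernel, the power of 2 replaces \<open>1 / t\<close> by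
  \<open>2 / dist x c\<close>, and the last factor bounds the norm of the atom.\<close>

definition far_const :: "'n::finite itself \<Rightarrow> real" where
  "far_const _ = exp 11 * (real CARD('n) + 9) * 2 ^ (CARD('n) + 1) * gauss_mass TYPE('n)"

lemma far_const_pos: "0 < far_const TYPE('n::finite)"
  unfolding far_const_def by (intro mult_pos_pos add_pos_nonneg add_nonneg_pos) auto

text \<open>The atom cancels with respect to Gauss measure, while the convolution is taken with
  respect to Lebesgue measure. The constant is therefore subtracted from the kernel
  \<open>H\<close>, which contains the factor \<open>1 / gdens\<close>. If \<open>t\<close> is too
  small to reach the ball, the convolution is 0; otherwise \<open>t\<close> exceeds half of
  \<open>dist x c\<close>, and \<open>H\<close> varies over the ball by order \<open>r / t\<close>
  relative to its size.\<close>

lemma atom_far_bound: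
  fixes a :: "real^'n \<Rightarrow> complex"
  assumes ai: "integrable gauss a" and mass: "(\<integral>\<^sup>+y. ennreal (norm (a y)) \<partial>gauss) \<le> ennreal (gauss_mass TYPE('n))"
    and adm: "admissible c r" and supp: "AE y in gauss. y \<notin> cball c r \<longrightarrow> a y = 0" and mean: "(LINT y|gauss. a y) = 0"
    and \<phi>: "\<phi> \<in> test_functions" and t: "0 < t" "t < adm_radius x" and far: "2 * r \<le> dist x c"
  shows "gdens x * norm (convol (dilate t \<phi>) a x) \<le> far_const TYPE('n) * r / dist x c ^ (CARD('n) + 1)"
proof -
  have r: "0 < r" using adm by (simp add: admissible_def)
  have d: "0 < dist x c" using far r by linarith
  have am: "a \<in> borel_measurable borel" using ai by (auto dest: borel_measurable_integrable)
  note supp' = supp[unfolded AE_gauss]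
  have rhs: "0 \<le> far_const TYPE('n) * r / dist x c ^ (CARD('n) + 1)"
    using less_imp_le[OF far_const_pos[where 'n='n]] r d by (intro divide_nonneg_nonneg mult_nonneg_nonneg) auto
  show ?thesis
  proof (cases "t \<le> dist x c - r")
    case True
    have "AE y in lborel. dilate t \<phi> (x - y) * a y = 0"
      using supp'
    proof eventually_elim
      case (elim y)
      show ?case
      proof (cases "y \<in> cball c r")
        case T: True
        have "dist x c \<le> dist x y + dist c y" by (metis dist_commute dist_triangle)
        then have "y \<notin> ball x t" using T True by auto
        then show ?thesis using dilate_bound[OF \<phi> t(1), of x y] by simp
      qed (use elim in simp)
    qed
    then have "convol (dilate t \<phi>) a x = 0" unfolding convol_def by (rule integral_eq_zero_AE)
    then show ?thesis using rhs by simp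
  next
    case False
    then have td: "dist x c < 2 * t" using far by linarith
    have ax: "dist c x \<le> 2 * adm_radius x" using td t(2) by (simp add: dist_commute)
    have gx: "gdens x \<le> exp 8 * gdens c" using gdens_comparable(2)[OF ax] by simp
    \<comment> \<open>The points are at distance at most 2, so \<open>max 1 (norm c)\<close> is at
      most \<open>3 * max 1 (norm x)\<close>; admissibility at \<open>c\<close> can then be measured
      by \<open>t\<close>, which is below the admissible radius at \<open>x\<close>.\<close>
    have inv: "1 / adm_radius c \<le> 3 / t"
    proof -
      have ix: "1 / adm_radius x = max 1 (norm x)" "1 / adm_radius c = max 1 (norm c)" by (simp_all add: adm_radius_eq)
      have "norm c \<le> norm x + dist x c" using dist_triangle[of 0 c x] by simp
      moreover have "dist x c \<le> 2" using td t(2) adm_radius_le_1[of x] by linarith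
      ultimately have "max 1 (norm c) \<le> 3 * max 1 (norm x)" by (auto simp: max_def)
      also have "max 1 (norm x) \<le> 1 / t" unfolding ix[symmetric] using t by (intro divide_left_mono) auto
      finally show ?thesis unfolding ix by simp
    qed
    define H where "H y = (1 / gdens y) *\<^sub>R \<phi> ((1 / t) *\<^sub>R (x - y))" for y
    let ?B = "exp 3 / gdens c * ((real CARD('n) + 9) * (r / t))"
    have Hd: "norm (H y - H c) \<le> ?B" if y: "y \<in> cball c r" for y
    proof -
      have g1: "1 / gdens y \<le> exp 3 / gdens c" using gdens_admissible(2)[OF adm y] by (simp add: field_simps)
      have "(1 / t) *\<^sub>R (x - y) - (1 / t) *\<^sub>R (x - c) = (1 / t) *\<^sub>R (c - y)" by (simp add: algebra_simps)
      then have "norm ((1 / t) *\<^sub>R (x - y) - (1 / t) *\<^sub>R (x - c)) = dist c y / t" using t by (simp add: dist_norm)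
      also have "\<dots> \<le> r / t" using y t by (intro divide_right_mono) auto
      finally have "real CARD('n) * norm ((1 / t) *\<^sub>R (x - y) - (1 / t) *\<^sub>R (x - c)) \<le> real CARD('n) * (r / t)"
        by (rule mult_left_mono) simp
      with test_function_lipschitz[OF \<phi>] have p1: "norm (\<phi> ((1 / t) *\<^sub>R (x - y)) - \<phi> ((1 / t) *\<^sub>R (x - c))) \<le> real CARD('n) * (r / t)"
        by (rule order_trans)
      \<comment> \<open>The relative change of \<open>1 / gdens\<close> is \<open>exp u - 1\<close>,
        with \<open>u\<close> the difference of squared norms. Admissibility yields
        \<open>|u| <= 3\<close>, which linearises the exponential, and
        \<open>|u| <= 9 * (r / t)\<close>, the origin of the 9 in \<open>far_const\<close>.\<close>
      have gd: "\<bar>1 / gdens y - 1 / gdens c\<bar> \<le> exp 3 / gdens c * (9 * (r / t))"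
      proof -
        define u where "u = (norm y)\<^sup>2 - (norm c)\<^sup>2"
        have ny: "norm y \<le> norm c + r" using y dist_triangle[of 0 y c] by simp
        have "\<bar>u\<bar> \<le> dist y c * (norm y + norm c)" unfolding u_def by (rule norm_sq_diff_le)
        also have "\<dots> \<le> r * (2 * norm c + r)" using y ny r by (intro mult_mono) (auto simp: dist_commute)
        also have "\<dots> \<le> r * (3 * (1 / adm_radius c))"
        proof (rule mult_left_mono)
          have "r \<le> 1" using adm adm_radius_le_1[of c] by (simp add: admissible_def)
          then show "2 * norm c + r \<le> 3 * (1 / adm_radius c)" by (auto simp: adm_radius_eq max_def)
        qed (use r in simp)
        finally have u1: "\<bar>u\<bar> \<le> r * (3 * (1 / adm_radius c))" .
        also have "\<dots> \<le> r * (3 * (3 / t))" using inv r by (intro mult_left_mono) auto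
        finally have u2: "\<bar>u\<bar> \<le> 9 * (r / t)" by (simp add: mult.commute)
        have "r * (1 / adm_radius c) \<le> 1" using adm adm_radius_pos[of c] by (simp add: admissible_def)
        then have "3 * (r * (1 / adm_radius c)) \<le> 3 * 1" by (rule mult_left_mono) simp
        then have "r * (3 * (1 / adm_radius c)) \<le> 3" by (simp only: mult_1_right mult.left_commute)
        then have u3: "\<bar>u\<bar> \<le> 3" by (rule order_trans[OF u1])
        have "gdens c / gdens y = exp u"
          unfolding gdens_def u_def by (simp add: exp_diff[symmetric])
        then have "1 / gdens y - 1 / gdens c = (1 / gdens c) * (exp u - 1)"
          by (simp add: field_simps)
        then have "\<bar>1 / gdens y - 1 / gdens c\<bar> = (1 / gdens c) * \<bar>exp u - 1\<bar>" by (simp add: abs_mult)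
        also have "\<dots> \<le> (1 / gdens c) * (exp 3 * \<bar>u\<bar>)" by (intro mult_left_mono exp_minus_one_bound u3) simp
        also have "\<dots> \<le> (1 / gdens c) * (exp 3 * (9 * (r / t)))" by (intro mult_left_mono u2) auto
        finally show ?thesis by simp
      qed
      have "H y - H c = (1 / gdens y) *\<^sub>R (\<phi> ((1 / t) *\<^sub>R (x - y)) - \<phi> ((1 / t) *\<^sub>R (x - c))) + (1 / gdens y - 1 / gdens c) *\<^sub>R \<phi> ((1 / t) *\<^sub>R (x - c))"
        by (simp add: H_def scaleR_diff_right scaleR_diff_left)
      then have "norm (H y - H c) \<le> norm ((1 / gdens y) *\<^sub>R (\<phi> ((1 / t) *\<^sub>R (x - y)) - \<phi> ((1 / t) *\<^sub>R (x - c)))) + norm ((1 / gdens y - 1 / gdens c) *\<^sub>R \<phi> ((1 / t) *\<^sub>R (x - c)))"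
        by (simp only: norm_triangle_ineq)
      also have "\<dots> \<le> (exp 3 / gdens c) * (real CARD('n) * (r / t)) + (exp 3 / gdens c * (9 * (r / t))) * 1"
        unfolding norm_scaleR using g1 p1 gd test_functionsD(2)[OF \<phi>] r t
        by (intro add_mono mult_mono) (auto simp: less_imp_le)
      also have "\<dots> = ?B"
      proof -
        have "e * (n * w) + e * (9 * w) * 1 = e * ((n + 9) * w)" for e n w :: real by (simp add: algebra_simps)
        then show ?thesis .
      qed
      finally show ?thesis .
    qed
    have B0: "0 \<le> ?B" using r t by (intro mult_nonneg_nonneg divide_nonneg_nonneg) auto
    define A where "A y = gdens y *\<^sub>R a y" for y
    have Ai: "integrable lborel A" unfolding A_def using ai integrable_gauss[OF am] by simp
    have A0: "(LINT y|lborel. A y) = 0" unfolding A_def using mean integral_gauss[OF am] by simp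
    have A1: "(LINT y|lborel. norm (A y)) \<le> gauss_mass TYPE('n)"
    proof -
      have "(LINT y|lborel. norm (A y)) = enn2real (\<integral>\<^sup>+y. ennreal (norm (A y)) \<partial>lborel)"
        using Ai by (intro integral_eq_nn_integral) auto
      also have "(\<integral>\<^sup>+y. ennreal (norm (A y)) \<partial>lborel) = (\<integral>\<^sup>+y. ennreal (norm (a y)) \<partial>gauss)"
        using am by (subst nn_integral_gauss) (auto simp: A_def ennreal_mult)
      also have "enn2real \<dots> \<le> gauss_mass TYPE('n)" using mass by (intro enn2real_leI) auto
      finally show ?thesis .
    qed
    have eq: "dilate t \<phi> (x - y) * a y = (1 / t ^ CARD('n)) *\<^sub>R (H y * A y)" for y
    proof -
      have "H y * A y = \<phi> ((1 / t) *\<^sub>R (x - y)) * a y" by (simp add: H_def A_def)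
      then show ?thesis by (simp add: dilate_def)
    qed
    have HAi: "integrable lborel (\<lambda>y. H y * A y)"
    proof -
      have "integrable lborel (\<lambda>y. (t ^ CARD('n)) *\<^sub>R (dilate t \<phi> (x - y) * a y))"
        by (intro integrable_scaleR_right convol_integrable[OF ai \<phi> t(1)])
      then show ?thesis unfolding eq using t by simp
    qed
    have "convol (dilate t \<phi>) a x = (1 / t ^ CARD('n)) *\<^sub>R (LINT y|lborel. H y * A y)"
      unfolding convol_def eq by (rule integral_scaleR_right)
    also have "(LINT y|lborel. H y * A y) = (LINT y|lborel. H y * A y) - (LINT y|lborel. H c * A y)"
      using A0 by simp
    also have "\<dots> = (LINT y|lborel. H y * A y - H c * A y)"
      by (rule Bochner_Integration.integral_diff[symmetric, OF HAi integrable_mult_right[OF Ai]])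
    finally have cv: "convol (dilate t \<phi>) a x = (1 / t ^ CARD('n)) *\<^sub>R (LINT y|lborel. H y * A y - H c * A y)" .
    have "norm (LINT y|lborel. H y * A y - H c * A y) \<le> (LINT y|lborel. norm (H y * A y - H c * A y))"
      by (rule integral_norm_bound)
    also have "\<dots> \<le> (LINT y|lborel. ?B * norm (A y))"
    proof (rule integral_mono_AE)
      show "integrable lborel (\<lambda>y. norm (H y * A y - H c * A y))"
        by (intro integrable_norm Bochner_Integration.integrable_diff HAi integrable_mult_right Ai)
      show "integrable lborel (\<lambda>y. ?B * norm (A y))" using Ai by (intro integrable_mult_right integrable_norm)
      show "AE y in lborel. norm (H y * A y - H c * A y) \<le> ?B * norm (A y)"
        using supp'
      proof eventually_elim
        case (elim y)
        show ?case
        proof (cases "y \<in> cball c r")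
          case True
          have "norm (H y * A y - H c * A y) = norm (H y - H c) * norm (A y)"
            by (simp only: left_diff_distrib[symmetric] norm_mult)
          also have "\<dots> \<le> ?B * norm (A y)" by (intro mult_right_mono Hd True) simp
          finally show ?thesis .
        next
          case False
          then have "A y = 0" using elim by (simp add: A_def)
          then show ?thesis by simp
        qed
      qed
    qed
    also have "\<dots> = ?B * (LINT y|lborel. norm (A y))" by (rule integral_mult_right_zero)
    also have "\<dots> \<le> ?B * gauss_mass TYPE('n)" by (rule mult_left_mono[OF A1 B0])
    finally have nI: "norm (LINT y|lborel. H y * A y - H c * A y) \<le> ?B * gauss_mass TYPE('n)" .
    have "gdens x * norm (convol (dilate t \<phi>) a x) = gdens x * ((1 / t ^ CARD('n)) * norm (LINT y|lborel. H y * A y - H c * A y))"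
      unfolding cv using t by simp
    also have "\<dots> \<le> (exp 8 * gdens c) * ((1 / t ^ CARD('n)) * (?B * gauss_mass TYPE('n)))"
      using gx nI t by (intro mult_mono) auto
    also have "\<dots> = exp 11 * (real CARD('n) + 9) * gauss_mass TYPE('n) * r * (1 / t ^ (CARD('n) + 1))"
    proof -
      have "(E * g) * ((1 / T) * ((F / g * (n * (r / t))) * G)) = E * F * n * G * r * (1 / (t * T))"
        if "g \<noteq> 0" for E g T F n G :: real using that by (simp add: mult_ac)
      from this[of "gdens c" "exp 8" "t ^ CARD('n)" "exp 3"] show ?thesis
        by (simp add: exp_add[symmetric])
    qed
    also have "\<dots> \<le> exp 11 * (real CARD('n) + 9) * gauss_mass TYPE('n) * r * (2 ^ (CARD('n) + 1) / dist x c ^ (CARD('n) + 1))"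
    proof (rule mult_left_mono)
      have "2 / (2 * t) \<le> 2 / dist x c"
      proof (rule divide_left_mono)
        show "dist x c \<le> 2 * t" using td by simp
        have "0 < 2 * t" using t(1) by simp
        then show "0 < 2 * t * dist x c" using d by (rule mult_pos_pos)
      qed simp
      then have "1 / t \<le> 2 / dist x c" by simp
      then have "(1 / t) ^ (CARD('n) + 1) \<le> (2 / dist x c) ^ (CARD('n) + 1)" using t by (intro power_mono) auto
      then show "1 / t ^ (CARD('n) + 1) \<le> 2 ^ (CARD('n) + 1) / dist x c ^ (CARD('n) + 1)" by (simp only: power_divide power_one)
    qed (use r in \<open>intro mult_nonneg_nonneg add_nonneg_nonneg; simp\<close>)
    also have "\<dots> = far_const TYPE('n) * r / dist x c ^ (CARD('n) + 1)"
      by (simp add: far_const_def)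
    finally show ?thesis .
  qed
qed

lemma dyadic_scale:
  fixes d :: real assumes "1 \<le> d"
  obtains k :: nat where "2 ^ k \<le> d" "d < 2 ^ (k + 1)"
proof -
  obtain m :: nat where m: "d < 2 ^ m" using real_arch_pow[of 2 d] by auto
  define k where "k = (LEAST m. d < 2 ^ (m::nat))"
  have k: "d < 2 ^ k" unfolding k_def by (rule LeastI[where P="\<lambda>m. d < 2 ^ m", OF m])
  have "k \<noteq> 0" using k assms by (cases k) auto
  then obtain j where j: "k = Suc j" by (cases k) auto
  have "\<not> d < 2 ^ j" using not_less_Least[of j "\<lambda>m. d < 2 ^ m"] j unfolding k_def[symmetric] by simp
  then show ?thesis using that[of j] k j by simp
qed

definition atom_const :: "'n::finite itself \<Rightarrow> real" where
  "atom_const _ = exp 11 + far_const TYPE('n)"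

lemma atom_const_pos: "0 < atom_const TYPE('n::finite)"
  unfolding atom_const_def by (intro add_pos_pos far_const_pos exp_gt_zero)

text \<open>Within two radii the sup bound of the atom is used, which is the term
  \<open>k = 0\<close>. Farther out the decay of order \<open>r / dist x c ^ (n + 1)\<close> is
  expressed on the dyadic shell of \<open>x\<close>. The exponent \<open>n + 1\<close> gains one
  power of 2 over the volume growth of the dyadic balls.\<close>

lemma ball_atom_Mloc:
  fixes a :: "real^'n \<Rightarrow> complex"
  assumes at: "gaussian_atom a" and adm: "admissible c r" and supp: "AE y in gauss. y \<notin> cball c r \<longrightarrow> a y = 0"
    and bd: "AE y in gauss. norm (a y) \<le> 1 / measure gauss (cball c r)" and mean: "(LINT y|gauss. a y) = 0"
  shows "ennreal (gdens x) * Mloc a x \<le>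
    (\<Sum>k. ennreal (atom_const TYPE('n) / r ^ CARD('n) * (1 / 2 ^ (CARD('n) + 1)) ^ k) * indicator (ball c (2 ^ (k + 1) * r)) x)"
    (is "_ \<le> (\<Sum>k. ?T k)")
proof -
  let ?V = "uvol TYPE('n)"
  have V: "0 < ?V" by simp
  have r: "0 < r" using adm by (simp add: admissible_def)
  have ai: "integrable gauss a" by (rule atom_integrable[OF at])
  have Tk: "?T k \<le> (\<Sum>k. ?T k)" for k
    using sum_le_suminf[of ?T "{k}"] by (simp only: summableI zero_le finite.intros sum.insert sum.empty add_0_right empty_iff not_False_eq_True simp_thms)
  show ?thesis
  proof (cases "dist x c < 2 * r")
    case True
    let ?\<gamma> = "measure gauss (cball c r)"
    have low: "gdens c * (?V * r ^ CARD('n)) \<le> exp 3 * ?\<gamma>" by (rule measure_gauss_cball(2)[OF adm])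
    have p: "0 < gdens c * (?V * r ^ CARD('n))" using r V by (intro mult_pos_pos gdens_pos) auto
    then have \<gamma>: "0 < ?\<gamma>" using low by (smt (verit) exp_gt_zero zero_less_mult_iff)
    have gx: "gdens x \<le> exp 8 * gdens c"
      using gdens_comparable(1)[of x c 2] True adm by (auto simp: admissible_def)
    have "Mloc a x \<le> ennreal (1 / ?\<gamma> * ?V)"
      by (rule Mloc_le_const[OF ai]) (use bd in \<open>simp only: AE_gauss\<close>)
    then have "ennreal (gdens x) * Mloc a x \<le> ennreal (gdens x) * ennreal (1 / ?\<gamma> * ?V)" by (rule mult_left_mono) simp
    also have "\<dots> = ennreal (gdens x * (1 / ?\<gamma> * ?V))" using V \<gamma> by (intro ennreal_mult[symmetric]) auto
    also have "\<dots> \<le> ennreal (atom_const TYPE('n) / r ^ CARD('n) * (1 / 2 ^ (CARD('n) + 1)) ^ 0)"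
    proof (rule ennreal_leI)
      have "1 / ?\<gamma> \<le> exp 3 / (gdens c * (?V * r ^ CARD('n)))" using low p \<gamma> by (simp add: field_simps)
      then have "gdens x * (1 / ?\<gamma> * ?V) \<le> (exp 8 * gdens c) * (exp 3 / (gdens c * (?V * r ^ CARD('n))) * ?V)"
        using gx V \<gamma> less_imp_le[OF p]
        by (intro mult_mono divide_nonneg_nonneg mult_nonneg_nonneg[of "gdens x"]) auto
      also have "\<dots> = exp 11 / r ^ CARD('n)"
      proof -
        have "(E * g) * (F / (g * (v * R)) * v) = E * F / R" if "g \<noteq> 0" "v \<noteq> 0" for E g F v R :: real using that by simp
        from this[of "gdens c" ?V "exp 8" "exp 3" "r ^ CARD('n)"] show ?thesis by (simp add: exp_add[symmetric])
      qed
      also have "\<dots> \<le> atom_const TYPE('n) / r ^ CARD('n)"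
        unfolding atom_const_def using r less_imp_le[OF far_const_pos[where 'n='n]] by (intro divide_right_mono) auto
      finally show "gdens x * (1 / ?\<gamma> * ?V) \<le> atom_const TYPE('n) / r ^ CARD('n) * (1 / 2 ^ (CARD('n) + 1)) ^ 0" by simp
    qed
    also have "\<dots> = ?T 0" using True by (simp add: dist_commute)
    also note Tk[of 0]
    finally show ?thesis .
  next
    case False
    then have far: "2 * r \<le> dist x c" by simp
    then have "1 \<le> dist x c / r" using r by simp
    then obtain k where k: "2 ^ k \<le> dist x c / r" "dist x c / r < 2 ^ (k + 1)" by (rule dyadic_scale)
    have k': "2 ^ k * r \<le> dist x c" "dist x c < 2 ^ (k + 1) * r"
      using k r by (simp_all add: pos_le_divide_eq pos_divide_less_eq)
    let ?F = "far_const TYPE('n) * r / dist x c ^ (CARD('n) + 1)"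
    have "Mloc a x \<le> ennreal (?F / gdens x)"
      unfolding Mloc_def
    proof (intro SUP_least ennreal_leI)
      fix \<phi> :: "real^'n \<Rightarrow> complex" and t assume \<phi>: "\<phi> \<in> test_functions" and "t \<in> {0<..<adm_radius x}"
      then have "gdens x * norm (convol (dilate t \<phi>) a x) \<le> ?F"
        by (intro atom_far_bound[OF ai atom_L1[OF at] adm supp mean \<phi>] far) auto
      then show "norm (convol (dilate t \<phi>) a x) \<le> ?F / gdens x" by (simp only: pos_le_divide_eq[OF gdens_pos(1)] mult.commute)
    qed
    then have "ennreal (gdens x) * Mloc a x \<le> ennreal (gdens x) * ennreal (?F / gdens x)" by (rule mult_left_mono) simp
    also have "\<dots> = ennreal ?F" by (subst ennreal_mult'[symmetric]) auto
    also have "\<dots> \<le> ennreal (atom_const TYPE('n) / r ^ CARD('n) * (1 / 2 ^ (CARD('n) + 1)) ^ k)"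
    proof (rule ennreal_leI)
      have "(2 ^ k * r) ^ (CARD('n) + 1) \<le> dist x c ^ (CARD('n) + 1)" using k'(1) r by (intro power_mono) auto
      then have "?F \<le> far_const TYPE('n) * r / (2 ^ k * r) ^ (CARD('n) + 1)"
      proof (intro divide_left_mono mult_nonneg_nonneg mult_pos_pos zero_less_power)
        show "0 < dist x c" using far r by linarith
      qed (use less_imp_le[OF far_const_pos[where 'n='n]] r in auto)
      also have "\<dots> = far_const TYPE('n) / r ^ CARD('n) * (1 / 2 ^ (CARD('n) + 1)) ^ k"
      proof -
        have "(2 ^ k * r) ^ (CARD('n) + 1) = (2 ^ (CARD('n) + 1)) ^ k * (r ^ CARD('n) * r)"
          by (simp add: power_mult_distrib power_mult[symmetric] mult.commute)
        then show ?thesis using r by (simp add: power_divide)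
      qed
      also have "\<dots> \<le> atom_const TYPE('n) / r ^ CARD('n) * (1 / 2 ^ (CARD('n) + 1)) ^ k"
        unfolding atom_const_def using r by (intro mult_right_mono divide_right_mono) auto
      finally show "?F \<le> atom_const TYPE('n) / r ^ CARD('n) * (1 / 2 ^ (CARD('n) + 1)) ^ k" .
    qed
    also have "\<dots> = ?T k" using k'(2) by (simp add: dist_commute)
    also note Tk[of k]
    finally show ?thesis .
  qed
qed

text \<open>After integration the \<open>k\<close>-th dyadic term is proportional to
  \<open>2^(-k)\<close>, and the powers of \<open>r\<close> cancel, so the bound does not depend on
  the ball. For the constant atom the maximal function is bounded and the mass is finite.\<close>

lemma atom_Mloc_integral:
  obtains C where "0 \<le> C" "\<And>a :: real^'n \<Rightarrow> complex. gaussian_atom a \<Longrightarrow> (\<integral>\<^sup>+y. Mloc a y \<partial>gauss) \<le> ennreal C"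
proof -
  let ?V = "uvol TYPE('n)"
  let ?J1 = "enn2real (\<integral>\<^sup>+y. Mloc (\<lambda>_. 1) y \<partial>(gauss :: (real^'n) measure))"
  define C where "C = ?J1 + atom_const TYPE('n) * ?V * 2 ^ CARD('n) * 2"
  have c2: "0 \<le> atom_const TYPE('n) * ?V * 2 ^ CARD('n) * 2" using less_imp_le[OF atom_const_pos[where 'n='n]] by simp
  have C0: "0 \<le> C" unfolding C_def using c2 by simp
  show ?thesis
  proof (rule that[OF C0])
    fix a :: "real^'n \<Rightarrow> complex" assume at: "gaussian_atom a"
    show "(\<integral>\<^sup>+y. Mloc a y \<partial>gauss) \<le> ennreal C"
    proof (cases "a = (\<lambda>_. 1)")
      case True
      have "(\<integral>\<^sup>+y. Mloc a y \<partial>gauss) = ennreal ?J1" unfolding True using Mloc_one_finite[where 'n='n] by (simp add: ennreal_enn2real_if)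
      also have "\<dots> \<le> ennreal C" unfolding C_def using c2 by (intro ennreal_leI) simp
      finally show ?thesis .
    next
      case False
      then obtain c r where adm: "admissible c r" and *: "AE y in gauss. y \<notin> cball c r \<longrightarrow> a y = 0"
        "AE y in gauss. norm (a y) \<le> 1 / measure gauss (cball c r)" "(LINT y|gauss. a y) = 0"
        using at unfolding gaussian_atom_def by blast
      have r: "0 < r" using adm by (simp add: admissible_def)
      let ?q = "1 / 2 ^ (CARD('n) + 1) :: real"
      let ?t = "\<lambda>k. atom_const TYPE('n) / r ^ CARD('n) * ?q ^ k"
      have t0: "0 \<le> ?t k" for k using less_imp_le[OF atom_const_pos[where 'n='n]] r by simp
      have Mm: "Mloc a \<in> borel_measurable borel" by (rule Mloc_measurable[OF atom_integrable[OF at]])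
      have "(\<integral>\<^sup>+y. Mloc a y \<partial>gauss) = (\<integral>\<^sup>+y. ennreal (gdens y) * Mloc a y \<partial>lborel)" by (rule nn_integral_gauss[OF Mm])
      also have "\<dots> \<le> (\<integral>\<^sup>+y. (\<Sum>k. ennreal (?t k) * indicator (ball c (2 ^ (k + 1) * r)) y) \<partial>lborel)"
        by (intro nn_integral_mono ball_atom_Mloc[OF at adm *])
      also have "\<dots> = (\<Sum>k. \<integral>\<^sup>+y. ennreal (?t k) * indicator (ball c (2 ^ (k + 1) * r)) y \<partial>lborel)"
        by (rule nn_integral_suminf) (auto intro!: borel_measurable_times_ennreal borel_measurable_indicator)
      also have "\<dots> = (\<Sum>k. ennreal (atom_const TYPE('n) * ?V * 2 ^ CARD('n) * (1 / 2) ^ k))"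
      proof (rule suminf_cong)
        fix k
        have "(\<integral>\<^sup>+y. ennreal (?t k) * indicator (ball c (2 ^ (k + 1) * r)) y \<partial>lborel) = ennreal (?t k) * emeasure lborel (ball c (2 ^ (k + 1) * r))"
          by (rule nn_integral_cmult_indicator) simp
        also have "\<dots> = ennreal (?t k) * ennreal (?V * (2 ^ (k + 1) * r) ^ CARD('n))"
          using r by (subst emeasure_ball_vec) auto
        also have "\<dots> = ennreal (?t k * (?V * (2 ^ (k + 1) * r) ^ CARD('n)))"
          using r t0 by (intro ennreal_mult[symmetric]) auto
        also have "?t k * (?V * (2 ^ (k + 1) * r) ^ CARD('n)) = atom_const TYPE('n) * ?V * 2 ^ CARD('n) * (1 / 2) ^ k"
        proof -
          have p: "(2 ^ (k + 1) * r) ^ CARD('n) = (2 ^ CARD('n)) ^ k * 2 ^ CARD('n) * r ^ CARD('n)"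
            by (simp add: power_mult_distrib power_mult[symmetric] mult.commute)
          have q: "?q ^ k = 1 / ((2 ^ CARD('n)) ^ k * 2 ^ k)"
            by (simp add: power_divide power_mult_distrib mult.commute)
          have "A / R * (1 / (X * Y)) * (v * (X * Z * R)) = A * v * Z * (1 / Y)" if "R \<noteq> 0" "X \<noteq> 0" for A R X Y v Z :: real
            using that by simp
          from this[of "r ^ CARD('n)" "(2 ^ CARD('n)) ^ k"] show ?thesis
            unfolding p q using r by (simp add: power_divide)
        qed
        finally show "(\<integral>\<^sup>+y. ennreal (?t k) * indicator (ball c (2 ^ (k + 1) * r)) y \<partial>lborel) = ennreal (atom_const TYPE('n) * ?V * 2 ^ CARD('n) * (1 / 2) ^ k)" .
      qed
      also have "\<dots> = ennreal (atom_const TYPE('n) * ?V * 2 ^ CARD('n) * 2)"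
      proof -
        have g: "(\<lambda>k. (1 / 2 :: real) ^ k) sums 2" using geometric_sums[of "1 / 2 :: real"] by simp
        from sums_mult[OF g, of "atom_const TYPE('n) * ?V * 2 ^ CARD('n)"]
        have s: "(\<lambda>k. atom_const TYPE('n) * ?V * 2 ^ CARD('n) * (1 / 2) ^ k) sums (atom_const TYPE('n) * ?V * 2 ^ CARD('n) * 2)" .
        have nn: "0 \<le> atom_const TYPE('n) * ?V * 2 ^ CARD('n) * (1 / 2) ^ k" for k using less_imp_le[OF atom_const_pos[where 'n='n]] by simp
        show ?thesis unfolding suminf_ennreal2[OF nn sums_summable[OF s]] sums_unique[OF s, symmetric] ..
      qed
      also have "\<dots> \<le> ennreal C" unfolding C_def by (intro ennreal_leI) simp
      finally show ?thesis .
    qed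
  qed
qed

lemma Mloc_necessary:
  fixes f :: "real^'n \<Rightarrow> complex"
  assumes "f \<in> H1"
  shows "L1_ennreal (Mloc f)"
proof -
  from assms obtain l a where f: "integrable gauss f" and d: "atomic_decomp f l a" by (auto simp: H1_def)
  have at: "gaussian_atom (a j)" for j using d by (simp add: atomic_decomp_def)
  have l: "summable (\<lambda>j. norm (l j))" using d by (simp add: atomic_decomp_def)
  obtain C where C: "0 \<le> C" "\<And>a :: real^'n \<Rightarrow> complex. gaussian_atom a \<Longrightarrow> (\<integral>\<^sup>+y. Mloc a y \<partial>gauss) \<le> ennreal C"
    by (rule atom_Mloc_integral) blast
  note m = Mloc_measurable[OF atom_integrable[OF at]]
  have "(\<integral>\<^sup>+y. Mloc f y \<partial>gauss) \<le> (\<integral>\<^sup>+y. (\<Sum>j. ennreal (norm (l j)) * Mloc (a j) y) \<partial>gauss)"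
    by (intro nn_integral_mono Mloc_atomic_le[OF f d])
  also have "\<dots> = (\<Sum>j. \<integral>\<^sup>+y. ennreal (norm (l j)) * Mloc (a j) y \<partial>gauss)"
    using m by (intro nn_integral_suminf borel_measurable_times_ennreal) simp_all
  also have "\<dots> = (\<Sum>j. ennreal (norm (l j)) * (\<integral>\<^sup>+y. Mloc (a j) y \<partial>gauss))"
    using m by (intro suminf_cong nn_integral_cmult) simp
  also have "\<dots> \<le> (\<Sum>j. ennreal (norm (l j) * C))"
  proof (intro suminf_le summableI allI)
    fix j
    have "ennreal (norm (l j)) * (\<integral>\<^sup>+y. Mloc (a j) y \<partial>gauss) \<le> ennreal (norm (l j)) * ennreal C"
      by (intro mult_left_mono C at) simp
    also have "\<dots> = ennreal (norm (l j) * C)" using C(1) by (intro ennreal_mult[symmetric]) auto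
    finally show "ennreal (norm (l j)) * (\<integral>\<^sup>+y. Mloc (a j) y \<partial>gauss) \<le> ennreal (norm (l j) * C)" .
  qed
  also have "\<dots> < \<infinity>" using C(1) summable_mult2[OF l, of C] by (intro suminf_ennreal_finite) auto
  finally show ?thesis using Mloc_measurable[OF f] by (simp add: L1_ennreal_def)
qed

section \<open>Second moments of atoms and of nonnegative functions\<close>

text \<open>Admissible balls see \<open>|y|\<^sup>2\<close> as constant up to a bounded error, so the mean zero property bounds
  the second moment of an atom; the truncation at \<open>K\<close> legitimises the interchange with the series.\<close>

lemma atom_moment:
  fixes a :: "real^'n \<Rightarrow> complex"
  assumes at: "gaussian_atom a" and K: "0 \<le> K"
  shows "norm (LINT y|gauss. min ((norm y)\<^sup>2) K *\<^sub>R a y) \<le>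
     enn2real (\<integral>\<^sup>+y. ennreal (1 + (norm y)\<^sup>2) \<partial>(gauss :: (real^'n) measure)) + 3 * gauss_mass TYPE('n)"
    (is "_ \<le> ?G2 + _")
proof -
  let ?g = "\<lambda>y::real^'n. min ((norm y)\<^sup>2) K"
  have ai: "integrable gauss a" by (rule atom_integrable[OF at])
  have am: "a \<in> borel_measurable borel" by (rule atom_measurable[OF at])
  have m0: "0 \<le> gauss_mass TYPE('n)" and m3: "0 \<le> 3 * gauss_mass TYPE('n)" by (intro add_nonneg_nonneg mult_nonneg_nonneg; simp)+
  have G20: "0 \<le> ?G2" by simp
  show ?thesis
  proof (cases "a = (\<lambda>_. 1)")
    case True
    have "norm (LINT y|gauss. ?g y *\<^sub>R a y) \<le> (LINT y|gauss. norm (?g y *\<^sub>R a y))" by (rule integral_norm_bound)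
    also have "\<dots> = enn2real (\<integral>\<^sup>+y. ennreal (norm (?g y *\<^sub>R a y)) \<partial>gauss)"
      using am by (intro integral_eq_nn_integral) auto
    also have "\<dots> \<le> ?G2"
      using gauss_moment_finite[where 'n='n] K by (intro enn2real_mono nn_integral_mono ennreal_leI) (auto simp: True)
    finally show ?thesis by (rule order_trans) (rule add_increasing2[OF m3 order_refl])
  next
    case False
    then obtain c r where adm: "admissible c r" and supp: "AE y in gauss. y \<notin> cball c r \<longrightarrow> a y = 0"
      and mean: "(LINT y|gauss. a y) = 0"
      using at unfolding gaussian_atom_def by blast
    have gi: "integrable gauss (\<lambda>y. ?g y *\<^sub>R a y)"
      using K by (intro integrable_bounded_scaleR[OF ai, of _ K]) auto
    have "(LINT y|gauss. ?g y *\<^sub>R a y) = (LINT y|gauss. ?g y *\<^sub>R a y) - (LINT y|gauss. ?g c *\<^sub>R a y)"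
      using mean by simp
    also have "\<dots> = (LINT y|gauss. ?g y *\<^sub>R a y - ?g c *\<^sub>R a y)"
      by (rule Bochner_Integration.integral_diff[symmetric, OF gi]) (use ai in simp)
    also have "norm \<dots> \<le> (LINT y|gauss. norm (?g y *\<^sub>R a y - ?g c *\<^sub>R a y))" by (rule integral_norm_bound)
    also have "\<dots> \<le> (LINT y|gauss. 3 * norm (a y))"
    proof (rule integral_mono_AE)
      show "integrable gauss (\<lambda>y. norm (?g y *\<^sub>R a y - ?g c *\<^sub>R a y))"
        using ai by (intro integrable_norm Bochner_Integration.integrable_diff gi) simp
      show "integrable gauss (\<lambda>y. 3 * norm (a y))" using ai by simp
      show "AE y in gauss. norm (?g y *\<^sub>R a y - ?g c *\<^sub>R a y) \<le> 3 * norm (a y)"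
        using supp
      proof eventually_elim
        case (elim y)
        show ?case
        proof (cases "y \<in> cball c r")
          case True
          then have "\<bar>(norm y)\<^sup>2 - (norm c)\<^sup>2\<bar> \<le> 2 * 1 + 1\<^sup>2"
            using adm by (intro norm_sq_diff_adm) (auto simp: admissible_def dist_commute)
          then have "\<bar>?g y - ?g c\<bar> \<le> 3" by simp
          then have "\<bar>?g y - ?g c\<bar> * norm (a y) \<le> 3 * norm (a y)" by (rule mult_right_mono) simp
          then show ?thesis by (simp only: scaleR_diff_left[symmetric] norm_scaleR)
        qed (use elim in simp)
      qed
    qed
    also have "\<dots> = 3 * enn2real (\<integral>\<^sup>+y. ennreal (norm (a y)) \<partial>gauss)"
      using am by (subst integral_eq_nn_integral[symmetric]) auto
    also have "\<dots> \<le> 3 * gauss_mass TYPE('n)"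
      using atom_L1[OF at] m0 by (intro mult_left_mono enn2real_leI) auto
    finally show ?thesis using G20 by linarith
  qed
qed

text \<open>For nonnegative \<open>f\<close> the integral of the weighted modulus equals the modulus
  of the weighted integral, so the cancellation of the atoms can be exploited. The truncated weight
  is bounded and therefore compatible with \<open>L^1\<close> convergence; the resulting bound is
  uniform in \<open>K\<close>, and Fatou's lemma removes the truncation.\<close>

lemma E_plus_necessary:
  fixes f :: "real^'n \<Rightarrow> complex"
  assumes "f \<in> H1" and nonneg: "AE y in gauss. f y \<in> \<real>\<^sub>\<ge>\<^sub>0"
  shows "E_plus f < \<infinity>"
proof -
  from assms(1) obtain l a where f: "integrable gauss f" and d: "atomic_decomp f l a" by (auto simp: H1_def)
  have fm: "f \<in> borel_measurable borel" using f by (auto dest: borel_measurable_integrable)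
  have at: "gaussian_atom (a j)" for j using d by (simp add: atomic_decomp_def)
  have l: "summable (\<lambda>j. norm (l j))" using d by (simp add: atomic_decomp_def)
  note ai = atom_integrable[OF at]
  define A where "A = enn2real (\<integral>\<^sup>+y. ennreal (1 + (norm y)\<^sup>2) \<partial>(gauss :: (real^'n) measure)) + 3 * gauss_mass TYPE('n)"
  have A: "0 \<le> A" unfolding A_def by (intro add_nonneg_nonneg mult_nonneg_nonneg) auto
  let ?D = "\<lambda>N. \<integral>\<^sup>+y. ennreal (norm (f y - (\<Sum>j<N. l j * a j y))) \<partial>gauss"
  have D: "?D \<longlonglongrightarrow> 0" using d by (simp add: atomic_decomp_def)
  let ?g = "\<lambda>K (y::real^'n). min ((norm y)\<^sup>2) (real K)"
  have gi: "integrable gauss (\<lambda>y. ?g K y *\<^sub>R h y)" if "integrable gauss h" for K and h :: "real^'n \<Rightarrow> complex"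
    by (intro integrable_bounded_scaleR[OF that, of _ "real K"]) auto
  have main: "(\<integral>\<^sup>+y. ennreal (?g K y * norm (f y)) \<partial>gauss) \<le> ennreal ((\<Sum>j. norm (l j)) * A)" for K :: nat
  proof -
    have "(\<integral>\<^sup>+y. ennreal (?g K y * norm (f y)) \<partial>gauss) = ennreal (LINT y|gauss. ?g K y * norm (f y))"
    proof (rule nn_integral_eq_integral)
      show "integrable gauss (\<lambda>y. ?g K y * norm (f y))"
        using integrable_norm[OF gi[OF f, of K]] by simp
    qed simp
    also have "(LINT y|gauss. ?g K y * norm (f y)) = norm (LINT y|gauss. ?g K y *\<^sub>R f y)"
    proof -
      have "(LINT y|gauss. ?g K y *\<^sub>R f y) = (LINT y|gauss. complex_of_real (?g K y * norm (f y)))"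
      proof (rule integral_cong_AE)
        show "AE y in gauss. ?g K y *\<^sub>R f y = complex_of_real (?g K y * norm (f y))"
          using nonneg
        proof eventually_elim
          case (elim y)
          then obtain u where "f y = of_real u" "0 \<le> u" by (auto elim: nonneg_Reals_cases)
          then show ?case by (simp add: scaleR_conv_of_real)
        qed
      qed (use fm in measurable)
      also have "\<dots> = of_real (LINT y|gauss. ?g K y * norm (f y))" by (rule integral_complex_of_real)
      finally have "norm (LINT y|gauss. ?g K y *\<^sub>R f y) = \<bar>LINT y|gauss. ?g K y * norm (f y)\<bar>" by (simp only: norm_of_real)
      also have "\<dots> = (LINT y|gauss. ?g K y * norm (f y))" by (intro abs_of_nonneg integral_nonneg_AE) simp
      finally show ?thesis ..
    qed
    also have "ennreal (norm (LINT y|gauss. ?g K y *\<^sub>R f y)) \<le> ennreal ((\<Sum>j. norm (l j)) * A)"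
    proof -
      \<comment> \<open>The error term carries the factor \<open>K\<close>, which is harmless
        because \<open>K\<close> is fixed while \<open>N\<close> tends to infinity.\<close>
      have b: "ennreal (norm (LINT y|gauss. ?g K y *\<^sub>R f y)) \<le> ennreal (real K) * ?D N + ennreal ((\<Sum>j. norm (l j)) * A)" for N
      proof -
        let ?S = "\<lambda>y. \<Sum>j<N. l j * a j y"
        have iS: "integrable gauss ?S" using ai by (intro Bochner_Integration.integrable_sum integrable_mult_right)
        have iR: "integrable gauss (\<lambda>y. f y - ?S y)" by (rule Bochner_Integration.integrable_diff[OF f iS])
        have "(LINT y|gauss. ?g K y *\<^sub>R f y) = (LINT y|gauss. ?g K y *\<^sub>R (f y - ?S y) + (\<Sum>j<N. l j * (?g K y *\<^sub>R a j y)))"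
          by (rule Bochner_Integration.integral_cong[OF refl]) (simp add: scaleR_diff_right scaleR_sum_right)
        also have "\<dots> = (LINT y|gauss. ?g K y *\<^sub>R (f y - ?S y)) + (LINT y|gauss. (\<Sum>j<N. l j * (?g K y *\<^sub>R a j y)))"
          by (rule Bochner_Integration.integral_add[OF gi[OF iR]])
             (intro Bochner_Integration.integrable_sum integrable_mult_right gi ai)
        also have "(LINT y|gauss. (\<Sum>j<N. l j * (?g K y *\<^sub>R a j y))) = (\<Sum>j<N. LINT y|gauss. l j * (?g K y *\<^sub>R a j y))"
          by (rule Bochner_Integration.integral_sum) (intro integrable_mult_right gi ai)
        also have "\<dots> = (\<Sum>j<N. l j * (LINT y|gauss. ?g K y *\<^sub>R a j y))"
          by (rule sum.cong[OF refl]) (rule integral_mult_right_zero)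
        finally have "norm (LINT y|gauss. ?g K y *\<^sub>R f y) \<le> norm (LINT y|gauss. ?g K y *\<^sub>R (f y - ?S y)) + (\<Sum>j<N. norm (l j) * norm (LINT y|gauss. ?g K y *\<^sub>R a j y))"
          using norm_triangle_ineq[of "LINT y|gauss. ?g K y *\<^sub>R (f y - ?S y)" "\<Sum>j<N. l j * (LINT y|gauss. ?g K y *\<^sub>R a j y)"]
            norm_sum[of "\<lambda>j. l j * (LINT y|gauss. ?g K y *\<^sub>R a j y)" "{..<N}"] by (simp add: norm_mult)
        also have "(\<Sum>j<N. norm (l j) * norm (LINT y|gauss. ?g K y *\<^sub>R a j y)) \<le> (\<Sum>j<N. norm (l j) * A)"
          unfolding A_def by (intro sum_mono mult_left_mono atom_moment[OF at]) auto
        also have "\<dots> = (\<Sum>j<N. norm (l j)) * A" by (simp add: sum_distrib_right)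
        also have "\<dots> \<le> (\<Sum>j. norm (l j)) * A" using l A by (intro mult_right_mono sum_le_suminf) auto
        finally have "ennreal (norm (LINT y|gauss. ?g K y *\<^sub>R f y)) \<le> ennreal (norm (LINT y|gauss. ?g K y *\<^sub>R (f y - ?S y)) + (\<Sum>j. norm (l j)) * A)"
          by (intro ennreal_leI) simp
        also have "\<dots> = ennreal (norm (LINT y|gauss. ?g K y *\<^sub>R (f y - ?S y))) + ennreal ((\<Sum>j. norm (l j)) * A)"
          using A l by (intro ennreal_plus mult_nonneg_nonneg suminf_nonneg) auto
        also have "ennreal (norm (LINT y|gauss. ?g K y *\<^sub>R (f y - ?S y))) \<le> (\<integral>\<^sup>+y. ennreal (norm (?g K y *\<^sub>R (f y - ?S y))) \<partial>gauss)"
          by (rule integral_norm_bound_ennreal[OF gi[OF iR]])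
        also have "\<dots> \<le> (\<integral>\<^sup>+y. ennreal (real K) * ennreal (norm (f y - ?S y)) \<partial>gauss)"
          by (intro nn_integral_mono) (auto simp: ennreal_mult[symmetric] intro!: ennreal_leI mult_right_mono)
        also have "\<dots> = ennreal (real K) * ?D N"
          using borel_measurable_integrable[OF iR] by (intro nn_integral_cmult) simp
        finally show ?thesis by (simp add: add_right_mono)
      qed
      have "(\<lambda>N. ennreal (real K) * ?D N + ennreal ((\<Sum>j. norm (l j)) * A)) \<longlonglongrightarrow> ennreal (real K) * 0 + ennreal ((\<Sum>j. norm (l j)) * A)"
        by (intro tendsto_add tendsto_const ennreal_tendsto_cmult D) simp
      then show ?thesis using b by (intro LIMSEQ_le_const) auto
    qed
    finally show ?thesis .
  qed
  have "E_plus f = (\<integral>\<^sup>+y. liminf (\<lambda>K. ennreal (?g K y * norm (f y))) \<partial>gauss)"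
    unfolding E_plus_def
  proof (rule nn_integral_cong)
    fix y :: "real^'n"
    obtain K0 :: nat where "(norm y)\<^sup>2 \<le> real K0" using real_arch_simple by blast
    then have "\<forall>\<^sub>F K in sequentially. ennreal (?g K y * norm (f y)) = ennreal ((norm y)\<^sup>2 * norm (f y))"
      unfolding eventually_at_top_linorder by (intro exI[of _ K0] allI impI) (simp add: min_absorb1 order_trans)
    then have "(\<lambda>K. ennreal (?g K y * norm (f y))) \<longlonglongrightarrow> ennreal ((norm y)\<^sup>2 * norm (f y))" by (rule tendsto_eventually)
    then show "ennreal ((norm y)\<^sup>2 * norm (f y)) = liminf (\<lambda>K. ennreal (?g K y * norm (f y)))"
      by (intro lim_imp_Liminf[symmetric]) auto
  qed
  also have "\<dots> \<le> liminf (\<lambda>K. \<integral>\<^sup>+y. ennreal (?g K y * norm (f y)) \<partial>gauss)"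
    using fm by (intro nn_integral_liminf) measurable
  also have "\<dots> \<le> ennreal ((\<Sum>j. norm (l j)) * A)"
    by (rule order_trans[OF Liminf_mono[where g="\<lambda>_. ennreal ((\<Sum>j. norm (l j)) * A)"]])
       (auto simp: main Liminf_const)
  also have "\<dots> < \<infinity>" by simp
  finally show ?thesis .
qed

theorem theorem4p2:
  shows "(\<exists>C::real. 0 < C \<and>
           (\<forall>f :: real ^ 'n \<Rightarrow> complex.
              integrable gauss f \<longrightarrow> L1_ennreal (Mloc f) \<longrightarrow> E_plus f < \<infinity> \<longrightarrow>
              f \<in> H1 \<and>
              ennreal (H1_norm f) \<le>
                ennreal C * (\<integral>\<^sup>+x. Mloc f x \<partial>gauss) + ennreal C * E_plus f)) \<and>
         (\<forall>f :: real ^ 'n \<Rightarrow> complex.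
            integrable gauss f \<longrightarrow> (AE x in gauss. f x \<in> \<real>\<^sub>\<ge>\<^sub>0) \<longrightarrow> f \<in> H1 \<longrightarrow>
            L1_ennreal (Mloc f) \<and> E_plus f < \<infinity>)"
proof (intro conjI allI impI)
  obtain C where C: "0 < C" "\<And>f :: real^'n \<Rightarrow> complex. integrable gauss f \<Longrightarrow> L1_ennreal (Mloc f) \<Longrightarrow> E_plus f < \<infinity> \<Longrightarrow>
     dec f (C * (enn2real (\<integral>\<^sup>+y. Mloc f y \<partial>gauss) + enn2real (E_plus f)))"
    by (rule sufficiency) blast
  show "\<exists>C::real. 0 < C \<and>
           (\<forall>f :: real ^ 'n \<Rightarrow> complex.
              integrable gauss f \<longrightarrow> L1_ennreal (Mloc f) \<longrightarrow> E_plus f < \<infinity> \<longrightarrow>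
              f \<in> H1 \<and>
              ennreal (H1_norm f) \<le>
                ennreal C * (\<integral>\<^sup>+x. Mloc f x \<partial>gauss) + ennreal C * E_plus f)"
  proof (intro exI[of _ C] conjI allI impI C(1))
    fix f :: "real ^ 'n \<Rightarrow> complex"
    assume f: "integrable gauss f" and M: "L1_ennreal (Mloc f)" and E: "E_plus f < \<infinity>"
    let ?J = "\<integral>\<^sup>+x. Mloc f x \<partial>gauss"
    note d = dec_H1[OF C(2)[OF f M E] f]
    show "f \<in> H1" by (rule d(1))
    have "?J < \<infinity>" using M by (simp add: L1_ennreal_def)
    then have J: "?J = ennreal (enn2real ?J)" by (simp add: ennreal_enn2real_if)
    have E': "E_plus f = ennreal (enn2real (E_plus f))" using E by (simp add: ennreal_enn2real_if)
    have "ennreal (H1_norm f) \<le> ennreal (C * enn2real ?J + C * enn2real (E_plus f))"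
      using d(2) by (intro ennreal_leI) (simp only: distrib_left)
    also have "\<dots> = ennreal (C * enn2real ?J) + ennreal (C * enn2real (E_plus f))"
      using C(1) by (intro ennreal_plus mult_nonneg_nonneg enn2real_nonneg) auto
    also have "\<dots> = ennreal C * ennreal (enn2real ?J) + ennreal C * ennreal (enn2real (E_plus f))"
      using C(1) by (simp only: ennreal_mult less_imp_le enn2real_nonneg)
    also have "\<dots> = ennreal C * ?J + ennreal C * E_plus f" unfolding J[symmetric] E'[symmetric] ..
    finally show "ennreal (H1_norm f) \<le> ennreal C * ?J + ennreal C * E_plus f" .
  qed
next
  fix f :: "real ^ 'n \<Rightarrow> complex"
  assume "f \<in> H1"
  then show "L1_ennreal (Mloc f)" by (rule Mloc_necessary)
next
  fix f :: "real ^ 'n \<Rightarrow> complex"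
  assume "f \<in> H1" "AE x in gauss. f x \<in> \<real>\<^sub>\<ge>\<^sub>0"
  then show "E_plus f < \<infinity>" by (rule E_plus_necessary)
qed

end
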